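(* Let $V_1,\dots,V_l,W_1,\dots,W_l,U$ be finite dimensional $k$-vector spaces. A linear transformation $T:\bigoplus_{i=1}^{l}(V_i\otimes W_i)\to U$ satisfies the left omnipresent (respectively, left general) maximal rank property if and only if so does its dual $\operatorname{D}T:\operatorname{D}U\to\bigoplus_{i=1}^{l}(\operatorname{D}V_i\otimes\operatorname{D}W_i)$.
   Context: $k$ is a fixed algebraically closed field; $\otimes$ is over $k$; $\operatorname{D}=\operatorname{Hom}_k(\ ,k)$, and $\operatorname{D}(V_i\otimes W_i)$ is identified with $\operatorname{D}V_i\otimes\operatorname{D}W_i$ in the natural way. A linear map has maximal rank if it is injective or surjective. A linear transformation $T$ from $\bigoplus_i(V_i\otimes W_i)$ to a finite dimensional space satisfies the left omnipresent maximal rank property if for every choice of subspaces $V'_i\subset V_i$, $i=1,\dots,l$, the restriction of $T$ to $\bigoplus_i(V'_i\otimes W_i)$ has maximal rank; it satisfies the left general maximal rank property if this restriction has maximal rank for a general choice of subspaces $V'_i\subset V_i$. For finite dimensional spaces $A_i$, $C_i$, a linear transformation $S$ from a finite dimensional space to $\bigoplus_i(A_i\otimes C_i)$ satisfies the left omnipresent maximal rank property if for every choice of subspaces $A'_i\subset A_i$ the composition of $S$ with $\bigoplus_i(\sigma_i\otimes 1_{C_i}):\bigoplus_i(A_i\otimes C_i)\to\bigoplus_i((A_i/A'_i)\otimes C_i)$ has maximal rank, where $\sigma_i:A_i\to A_i/A'_i$ is the natural projection; it satisfies the left general maximal rank property if this composition has maximal rank for a general choice of subspaces $A'_i\subset A_i$.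 "For a general choice of subspaces" means: once the dimensions of the subspaces are fixed (arbitrarily), there is a dense Zariski open subset of the corresponding product of Grassmannians such that the assertion holds whenever the tuple of subspaces belongs to it. *)

theory Defs
  imports
    "HOL-Analysis.Abstract_Topology"
    "HOL-Algebra.Algebraic_Closure"
    "Jordan_Normal_Form.Missing_VectorSpace"
begin

text \<open>\<open>mult\<close> has to denote the record field.\<close>

hide_const (open) Multiset.mult

section \<open>Spaces of linear maps, duals, quotients, direct sums\<close>

text \<open>
  Vector spaces are module records over a field record \<open>K\<close>, with the locales \<open>vectorspace\<close>,
  \<open>subspace\<close> and \<open>linear_map\<close>. The ring fields \<open>mult\<close> and \<open>one\<close> of a module record carry no
  meaning; as in \<open>func_space\<close> they are filled with zeros.
  Linear maps that are themselves elements of a space are extensional, i.e. \<open>undefined\<close> outside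
  the carrier, so that equality of elements is equality of maps.
\<close>

definition hom_space ::
  "('k, 'r) ring_scheme \<Rightarrow> ('k, 'v, 'x) module_scheme \<Rightarrow> ('k, 'w, 'y) module_scheme
     \<Rightarrow> ('k, 'v \<Rightarrow> 'w) module"
  where "hom_space K V W =
    \<lparr>carrier = module_hom K V W \<inter> extensional (carrier V),
     mult = (\<lambda>f g. \<lambda>v\<in>carrier V. \<zero>\<^bsub>W\<^esub>),
     one = (\<lambda>v\<in>carrier V. \<zero>\<^bsub>W\<^esub>),
     zero = (\<lambda>v\<in>carrier V. \<zero>\<^bsub>W\<^esub>),
     add = (\<lambda>f g. \<lambda>v\<in>carrier V. f v \<oplus>\<^bsub>W\<^esub> g v),
     smult = (\<lambda>c f. \<lambda>v\<in>carrier V. c \<odot>\<^bsub>W\<^esub> f v)\<rparr>"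

definition scalar_space :: "('k, 'r) ring_scheme \<Rightarrow> ('k, 'k) module"
  where "scalar_space K =
    \<lparr>carrier = carrier K, mult = mult K, one = one K, zero = zero K, add = add K, smult = mult K\<rparr>"

definition dual_space ::
  "('k, 'r) ring_scheme \<Rightarrow> ('k, 'v, 'x) module_scheme \<Rightarrow> ('k, 'v \<Rightarrow> 'k) module"
  where "dual_space K V = hom_space K V (scalar_space K)"

text \<open>The transpose of a linear map \<open>f\<close> with domain \<open>V\<close>.\<close>

definition transpose_map ::
  "('k, 'v, 'x) module_scheme \<Rightarrow> ('v \<Rightarrow> 'u) \<Rightarrow> ('u \<Rightarrow> 'k) \<Rightarrow> 'v \<Rightarrow> 'k"
  where "transpose_map V f \<phi> = (\<lambda>v\<in>carrier V. \<phi> (f v))"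

text \<open>The quotient \<open>V/N\<close>; the natural projection is \<open>v \<mapsto> N +>\<^bsub>V\<^esub> v\<close>.\<close>

definition quot_space :: "('k, 'v, 'x) module_scheme \<Rightarrow> 'v set \<Rightarrow> ('k, 'v set) module"
  where "quot_space V N =
    \<lparr>carrier = a_rcosets\<^bsub>V\<^esub> N,
     mult = (\<lambda>C D. N),
     one = N,
     zero = N,
     add = (\<lambda>C D. C <+>\<^bsub>V\<^esub> D),
     smult = (\<lambda>c C. \<Union>x\<in>C. N +>\<^bsub>V\<^esub> (c \<odot>\<^bsub>V\<^esub> x))\<rparr>"

text \<open>The direct sum of a family, used for finite \<open>I\<close> only (for infinite \<open>I\<close> this would be the
  direct product).\<close>

definition dsum :: "'i set \<Rightarrow> ('i \<Rightarrow> ('k, 'v, 'x) module_scheme) \<Rightarrow> ('k, 'i \<Rightarrow> 'v) module"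
  where "dsum I M =
    \<lparr>carrier = (\<Pi>\<^sub>E i\<in>I. carrier (M i)),
     mult = (\<lambda>x y. \<lambda>i\<in>I. \<zero>\<^bsub>M i\<^esub>),
     one = (\<lambda>i\<in>I. \<zero>\<^bsub>M i\<^esub>),
     zero = (\<lambda>i\<in>I. \<zero>\<^bsub>M i\<^esub>),
     add = (\<lambda>x y. \<lambda>i\<in>I. x i \<oplus>\<^bsub>M i\<^esub> y i),
     smult = (\<lambda>c x. \<lambda>i\<in>I. c \<odot>\<^bsub>M i\<^esub> x i)\<rparr>"

definition dsum_inj :: "'i set \<Rightarrow> ('i \<Rightarrow> ('k, 'v, 'x) module_scheme) \<Rightarrow> 'i \<Rightarrow> 'v \<Rightarrow> 'i \<Rightarrow> 'v"
  where "dsum_inj I M j x = (\<lambda>i\<in>I. if i = j then x else \<zero>\<^bsub>M i\<^esub>)"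

definition dsum_map :: "'i set \<Rightarrow> ('i \<Rightarrow> 'v \<Rightarrow> 'w) \<Rightarrow> ('i \<Rightarrow> 'v) \<Rightarrow> 'i \<Rightarrow> 'w"
  where "dsum_map I f x = (\<lambda>i\<in>I. f i (x i))"


section \<open>Tensor products\<close>

text \<open>\<open>V \<otimes> W\<close> is the free vector space on \<open>V \<times> W\<close> modulo the span of the bilinearity relations.\<close>

definition free_space :: "('k, 'r) ring_scheme \<Rightarrow> 's set \<Rightarrow> ('k, 's \<Rightarrow> 'k) module"
  where "free_space K S =
    (ring.func_space K S)\<lparr>carrier := {r \<in> S \<rightarrow>\<^sub>E carrier K. finite {s \<in> S. r s \<noteq> \<zero>\<^bsub>K\<^esub>}}\<rparr>"

definition free_gen :: "('k, 'r) ring_scheme \<Rightarrow> 's set \<Rightarrow> 's \<Rightarrow> 's \<Rightarrow> 'k"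
  where "free_gen K S s = (\<lambda>t\<in>S. if t = s then \<one>\<^bsub>K\<^esub> else \<zero>\<^bsub>K\<^esub>)"

definition tensor_relations ::
  "('k, 'r) ring_scheme \<Rightarrow> ('k, 'v, 'x) module_scheme \<Rightarrow> ('k, 'w, 'y) module_scheme
     \<Rightarrow> ('v \<times> 'w \<Rightarrow> 'k) set"
  where "tensor_relations K V W =
    (let F = free_space K (carrier V \<times> carrier W);
         e = (\<lambda>v w. free_gen K (carrier V \<times> carrier W) (v, w))
     in {e (v \<oplus>\<^bsub>V\<^esub> v') w \<ominus>\<^bsub>F\<^esub> (e v w \<oplus>\<^bsub>F\<^esub> e v' w) | v v' w.
            v \<in> carrier V \<and> v' \<in> carrier V \<and> w \<in> carrier W}
      \<union> {e v (w \<oplus>\<^bsub>W\<^esub> w') \<ominus>\<^bsub>F\<^esub> (e v w \<oplus>\<^bsub>F\<^esub> e v w') | v w w'.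
            v \<in> carrier V \<and> w \<in> carrier W \<and> w' \<in> carrier W}
      \<union> {e (c \<odot>\<^bsub>V\<^esub> v) w \<ominus>\<^bsub>F\<^esub> (c \<odot>\<^bsub>F\<^esub> e v w) | c v w.
            c \<in> carrier K \<and> v \<in> carrier V \<and> w \<in> carrier W}
      \<union> {e v (c \<odot>\<^bsub>W\<^esub> w) \<ominus>\<^bsub>F\<^esub> (c \<odot>\<^bsub>F\<^esub> e v w) | c v w.
            c \<in> carrier K \<and> v \<in> carrier V \<and> w \<in> carrier W})"

definition tensor_null ::
  "('k, 'r) ring_scheme \<Rightarrow> ('k, 'v, 'x) module_scheme \<Rightarrow> ('k, 'w, 'y) module_scheme
     \<Rightarrow> ('v \<times> 'w \<Rightarrow> 'k) set"
  where "tensor_null K V W =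
    LinearCombinations.module.span K (free_space K (carrier V \<times> carrier W)) (tensor_relations K V W)"

definition tensor ::
  "('k, 'r) ring_scheme \<Rightarrow> ('k, 'v, 'x) module_scheme \<Rightarrow> ('k, 'w, 'y) module_scheme
     \<Rightarrow> ('k, ('v \<times> 'w \<Rightarrow> 'k) set) module"
  where "tensor K V W =
    quot_space (free_space K (carrier V \<times> carrier W)) (tensor_null K V W)"

definition pure_tensor ::
  "('k, 'r) ring_scheme \<Rightarrow> ('k, 'v, 'x) module_scheme \<Rightarrow> ('k, 'w, 'y) module_scheme
     \<Rightarrow> 'v \<Rightarrow> 'w \<Rightarrow> ('v \<times> 'w \<Rightarrow> 'k) set"
  where "pure_tensor K V W v w =
    tensor_null K V W +>\<^bsub>free_space K (carrier V \<times> carrier W)\<^esub>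
      free_gen K (carrier V \<times> carrier W) (v, w)"

text \<open>The linear map \<open>V \<otimes> W \<rightarrow> Y\<close> induced by a bilinear map \<open>b\<close>: a class is sent to the common
  value of \<open>\<Sum> r(v,w) b(v,w)\<close> over its representatives \<open>r\<close>.\<close>

definition tensor_lift ::
  "('k, 'r) ring_scheme \<Rightarrow> ('k, 'v, 'x) module_scheme \<Rightarrow> ('k, 'w, 'y) module_scheme
     \<Rightarrow> ('k, 'u, 'z) module_scheme \<Rightarrow> ('v \<Rightarrow> 'w \<Rightarrow> 'u) \<Rightarrow> ('v \<times> 'w \<Rightarrow> 'k) set \<Rightarrow> 'u"
  where "tensor_lift K V W Y b =
    (\<lambda>C\<in>carrier (tensor K V W).
       the_elem ((\<lambda>r. \<Oplus>\<^bsub>Y\<^esub>p\<in>{p \<in> carrier V \<times> carrier W. r p \<noteq> \<zero>\<^bsub>K\<^esub>}.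
                        r p \<odot>\<^bsub>Y\<^esub> b (fst p) (snd p)) ` C))"

text \<open>\<open>f \<otimes> g : V \<otimes> W \<rightarrow> V' \<otimes> W'\<close>\<close>

definition tensor_map ::
  "('k, 'r) ring_scheme \<Rightarrow> ('k, 'v, 'x) module_scheme \<Rightarrow> ('k, 'w, 'y) module_scheme
     \<Rightarrow> ('k, 'v', 'x') module_scheme \<Rightarrow> ('k, 'w', 'y') module_scheme
     \<Rightarrow> ('v \<Rightarrow> 'v') \<Rightarrow> ('w \<Rightarrow> 'w') \<Rightarrow> ('v \<times> 'w \<Rightarrow> 'k) set \<Rightarrow> ('v' \<times> 'w' \<Rightarrow> 'k) set"
  where "tensor_map K V W V' W' f g =
    tensor_lift K V W (tensor K V' W') (\<lambda>v w. pure_tensor K V' W' (f v) (g w))"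

text \<open>The natural map \<open>DV \<otimes> DW \<rightarrow> D(V \<otimes> W)\<close>, \<open>\<phi> \<otimes> \<psi> \<mapsto> (v \<otimes> w \<mapsto> \<phi>(v) \<psi>(w))\<close>; it is bijective
  in finite dimension, and its inverse identifies \<open>D(V \<otimes> W)\<close> with \<open>DV \<otimes> DW\<close>.\<close>

definition dual_tensor ::
  "('k, 'r) ring_scheme \<Rightarrow> ('k, 'v, 'x) module_scheme \<Rightarrow> ('k, 'w, 'y) module_scheme
     \<Rightarrow> (('v \<Rightarrow> 'k) \<times> ('w \<Rightarrow> 'k) \<Rightarrow> 'k) set \<Rightarrow> ('v \<times> 'w \<Rightarrow> 'k) set \<Rightarrow> 'k"
  where "dual_tensor K V W =
    tensor_lift K (dual_space K V) (dual_space K W) (dual_space K (tensor K V W))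
      (\<lambda>\<phi> \<psi>. tensor_lift K V W (scalar_space K) (\<lambda>v w. \<phi> v \<otimes>\<^bsub>K\<^esub> \<psi> w))"

text \<open>The source \<open>\<Oplus>\<^sub>i (V\<^sub>i \<otimes> W\<^sub>i)\<close> of the linear transformations considered.\<close>

definition tensor_sum ::
  "('k, 'r) ring_scheme \<Rightarrow> 'i set \<Rightarrow> ('i \<Rightarrow> ('k, 'v, 'x) module_scheme)
     \<Rightarrow> ('i \<Rightarrow> ('k, 'w, 'y) module_scheme) \<Rightarrow> ('k, 'i \<Rightarrow> ('v \<times> 'w \<Rightarrow> 'k) set) module"
  where "tensor_sum K I V W = dsum I (\<lambda>i. tensor K (V i) (W i))"

text \<open>\<open>DT : DU \<rightarrow> \<Oplus>\<^sub>i (DV\<^sub>i \<otimes> DW\<^sub>i)\<close> for \<open>T : \<Oplus>\<^sub>i (V\<^sub>i \<otimes> W\<^sub>i) \<rightarrow> U\<close>: the transpose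
  \<open>DU \<rightarrow> D(\<Oplus>\<^sub>i (V\<^sub>i \<otimes> W\<^sub>i))\<close>, followed by restriction of a functional to the summands and by the
  identification of \<open>D(V\<^sub>i \<otimes> W\<^sub>i)\<close> with \<open>DV\<^sub>i \<otimes> DW\<^sub>i\<close>.\<close>

definition dual_transformation ::
  "('k, 'r) ring_scheme \<Rightarrow> 'i set \<Rightarrow> ('i \<Rightarrow> ('k, 'v, 'x) module_scheme)
     \<Rightarrow> ('i \<Rightarrow> ('k, 'w, 'y) module_scheme)
     \<Rightarrow> (('i \<Rightarrow> ('v \<times> 'w \<Rightarrow> 'k) set) \<Rightarrow> 'u)
     \<Rightarrow> ('u \<Rightarrow> 'k) \<Rightarrow> 'i \<Rightarrow> (('v \<Rightarrow> 'k) \<times> ('w \<Rightarrow> 'k) \<Rightarrow> 'k) set"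
  where "dual_transformation K I V W T \<phi> =
    (\<lambda>i\<in>I. inv_into (carrier (tensor K (dual_space K (V i)) (dual_space K (W i))))
             (dual_tensor K (V i) (W i))
             (transpose_map (tensor K (V i) (W i)) (dsum_inj I (\<lambda>i. tensor K (V i) (W i)) i)
               (transpose_map (tensor_sum K I V W) T \<phi>)))"


section \<open>Zariski topology on products of Grassmannians\<close>

text \<open>Polynomial functions on a vector space: the algebra of functions generated by the constants
  and the linear functionals.\<close>

inductive_set poly_functions ::
  "('k, 'r) ring_scheme \<Rightarrow> ('k, 'v, 'x) module_scheme \<Rightarrow> ('v \<Rightarrow> 'k) set"
  for K and V
where
  const: "c \<in> carrier K \<Longrightarrow> (\<lambda>v\<in>carrier V. c) \<in> poly_functions K V"
| functional: "\<phi> \<in> carrier (dual_space K V) \<Longrightarrow> \<phi> \<in> poly_functions K V"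
| add: "\<lbrakk>p \<in> poly_functions K V; q \<in> poly_functions K V\<rbrakk>
        \<Longrightarrow> (\<lambda>v\<in>carrier V. p v \<oplus>\<^bsub>K\<^esub> q v) \<in> poly_functions K V"
| mult: "\<lbrakk>p \<in> poly_functions K V; q \<in> poly_functions K V\<rbrakk>
        \<Longrightarrow> (\<lambda>v\<in>carrier V. p v \<otimes>\<^bsub>K\<^esub> q v) \<in> poly_functions K V"

text \<open>The Zariski topology of a finite dimensional vector space regarded as an affine space, generated
  by the principal open sets.\<close>

definition zariski_topology ::
  "('k, 'r) ring_scheme \<Rightarrow> ('k, 'v, 'x) module_scheme \<Rightarrow> 'v topology"
  where "zariski_topology K V =
    topology_generated_by {{v \<in> carrier V. p v \<noteq> \<zero>\<^bsub>K\<^esub>} | p. p \<in> poly_functions K V}"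

definition grassmannian ::
  "('k, 'r) ring_scheme \<Rightarrow> ('k, 'v, 'x) module_scheme \<Rightarrow> nat \<Rightarrow> 'v set set"
  where "grassmannian K V d =
    {S. VectorSpace.subspace K S V \<and> vectorspace.dim K (V\<lparr>carrier := S\<rparr>) = d}"

definition complementary ::
  "('k, 'r) ring_scheme \<Rightarrow> ('k, 'v, 'x) module_scheme \<Rightarrow> 'v set \<Rightarrow> 'v set \<Rightarrow> bool"
  where "complementary K V A B \<longleftrightarrow>
    VectorSpace.subspace K A V \<and> VectorSpace.subspace K B V \<and>
    A \<inter> B = {\<zero>\<^bsub>V\<^esub>} \<and> A <+>\<^bsub>V\<^esub> B = carrier V"

text \<open>
  Every family of decompositions \<open>V\<^sub>i = A\<^sub>i \<oplus> B\<^sub>i\<close> with \<open>dim A\<^sub>i = d\<^sub>i\<close> gives a standard affine chart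
  of \<open>\<Prod>\<^sub>i Gr(d\<^sub>i, V\<^sub>i)\<close>: it is parametrised by the vector space \<open>\<Prod>\<^sub>i Hom(A\<^sub>i, B\<^sub>i)\<close>, a family of
  linear maps being sent to the family of their graphs.
\<close>

definition chart_space ::
  "('k, 'r) ring_scheme \<Rightarrow> 'i set \<Rightarrow> ('i \<Rightarrow> ('k, 'v, 'x) module_scheme)
     \<Rightarrow> ('i \<Rightarrow> 'v set) \<Rightarrow> ('i \<Rightarrow> 'v set) \<Rightarrow> ('k, 'i \<Rightarrow> 'v \<Rightarrow> 'v) module"
  where "chart_space K I V A B =
    dsum I (\<lambda>i. hom_space K ((V i)\<lparr>carrier := A i\<rparr>) ((V i)\<lparr>carrier := B i\<rparr>))"

definition graph_chart ::
  "'i set \<Rightarrow> ('i \<Rightarrow> ('k, 'v, 'x) module_scheme) \<Rightarrow> ('i \<Rightarrow> 'v set) \<Rightarrow> ('i \<Rightarrow> 'v \<Rightarrow> 'v) \<Rightarrow> 'i \<Rightarrow> 'v set"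
  where "graph_chart I V A f = (\<lambda>i\<in>I. (\<lambda>a. a \<oplus>\<^bsub>V i\<^esub> f i a) ` A i)"

text \<open>A subset of the product of Grassmannians is Zariski open iff its trace on every chart is. In
  general this topology is strictly finer than the product of the Zariski topologies.\<close>

definition grassmannian_open ::
  "('k, 'r) ring_scheme \<Rightarrow> 'i set \<Rightarrow> ('i \<Rightarrow> ('k, 'v, 'x) module_scheme) \<Rightarrow> ('i \<Rightarrow> nat)
     \<Rightarrow> ('i \<Rightarrow> 'v set) set \<Rightarrow> bool"
  where "grassmannian_open K I V d Z \<longleftrightarrow>
    Z \<subseteq> (\<Pi>\<^sub>E i\<in>I. grassmannian K (V i) (d i)) \<and>
    (\<forall>A B. (\<forall>i\<in>I. A i \<in> grassmannian K (V i) (d i) \<and> complementary K (V i) (A i) (B i)) \<longrightarrow>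
       openin (zariski_topology K (chart_space K I V A B))
         {f \<in> carrier (chart_space K I V A B). graph_chart I V A f \<in> Z})"

lemma istopology_grassmannian_open: "istopology (grassmannian_open K I V d)"
proof -
  have "grassmannian_open K I V d (S \<inter> T)"
    if S: "grassmannian_open K I V d S" and T: "grassmannian_open K I V d T" for S T
    unfolding grassmannian_open_def
  proof (intro conjI allI impI)
    show "S \<inter> T \<subseteq> (\<Pi>\<^sub>E i\<in>I. grassmannian K (V i) (d i))"
      using S by (auto simp: grassmannian_open_def)
    fix A B
    assume AB: "\<forall>i\<in>I. A i \<in> grassmannian K (V i) (d i) \<and> complementary K (V i) (A i) (B i)"
    let ?X = "carrier (chart_space K I V A B)"
    have "openin (zariski_topology K (chart_space K I V A B))
            ({f \<in> ?X. graph_chart I V A f \<in> S} \<inter> {f \<in> ?X. graph_chart I V A f \<in> T})"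
      using S T AB by (intro openin_Int) (auto simp: grassmannian_open_def)
    also have "{f \<in> ?X. graph_chart I V A f \<in> S} \<inter> {f \<in> ?X. graph_chart I V A f \<in> T}
                = {f \<in> ?X. graph_chart I V A f \<in> S \<inter> T}"
      by auto
    finally show "openin (zariski_topology K (chart_space K I V A B))
            {f \<in> ?X. graph_chart I V A f \<in> S \<inter> T}" .
  qed
  moreover have "grassmannian_open K I V d (\<Union>\<Z>)"
    if Z: "\<forall>S\<in>\<Z>. grassmannian_open K I V d S" for \<Z>
    unfolding grassmannian_open_def
  proof (intro conjI allI impI)
    show "\<Union>\<Z> \<subseteq> (\<Pi>\<^sub>E i\<in>I. grassmannian K (V i) (d i))"
      using Z unfolding grassmannian_open_def by blast
    fix A B
    assume AB: "\<forall>i\<in>I. A i \<in> grassmannian K (V i) (d i) \<and> complementary K (V i) (A i) (B i)"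
    let ?X = "carrier (chart_space K I V A B)"
    have "openin (zariski_topology K (chart_space K I V A B))
            (\<Union>S\<in>\<Z>. {f \<in> ?X. graph_chart I V A f \<in> S})"
      using Z AB by (intro openin_Union) (auto simp: grassmannian_open_def)
    also have "(\<Union>S\<in>\<Z>. {f \<in> ?X. graph_chart I V A f \<in> S}) = {f \<in> ?X. graph_chart I V A f \<in> \<Union>\<Z>}"
      by auto
    finally show "openin (zariski_topology K (chart_space K I V A B))
            {f \<in> ?X. graph_chart I V A f \<in> \<Union>\<Z>}" .
  qed
  ultimately show ?thesis
    unfolding istopology_def by blast
qed

definition grassmannian_topology ::
  "('k, 'r) ring_scheme \<Rightarrow> 'i set \<Rightarrow> ('i \<Rightarrow> ('k, 'v, 'x) module_scheme) \<Rightarrow> ('i \<Rightarrow> nat)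
     \<Rightarrow> ('i \<Rightarrow> 'v set) topology"
  where "grassmannian_topology K I V d = topology (grassmannian_open K I V d)"

lemma openin_grassmannian_topology:
  "openin (grassmannian_topology K I V d) = grassmannian_open K I V d"
  unfolding grassmannian_topology_def
  by (rule topology_inverse') (rule istopology_grassmannian_open)

text \<open>\<open>P\<close> holds for a general choice of subspaces of the \<open>V\<^sub>i\<close>. Dimensions \<open>d\<^sub>i > dim V\<^sub>i\<close> need not be
  excluded: the product of Grassmannians is then empty.\<close>

definition general_subspaces ::
  "('k, 'r) ring_scheme \<Rightarrow> 'i set \<Rightarrow> ('i \<Rightarrow> ('k, 'v, 'x) module_scheme)
     \<Rightarrow> (('i \<Rightarrow> 'v set) \<Rightarrow> bool) \<Rightarrow> bool"
  where "general_subspaces K I V P \<longleftrightarrow>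
    (\<forall>d. \<exists>\<Omega>. openin (grassmannian_topology K I V d) \<Omega> \<and>
             (grassmannian_topology K I V d) closure_of \<Omega> =
               (\<Pi>\<^sub>E i\<in>I. grassmannian K (V i) (d i)) \<and>
             (\<forall>V'\<in>\<Omega>. P V'))"


section \<open>Maximal rank properties\<close>

definition maximal_rank ::
  "('k, 'v, 'x) module_scheme \<Rightarrow> ('k, 'w, 'y) module_scheme \<Rightarrow> ('v \<Rightarrow> 'w) \<Rightarrow> bool"
  where "maximal_rank V W f \<longleftrightarrow> inj_on f (carrier V) \<or> f ` carrier V = carrier W"

text \<open>The restriction of \<open>T\<close> to \<open>\<Oplus>\<^sub>i (V'\<^sub>i \<otimes> W\<^sub>i)\<close>, i.e. its composition with the natural injection
  into \<open>\<Oplus>\<^sub>i (V\<^sub>i \<otimes> W\<^sub>i)\<close>, has maximal rank.\<close>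

definition restriction_maximal_rank ::
  "('k, 'r) ring_scheme \<Rightarrow> 'i set \<Rightarrow> ('i \<Rightarrow> ('k, 'v, 'x) module_scheme)
     \<Rightarrow> ('i \<Rightarrow> ('k, 'w, 'y) module_scheme) \<Rightarrow> ('k, 'u, 'z) module_scheme
     \<Rightarrow> (('i \<Rightarrow> ('v \<times> 'w \<Rightarrow> 'k) set) \<Rightarrow> 'u) \<Rightarrow> ('i \<Rightarrow> 'v set) \<Rightarrow> bool"
  where "restriction_maximal_rank K I V W U T V' \<longleftrightarrow>
    maximal_rank (tensor_sum K I (\<lambda>i. (V i)\<lparr>carrier := V' i\<rparr>) W) U
      (T \<circ> dsum_map I
         (\<lambda>i. tensor_map K ((V i)\<lparr>carrier := V' i\<rparr>) (W i) (V i) (W i) (\<lambda>v. v) (\<lambda>w. w)))"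

text \<open>The composition of \<open>S\<close> with \<open>\<Oplus>\<^sub>i (A\<^sub>i \<otimes> C\<^sub>i) \<rightarrow> \<Oplus>\<^sub>i ((A\<^sub>i/A'\<^sub>i) \<otimes> C\<^sub>i)\<close> has maximal rank.\<close>

definition projection_maximal_rank ::
  "('k, 'r) ring_scheme \<Rightarrow> 'i set \<Rightarrow> ('k, 'u, 'z) module_scheme
     \<Rightarrow> ('i \<Rightarrow> ('k, 'v, 'x) module_scheme) \<Rightarrow> ('i \<Rightarrow> ('k, 'w, 'y) module_scheme)
     \<Rightarrow> ('u \<Rightarrow> 'i \<Rightarrow> ('v \<times> 'w \<Rightarrow> 'k) set) \<Rightarrow> ('i \<Rightarrow> 'v set) \<Rightarrow> bool"
  where "projection_maximal_rank K I Y A C S A' \<longleftrightarrow>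
    maximal_rank Y (tensor_sum K I (\<lambda>i. quot_space (A i) (A' i)) C)
      (dsum_map I
         (\<lambda>i. tensor_map K (A i) (C i) (quot_space (A i) (A' i)) (C i)
                (\<lambda>a. A' i +>\<^bsub>A i\<^esub> a) (\<lambda>c. c)) \<circ> S)"

definition left_omnipresent_from where
  "left_omnipresent_from K I V W U T \<longleftrightarrow>
    (\<forall>V'. (\<forall>i\<in>I. VectorSpace.subspace K (V' i) (V i)) \<longrightarrow> restriction_maximal_rank K I V W U T V')"

definition left_general_from where
  "left_general_from K I V W U T \<longleftrightarrow>
    general_subspaces K I V (restriction_maximal_rank K I V W U T)"

definition left_omnipresent_to where
  "left_omnipresent_to K I Y A C S \<longleftrightarrow>
    (\<forall>A'. (\<forall>i\<in>I. VectorSpace.subspace K (A' i) (A i)) \<longrightarrow> projection_maximal_rank K I Y A C S A')"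

definition left_general_to where
  "left_general_to K I Y A C S \<longleftrightarrow>
    general_subspaces K I A (projection_maximal_rank K I Y A C S)"

end

theory Submission
  imports Defs
begin

text \<open>
  Dualizing the restriction of \<open>T\<close> to \<open>\<Oplus>\<^sub>i (V'\<^sub>i \<otimes> W\<^sub>i)\<close> gives, up to the isomorphisms
  \<open>(DV\<^sub>i/A\<^sub>i) \<otimes> DW\<^sub>i \<cong> D(V'\<^sub>i \<otimes> W\<^sub>i)\<close> with \<open>A\<^sub>i\<close> the annihilator of \<open>V'\<^sub>i\<close>, the composition of \<open>DT\<close>
  with the projection modulo the \<open>A\<^sub>i\<close>; and a linear map is injective (surjective) iff its
  transpose is surjective (injective). Hence the restriction to \<open>(V'\<^sub>i)\<close> has maximal rank iff the
  projection modulo \<open>(A\<^sub>i)\<close> has. Every subspace of \<open>DV\<^sub>i\<close> is an annihilator, which settles the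
  omnipresent properties; for the general ones, passing to annihilators is linear in the standard
  charts and therefore a homeomorphism between the products of Grassmannians.
\<close>

section \<open>Linear maps and subspaces\<close>

text \<open>A tensor product is a set of cosets of functions on a product of carriers, so N
  \<otimes> W is not a subset of V \<otimes> W, and the identification of D(V \<otimes> W) with DV
  \<otimes> DW enters the dual map as an \<open>inv_into\<close>. Elements are therefore compared
  after mapping them into a dual space, where values at pure tensors decide. One lemma,
  \<open>pairing_bij\<close>, serves twice: it makes \<open>dual_tensor\<close> bijective, and it
  makes (DV/A) \<otimes> DW the dual of N \<otimes> W. Finite dimension is used through dual bases,
  families of vectors and functionals over a common finite index set. A basis adapted to N splits
  the index set into a part for N and a part for its annihilator. Openness in the product of
  Grassmannians is tested on the charts of all complementary pairs, so every chart on the dual side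
  has to come from one on the original side; preannihilators supply it. Dimensions correspond by d
  \<mapsto> dim V - d, which needs d \<le> dim V; larger dimensions give an empty product and are
  treated apart.\<close>

lemma linear_mapI:
  assumes "vectorspace K V" "vectorspace K W"
    and "\<And>v. v \<in> carrier V \<Longrightarrow> f v \<in> carrier W"
    and "\<And>v w. v \<in> carrier V \<Longrightarrow> w \<in> carrier V \<Longrightarrow> f (v \<oplus>\<^bsub>V\<^esub> w) = f v \<oplus>\<^bsub>W\<^esub> f w"
    and "\<And>c v. c \<in> carrier K \<Longrightarrow> v \<in> carrier V \<Longrightarrow> f (c \<odot>\<^bsub>V\<^esub> v) = c \<odot>\<^bsub>W\<^esub> f v"
  shows "linear_map K V W f"
  using assms unfolding linear_map_def mod_hom_def mod_hom_axioms_def module_hom_def vectorspace_def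
  by auto

lemma linear_map_vs:
  assumes "linear_map K V W f"
  shows "vectorspace K V" "vectorspace K W"
  using assms by (auto simp: linear_map_def)

lemma linear_map_closed:
  "\<lbrakk>linear_map K V W f; v \<in> carrier V\<rbrakk> \<Longrightarrow> f v \<in> carrier W"
  unfolding linear_map_def mod_hom_def mod_hom_axioms_def module_hom_def by auto

lemma linear_map_add:
  "\<lbrakk>linear_map K V W f; v \<in> carrier V; w \<in> carrier V\<rbrakk> \<Longrightarrow> f (v \<oplus>\<^bsub>V\<^esub> w) = f v \<oplus>\<^bsub>W\<^esub> f w"
  unfolding linear_map_def mod_hom_def mod_hom_axioms_def module_hom_def by auto

lemma linear_map_smult:
  "\<lbrakk>linear_map K V W f; c \<in> carrier K; v \<in> carrier V\<rbrakk> \<Longrightarrow> f (c \<odot>\<^bsub>V\<^esub> v) = c \<odot>\<^bsub>W\<^esub> f v"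
  unfolding linear_map_def mod_hom_def mod_hom_axioms_def module_hom_def by auto

lemma linear_map_zero: "linear_map K V W f \<Longrightarrow> f \<zero>\<^bsub>V\<^esub> = \<zero>\<^bsub>W\<^esub>"
  by (rule linear_map.T0_is_0)

lemma linear_map_minus:
  "\<lbrakk>linear_map K V W f; v \<in> carrier V; w \<in> carrier V\<rbrakk> \<Longrightarrow> f (v \<ominus>\<^bsub>V\<^esub> w) = f v \<ominus>\<^bsub>W\<^esub> f w"
  by (rule linear_map.T_minus)

lemma module_hom_iff:
  "\<lbrakk>vectorspace K V; vectorspace K W\<rbrakk> \<Longrightarrow> f \<in> module_hom K V W \<longleftrightarrow> linear_map K V W f"
  unfolding linear_map_def mod_hom_def mod_hom_axioms_def vectorspace_def by auto

text \<open>Linearity depends only on values on the carrier. This is what lets a formula be replaced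
  by its restriction to the carrier, the form in which maps become elements of a space.\<close>

lemma linear_map_cong:
  assumes "linear_map K V W f" "\<And>v. v \<in> carrier V \<Longrightarrow> g v = f v"
  shows "linear_map K V W g"
proof -
  interpret linear_map K V W f by fact
  show ?thesis
    using assms(2) by (intro linear_mapI V.vectorspace_axioms W.vectorspace_axioms) auto
qed

lemma linear_map_comp:
  assumes "linear_map K V W f" "linear_map K W Y g"
  shows "linear_map K V Y (\<lambda>v. g (f v))"
proof -
  interpret f: linear_map K V W f by fact
  interpret g: linear_map K W Y g by fact
  show ?thesis
    by (intro linear_mapI f.V.vectorspace_axioms g.W.vectorspace_axioms) auto
qed

lemma linear_map_id: "vectorspace K V \<Longrightarrow> linear_map K V V (\<lambda>v. v)"
  by (rule linear_mapI) auto

text \<open>The index set may be infinite: both sums are then zero by convention, and the claim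
  reduces to f mapping zero to zero.\<close>

lemma linear_map_finsum:
  assumes "linear_map K V W f" and "g \<in> A \<rightarrow> carrier V"
  shows "f (\<Oplus>\<^bsub>V\<^esub>a\<in>A. g a) = (\<Oplus>\<^bsub>W\<^esub>a\<in>A. f (g a))"
proof -
  interpret linear_map K V W f by fact
  show ?thesis
    using assms(2)
  proof (induction A rule: infinite_finite_induct)
    case (insert a A)
    then show ?case by (simp add: V.module.M.finsum_insert W.module.M.finsum_insert Pi_iff)
  qed auto
qed

lemma linear_map_injI:
  assumes "linear_map K V W f" and "\<And>v. v \<in> carrier V \<Longrightarrow> f v = \<zero>\<^bsub>W\<^esub> \<Longrightarrow> v = \<zero>\<^bsub>V\<^esub>"
  shows "inj_on f (carrier V)"
proof -
  interpret linear_map K V W f by fact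
  show ?thesis
    using assms(2) by (intro Ke0_imp_inj) (auto simp: mod_hom.ker_def)
qed

lemma linear_map_inv_into:
  assumes f: "linear_map K V W f" and bij: "bij_betw f (carrier V) (carrier W)"
  shows "linear_map K W V (inv_into (carrier V) f)"
proof -
  interpret linear_map K V W f by fact
  let ?g = "inv_into (carrier V) f"
  have g: "?g w \<in> carrier V" "f (?g w) = w" if "w \<in> carrier W" for w
    using bij that by (auto simp: bij_betw_def f_inv_into_f inv_into_into)
  have inj: "v = v'" if "v \<in> carrier V" "v' \<in> carrier V" "f v = f v'" for v v'
    using bij that by (auto simp: bij_betw_def inj_on_def)
  show ?thesis
    by (rule linear_mapI[OF W.vectorspace_axioms V.vectorspace_axioms])
      (auto intro!: inj simp: g)
qed

lemma subspaceI:
  assumes "vectorspace K V" "N \<subseteq> carrier V" "\<zero>\<^bsub>V\<^esub> \<in> N"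
    and "\<And>v w. v \<in> N \<Longrightarrow> w \<in> N \<Longrightarrow> v \<oplus>\<^bsub>V\<^esub> w \<in> N"
    and "\<And>c v. c \<in> carrier K \<Longrightarrow> v \<in> N \<Longrightarrow> c \<odot>\<^bsub>V\<^esub> v \<in> N"
  shows "VectorSpace.subspace K N V"
  using assms unfolding VectorSpace.subspace_def submodule_def vectorspace_def by auto

lemma subspaceD:
  assumes "VectorSpace.subspace K N V"
  shows "vectorspace K V" "N \<subseteq> carrier V" "\<zero>\<^bsub>V\<^esub> \<in> N"
    and "\<And>v w. v \<in> N \<Longrightarrow> w \<in> N \<Longrightarrow> v \<oplus>\<^bsub>V\<^esub> w \<in> N"
    and "\<And>c v. c \<in> carrier K \<Longrightarrow> v \<in> N \<Longrightarrow> c \<odot>\<^bsub>V\<^esub> v \<in> N"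
  using assms unfolding VectorSpace.subspace_def submodule_def by auto

lemma subspace_vs: "VectorSpace.subspace K N V \<Longrightarrow> vectorspace K (V\<lparr>carrier := N\<rparr>)"
  by (rule vectorspace.subspace_is_vs[OF subspaceD(1)])

lemma subspace_minus:
  assumes "VectorSpace.subspace K N V" "v \<in> N" "w \<in> N"
  shows "v \<ominus>\<^bsub>V\<^esub> w \<in> N"
proof -
  interpret vectorspace K V by (rule subspaceD(1)[OF assms(1)])
  \<comment> \<open>The closure properties of a subspace mention sums and multiples only, so the
    difference is written with the scalar -1.\<close>
  have "v \<ominus>\<^bsub>V\<^esub> w = v \<oplus>\<^bsub>V\<^esub> (\<ominus>\<^bsub>K\<^esub> \<one>\<^bsub>K\<^esub>) \<odot>\<^bsub>V\<^esub> w"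
    using assms subspaceD(2)[OF assms(1)] by (auto simp: a_minus_def smult_minus_1)
  then show ?thesis
    using assms subspaceD[OF assms(1)] by auto
qed

lemma subspace_finsum:
  assumes N: "VectorSpace.subspace K N V" and "g \<in> A \<rightarrow> N"
  shows "(\<Oplus>\<^bsub>V\<^esub>a\<in>A. g a) \<in> N"
proof -
  interpret vectorspace K V by (rule subspaceD(1)[OF N])
  show ?thesis
    using assms(2)
  proof (induction A rule: infinite_finite_induct)
    case (insert a A)
    then have "g \<in> A \<rightarrow> carrier V" "g a \<in> carrier V" using subspaceD(2)[OF N] by auto
    with insert show ?case by (subst finsum_insert) (auto intro: subspaceD(4)[OF N])
  qed (auto simp: subspaceD(3)[OF N])
qed

lemma linear_map_restrict:
  assumes "linear_map K V W f" "VectorSpace.subspace K N V"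
  shows "linear_map K (V\<lparr>carrier := N\<rparr>) W f"
proof -
  interpret linear_map K V W f by fact
  have "v \<in> carrier V" if "v \<in> N" for v using subspaceD(2)[OF assms(2)] that by auto
  then show ?thesis
    by (intro linear_mapI subspace_vs[OF assms(2)] W.vectorspace_axioms) auto
qed

lemma linear_map_into_subspace:
  assumes "linear_map K V W f" "VectorSpace.subspace K N W" "\<And>v. v \<in> carrier V \<Longrightarrow> f v \<in> N"
  shows "linear_map K V (W\<lparr>carrier := N\<rparr>) f"
proof -
  interpret linear_map K V W f by fact
  show ?thesis
    using assms(3) by (intro linear_mapI subspace_vs[OF assms(2)] V.vectorspace_axioms) auto
qed

lemma linear_map_from_subspace:
  assumes "linear_map K V (W\<lparr>carrier := N\<rparr>) f" "VectorSpace.subspace K N W"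
  shows "linear_map K V W f"
proof -
  interpret linear_map K V "W\<lparr>carrier := N\<rparr>" f by fact
  have "f v \<in> carrier W" if "v \<in> carrier V" for v
    using linear_map_closed[OF assms(1) that] subspaceD(2)[OF assms(2)] by auto
  with linear_map_add[OF assms(1)] linear_map_smult[OF assms(1)] show ?thesis
    by (intro linear_mapI subspaceD(1)[OF assms(2)] V.vectorspace_axioms) auto
qed

lemma kernel_subspace:
  assumes "linear_map K V W f"
  shows "VectorSpace.subspace K {v \<in> carrier V. f v = \<zero>\<^bsub>W\<^esub>} V"
proof -
  interpret linear_map K V W f by fact
  show ?thesis by (intro subspaceI V.vectorspace_axioms) auto
qed

lemma image_subspace:
  assumes "linear_map K V W f" "VectorSpace.subspace K N V"
  shows "VectorSpace.subspace K (f ` N) W"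
proof -
  interpret linear_map K V W f by fact
  note N = subspaceD[OF assms(2)]
  show ?thesis
  proof (rule subspaceI[OF W.vectorspace_axioms])
    show "\<zero>\<^bsub>W\<^esub> \<in> f ` N" using N(3) T0_is_0 by (metis imageI)
    fix v w assume "v \<in> f ` N" "w \<in> f ` N"
    then obtain a b where "a \<in> N" "b \<in> N" "v = f a" "w = f b" by auto
    moreover from this N(2) have "a \<in> carrier V" "b \<in> carrier V" by auto
    ultimately show "v \<oplus>\<^bsub>W\<^esub> w \<in> f ` N"
      using N(4) by (auto intro!: image_eqI[of _ _ "a \<oplus>\<^bsub>V\<^esub> b"])
  next
    fix c v assume "c \<in> carrier K" "v \<in> f ` N"
    then obtain a where "a \<in> N" "v = f a" by auto
    moreover from this N(2) have "a \<in> carrier V" by auto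
    ultimately show "c \<odot>\<^bsub>W\<^esub> v \<in> f ` N"
      using N(5) \<open>c \<in> carrier K\<close> by (auto intro!: image_eqI[of _ _ "c \<odot>\<^bsub>V\<^esub> a"])
  qed (use N in auto)
qed

lemma carrier_subspace: "vectorspace K V \<Longrightarrow> VectorSpace.subspace K (carrier V) V"
proof -
  assume "vectorspace K V"
  then interpret vectorspace K V .
  show ?thesis by (intro subspaceI vectorspace_axioms) auto
qed

section \<open>Spaces of linear maps and direct sums\<close>

lemma hom_space_simps [simp]:
  "\<zero>\<^bsub>hom_space K V W\<^esub> = (\<lambda>v\<in>carrier V. \<zero>\<^bsub>W\<^esub>)"
  "f \<oplus>\<^bsub>hom_space K V W\<^esub> g = (\<lambda>v\<in>carrier V. f v \<oplus>\<^bsub>W\<^esub> g v)"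
  "c \<odot>\<^bsub>hom_space K V W\<^esub> f = (\<lambda>v\<in>carrier V. c \<odot>\<^bsub>W\<^esub> f v)"
  by (simp_all add: hom_space_def)

lemma carrier_hom_space:
  "\<lbrakk>vectorspace K V; vectorspace K W\<rbrakk> \<Longrightarrow>
    f \<in> carrier (hom_space K V W) \<longleftrightarrow> linear_map K V W f \<and> f \<in> extensional (carrier V)"
  by (simp add: hom_space_def module_hom_iff)

lemma linear_map_zero_map:
  assumes "vectorspace K V" "vectorspace K W"
  shows "linear_map K V W (\<lambda>v. \<zero>\<^bsub>W\<^esub>)"
proof -
  interpret W: vectorspace K W by fact
  show ?thesis by (intro linear_mapI assms) auto
qed

lemma linear_map_sum:
  assumes "linear_map K V W f" "linear_map K V W g"
  shows "linear_map K V W (\<lambda>v. f v \<oplus>\<^bsub>W\<^esub> g v)"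
proof -
  interpret f: linear_map K V W f by fact
  interpret g: linear_map K V W g by fact
  show ?thesis
    by (intro linear_mapI f.V.vectorspace_axioms f.W.vectorspace_axioms)
      (auto simp: f.W.module.M.a_ac f.W.module.smult_r_distr)
qed

lemma (in vectorspace) comm_K: "a \<in> carrier K \<Longrightarrow> b \<in> carrier K \<Longrightarrow> a \<otimes>\<^bsub>K\<^esub> b = b \<otimes>\<^bsub>K\<^esub> a"
  using vectorspace_axioms
  by (simp add: vectorspace_def field_def domain_def cring.cring_simprules(14))

text \<open>Commutativity of \<open>K\<close> enters here: c (a w) has to equal a (c w).\<close>

lemma linear_map_scale:
  assumes "linear_map K V W f" "c \<in> carrier K"
  shows "linear_map K V W (\<lambda>v. c \<odot>\<^bsub>W\<^esub> f v)"
proof -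
  interpret f: linear_map K V W f by fact
  note comm = vectorspace.comm_K[OF f.V.vectorspace_axioms]
  show ?thesis
    using assms(2)
    by (intro linear_mapI f.V.vectorspace_axioms f.W.vectorspace_axioms)
      (auto simp: f.W.module.smult_r_distr f.W.module.smult_assoc1[symmetric] comm)
qed

lemma linear_map_neg:
  assumes "linear_map K V W f"
  shows "linear_map K V W (\<lambda>v. \<ominus>\<^bsub>W\<^esub> f v)"
proof -
  interpret f: linear_map K V W f by fact
  show ?thesis
    by (rule linear_map_cong[OF linear_map_scale[OF assms, of "\<ominus>\<^bsub>K\<^esub> \<one>\<^bsub>K\<^esub>"]])
      (auto simp: f.W.module.smult_minus_1)
qed

lemma linear_map_diff:
  assumes "linear_map K V W f" "linear_map K V W g"
  shows "linear_map K V W (\<lambda>v. f v \<ominus>\<^bsub>W\<^esub> g v)"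
  using linear_map_sum[OF assms(1) linear_map_neg[OF assms(2)]] by (simp add: a_minus_def)

lemma linear_map_finsum_map:
  assumes "vectorspace K V" "vectorspace K W" "\<And>a. a \<in> A \<Longrightarrow> linear_map K V W (f a)"
  shows "linear_map K V W (\<lambda>v. \<Oplus>\<^bsub>W\<^esub>a\<in>A. f a v)"
  using assms(3)
proof (induction A rule: infinite_finite_induct)
  case (insert a A)
  interpret W: vectorspace K W by fact
  have "(\<Oplus>\<^bsub>W\<^esub>a\<in>insert a A. f a v) = f a v \<oplus>\<^bsub>W\<^esub> (\<Oplus>\<^bsub>W\<^esub>a\<in>A. f a v)" if "v \<in> carrier V" for v
    using insert(1,2) linear_map_closed[OF insert.prems that]
    by (subst W.M.finsum_insert) auto
  note sum = this
  have "linear_map K V W (\<lambda>v. f a v \<oplus>\<^bsub>W\<^esub> (\<Oplus>\<^bsub>W\<^esub>a\<in>A. f a v))"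
    using insert by (auto intro!: linear_map_sum)
  then show ?case
    by (rule linear_map_cong) (rule sum)
next
  case (infinite A)
  interpret W: vectorspace K W by fact
  show ?case using linear_map_zero_map[OF assms(1,2)] infinite by simp
next
  case empty
  interpret W: vectorspace K W by fact
  show ?case using linear_map_zero_map[OF assms(1,2)] by simp
qed

lemma hom_space_vs:
  assumes "vectorspace K V" "vectorspace K W"
  shows "vectorspace K (hom_space K V W)"
proof -
  interpret V: vectorspace K V by fact
  interpret W: vectorspace K W by fact
  note c = carrier_hom_space[OF assms]
  \<comment> \<open>Elements of \<open>hom_space\<close> are extensional, so each closure property
    is obtained by restricting a linear formula to the carrier.\<close>
  have restr: "(\<lambda>v\<in>carrier V. f v) \<in> carrier (hom_space K V W)" if "linear_map K V W f" for f
    using that by (auto simp: c intro: linear_map_cong)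
  have cl: "f v \<in> carrier W" if "f \<in> carrier (hom_space K V W)" "v \<in> carrier V" for f v
    using that linear_map_closed[of K V W f v] by (simp add: c)
  have ext: "f = g" if "f \<in> carrier (hom_space K V W)" "g \<in> carrier (hom_space K V W)"
    "\<And>v. v \<in> carrier V \<Longrightarrow> f v = g v" for f g
    using that by (auto simp: c intro: extensionalityI)
  have add: "f \<oplus>\<^bsub>hom_space K V W\<^esub> g \<in> carrier (hom_space K V W)"
    if "f \<in> carrier (hom_space K V W)" "g \<in> carrier (hom_space K V W)" for f g
    using restr[OF linear_map_sum[of K V W f g]] that by (simp add: c)
  have sm: "a \<odot>\<^bsub>hom_space K V W\<^esub> f \<in> carrier (hom_space K V W)"
    if "f \<in> carrier (hom_space K V W)" "a \<in> carrier K" for f a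
    using restr[OF linear_map_scale[of K V W f a]] that by (simp add: c)
  have z: "\<zero>\<^bsub>hom_space K V W\<^esub> \<in> carrier (hom_space K V W)"
    using restr[OF linear_map_zero_map[OF assms]] by simp
  show ?thesis
  proof (rule vs_criteria)
    show "\<forall>f\<in>carrier (hom_space K V W). \<exists>g\<in>carrier (hom_space K V W).
            f \<oplus>\<^bsub>hom_space K V W\<^esub> g = \<zero>\<^bsub>hom_space K V W\<^esub>"
    proof
      fix f assume f: "f \<in> carrier (hom_space K V W)"
      then have "(\<lambda>v\<in>carrier V. \<ominus>\<^bsub>W\<^esub> f v) \<in> carrier (hom_space K V W)"
        by (intro restr linear_map_neg) (simp add: c)
      moreover have "f \<oplus>\<^bsub>hom_space K V W\<^esub> (\<lambda>v\<in>carrier V. \<ominus>\<^bsub>W\<^esub> f v) = \<zero>\<^bsub>hom_space K V W\<^esub>"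
        using cl[OF f] by (auto simp: W.r_neg)
      ultimately show "\<exists>g\<in>carrier (hom_space K V W). f \<oplus>\<^bsub>hom_space K V W\<^esub> g = \<zero>\<^bsub>hom_space K V W\<^esub>"
        by blast
    qed
    show "field K" by (rule V.field_axioms)
  next
    show "\<forall>f\<in>carrier (hom_space K V W). f \<oplus>\<^bsub>hom_space K V W\<^esub> \<zero>\<^bsub>hom_space K V W\<^esub> = f"
      by (intro ballI ext) (auto simp: add[OF _ z, simplified] cl)
    show "\<forall>f\<in>carrier (hom_space K V W). \<one>\<^bsub>K\<^esub> \<odot>\<^bsub>hom_space K V W\<^esub> f = f"
      by (intro ballI ext) (auto simp: sm[OF _ V.one_closed, simplified] cl)
  qed (use add sm z in \<open>auto simp: cl W.a_ac W.smult_assoc1 W.smult_l_distr W.smult_r_distr intro!: restrict_ext\<close>)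
qed

section \<open>The ground field as a space, dual spaces and transposes\<close>

lemma scalar_space_simps [simp]:
  "carrier (scalar_space K) = carrier K" "\<zero>\<^bsub>scalar_space K\<^esub> = \<zero>\<^bsub>K\<^esub>"
  "a \<oplus>\<^bsub>scalar_space K\<^esub> b = a \<oplus>\<^bsub>K\<^esub> b" "a \<odot>\<^bsub>scalar_space K\<^esub> b = a \<otimes>\<^bsub>K\<^esub> b"
  by (simp_all add: scalar_space_def)

lemma scalar_space_vs:
  assumes "field K"
  shows "vectorspace K (scalar_space K)"
proof -
  interpret field K by fact
  show ?thesis
    by (rule vs_criteria[OF assms]) (auto simp: a_ac m_assoc l_distr r_distr intro: r_neg)
qed

text \<open>Negation is not a field of the record but is derived from addition, so
  \<open>scalar_space K\<close> has a negation of its own, which has to be matched with that of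
  \<open>K\<close>.\<close>

lemma scalar_space_uminus [simp]:
  assumes "field K" "a \<in> carrier K"
  shows "\<ominus>\<^bsub>scalar_space K\<^esub> a = \<ominus>\<^bsub>K\<^esub> a"
proof -
  interpret field K by fact
  interpret S: vectorspace K "scalar_space K" by (rule scalar_space_vs[OF assms(1)])
  show ?thesis using assms(2) by (intro S.module.M.minus_equality) (auto simp: l_neg)
qed

lemma vs_field: "vectorspace K V \<Longrightarrow> field K"
  by (simp add: vectorspace_def)

lemma vs_scalar: "vectorspace K V \<Longrightarrow> vectorspace K (scalar_space K)"
  by (simp add: scalar_space_vs vs_field)

lemma dual_space_vs: "vectorspace K V \<Longrightarrow> vectorspace K (dual_space K V)"
  unfolding dual_space_def by (intro hom_space_vs vs_scalar)

lemma dual_space_simps [simp]: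
  "\<zero>\<^bsub>dual_space K V\<^esub> = (\<lambda>v\<in>carrier V. \<zero>\<^bsub>K\<^esub>)"
  "f \<oplus>\<^bsub>dual_space K V\<^esub> g = (\<lambda>v\<in>carrier V. f v \<oplus>\<^bsub>K\<^esub> g v)"
  "c \<odot>\<^bsub>dual_space K V\<^esub> f = (\<lambda>v\<in>carrier V. c \<otimes>\<^bsub>K\<^esub> f v)"
  by (simp_all add: dual_space_def)

lemma carrier_dual_space:
  "vectorspace K V \<Longrightarrow> \<phi> \<in> carrier (dual_space K V) \<longleftrightarrow>
     linear_map K V (scalar_space K) \<phi> \<and> \<phi> \<in> extensional (carrier V)"
  unfolding dual_space_def by (intro carrier_hom_space vs_scalar)

lemma dual_restrict:
  "linear_map K V (scalar_space K) f \<Longrightarrow> (\<lambda>v\<in>carrier V. f v) \<in> carrier (dual_space K V)"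
  by (auto simp: carrier_dual_space linear_map_vs(1) intro: linear_map_cong)

lemma dual_linear:
  "\<lbrakk>vectorspace K V; \<phi> \<in> carrier (dual_space K V)\<rbrakk> \<Longrightarrow> linear_map K V (scalar_space K) \<phi>"
  by (simp add: carrier_dual_space)

lemma dual_closed:
  "\<lbrakk>vectorspace K V; \<phi> \<in> carrier (dual_space K V); v \<in> carrier V\<rbrakk> \<Longrightarrow> \<phi> v \<in> carrier K"
  using linear_map_closed[OF dual_linear] by fastforce

lemma dual_eqI:
  assumes "vectorspace K V" "\<phi> \<in> carrier (dual_space K V)" "\<psi> \<in> carrier (dual_space K V)"
    and "\<And>v. v \<in> carrier V \<Longrightarrow> \<phi> v = \<psi> v"
  shows "\<phi> = \<psi>"
  using assms by (auto simp: carrier_dual_space intro: extensionalityI)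

lemma hom_eval_linear:
  assumes "vectorspace K V" "vectorspace K W" "v \<in> carrier V"
  shows "linear_map K (hom_space K V W) W (\<lambda>f. f v)"
  using assms(3) linear_map_closed[OF _ assms(3)]
  by (intro linear_mapI hom_space_vs assms(1,2)) (auto simp: carrier_hom_space assms(1,2))

lemma eval_linear:
  assumes "vectorspace K V" "v \<in> carrier V"
  shows "linear_map K (dual_space K V) (scalar_space K) (\<lambda>\<phi>. \<phi> v)"
  unfolding dual_space_def by (rule hom_eval_linear[OF assms(1) vs_scalar[OF assms(1)] assms(2)])

text \<open>Operations in \<open>hom_space\<close> are pointwise and its elements extensional, so
  linearity of a map into it can be tested by evaluating at each v.\<close>

lemma linear_map_into_hom:
  assumes "vectorspace K Y" "vectorspace K V" "vectorspace K W"
    and h: "\<And>y. y \<in> carrier Y \<Longrightarrow> h y \<in> carrier (hom_space K V W)"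
    and ev: "\<And>v. v \<in> carrier V \<Longrightarrow> linear_map K Y W (\<lambda>y. h y v)"
  shows "linear_map K Y (hom_space K V W) h"
proof -
  interpret Y: vectorspace K Y by fact
  interpret H: vectorspace K "hom_space K V W" by (rule hom_space_vs[OF assms(2,3)])
  have ext: "h y \<in> extensional (carrier V)" if "y \<in> carrier Y" for y
    using h[OF that] by (simp add: carrier_hom_space[OF assms(2,3)])
  show ?thesis
  proof (rule linear_mapI[OF assms(1) H.vectorspace_axioms h])
    show "h (x \<oplus>\<^bsub>Y\<^esub> y) = h x \<oplus>\<^bsub>hom_space K V W\<^esub> h y" if "x \<in> carrier Y" "y \<in> carrier Y" for x y
      using that ext linear_map_add[OF ev] by (intro extensionalityI[of _ "carrier V"]) auto
    show "h (c \<odot>\<^bsub>Y\<^esub> y) = c \<odot>\<^bsub>hom_space K V W\<^esub> h y" if "c \<in> carrier K" "y \<in> carrier Y" for c y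
      using that ext linear_map_smult[OF ev] by (intro extensionalityI[of _ "carrier V"]) auto
  qed
qed

lemma linear_map_into_dual:
  assumes "vectorspace K Y" "vectorspace K V"
    and "\<And>y. y \<in> carrier Y \<Longrightarrow> h y \<in> carrier (dual_space K V)"
    and "\<And>v. v \<in> carrier V \<Longrightarrow> linear_map K Y (scalar_space K) (\<lambda>y. h y v)"
  shows "linear_map K Y (dual_space K V) h"
  using assms unfolding dual_space_def by (intro linear_map_into_hom vs_scalar)

lemma dual_finsum:
  assumes "vectorspace K V" "f \<in> A \<rightarrow> carrier (dual_space K V)" "v \<in> carrier V"
  shows "(\<Oplus>\<^bsub>dual_space K V\<^esub>a\<in>A. f a) v = (\<Oplus>\<^bsub>scalar_space K\<^esub>a\<in>A. f a v)"
  by (rule linear_map_finsum[OF eval_linear[OF assms(1,3)] assms(2)])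

lemma transpose_closed:
  assumes "linear_map K V W f" "\<phi> \<in> carrier (dual_space K W)"
  shows "transpose_map V f \<phi> \<in> carrier (dual_space K V)"
  unfolding transpose_map_def
  by (intro dual_restrict linear_map_comp[OF assms(1)] dual_linear assms linear_map_vs(2)[OF assms(1)])

lemma transpose_linear:
  assumes "linear_map K V W f"
  shows "linear_map K (dual_space K W) (dual_space K V) (transpose_map V f)"
  using transpose_closed[OF assms] linear_map_closed[OF assms]
  by (intro linear_mapI dual_space_vs linear_map_vs[OF assms])
    (auto simp: transpose_map_def intro!: restrict_ext)

section \<open>Direct sums\<close>

lemma dsum_simps [simp]:
  "carrier (dsum I M) = (\<Pi>\<^sub>E i\<in>I. carrier (M i))" "\<zero>\<^bsub>dsum I M\<^esub> = (\<lambda>i\<in>I. \<zero>\<^bsub>M i\<^esub>)"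
  "x \<oplus>\<^bsub>dsum I M\<^esub> y = (\<lambda>i\<in>I. x i \<oplus>\<^bsub>M i\<^esub> y i)" "c \<odot>\<^bsub>dsum I M\<^esub> x = (\<lambda>i\<in>I. c \<odot>\<^bsub>M i\<^esub> x i)"
  by (simp_all add: dsum_def)

lemma dsum_vs:
  assumes "field K" "\<And>i. i \<in> I \<Longrightarrow> vectorspace K (M i)"
  shows "vectorspace K (dsum I M)"
proof -
  \<comment> \<open>The summands are vector spaces only for indices in \<open>I\<close>, so the
    module laws are collected as rules with that premise instead of being interpreted once.\<close>
  have ag: "abelian_group (M i)" and md: "Module.module K (M i)" if "i \<in> I" for i
    using assms(2)[OF that] by (auto simp: vectorspace_def Module.module_def)
  note ab = abelian_groupE[OF ag]
  show ?thesis
  proof (rule vs_criteria[OF assms(1)])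
    show "\<forall>v\<in>carrier (dsum I M). \<exists>w\<in>carrier (dsum I M). v \<oplus>\<^bsub>dsum I M\<^esub> w = \<zero>\<^bsub>dsum I M\<^esub>"
    proof
      fix v assume "v \<in> carrier (dsum I M)"
      then show "\<exists>w\<in>carrier (dsum I M). v \<oplus>\<^bsub>dsum I M\<^esub> w = \<zero>\<^bsub>dsum I M\<^esub>"
        by (intro bexI[of _ "\<lambda>i\<in>I. \<ominus>\<^bsub>M i\<^esub> v i"])
          (auto intro!: restrict_ext abelian_group.r_neg ag abelian_group.a_inv_closed)
    qed
    show "\<forall>v\<in>carrier (dsum I M). v \<oplus>\<^bsub>dsum I M\<^esub> \<zero>\<^bsub>dsum I M\<^esub> = v"
      by (auto simp: fun_eq_iff PiE_iff extensional_def abelian_monoid.r_zero[OF abelian_group.axioms(1)[OF ag]])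
    show "\<forall>v\<in>carrier (dsum I M). \<one>\<^bsub>K\<^esub> \<odot>\<^bsub>dsum I M\<^esub> v = v"
      by (auto simp: fun_eq_iff PiE_iff extensional_def Module.module.smult_one[OF md])
  next
    show "\<zero>\<^bsub>dsum I M\<^esub> \<in> carrier (dsum I M)" using ab(2) by auto
    show "\<forall>v w. v \<in> carrier (dsum I M) \<and> w \<in> carrier (dsum I M) \<longrightarrow> v \<oplus>\<^bsub>dsum I M\<^esub> w \<in> carrier (dsum I M)"
      using ab(1) by (auto simp: PiE_iff)
    show "\<forall>c v. c \<in> carrier K \<and> v \<in> carrier (dsum I M) \<longrightarrow> c \<odot>\<^bsub>dsum I M\<^esub> v \<in> carrier (dsum I M)"
      by (auto simp: PiE_iff intro: Module.module.smult_closed[OF md])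
  qed (auto simp: PiE_iff ab(3,4) Module.module.smult_assoc1[OF md]
        Module.module.smult_l_distr[OF md] Module.module.smult_r_distr[OF md]
        intro!: restrict_ext)
qed

section \<open>Dual bases and annihilators\<close>

text \<open>Families over an index set are used instead of a set of vectors: the functionals can
  then serve as a basis of the dual over the same \<open>J\<close>, and a basis can be carried along
  an isomorphism. Independence is contained in the Kronecker condition, spanning in the
  expansion.\<close>

definition dual_basis where
  "dual_basis K V J e \<epsilon> \<longleftrightarrow>
     finite J \<and> e \<in> J \<rightarrow> carrier V \<and> \<epsilon> \<in> J \<rightarrow> carrier (dual_space K V) \<and>
     (\<forall>i\<in>J. \<forall>j\<in>J. \<epsilon> i (e j) = (if i = j then \<one>\<^bsub>K\<^esub> else \<zero>\<^bsub>K\<^esub>)) \<and>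
     (\<forall>v\<in>carrier V. v = (\<Oplus>\<^bsub>V\<^esub>j\<in>J. \<epsilon> j v \<odot>\<^bsub>V\<^esub> e j))"

lemma dual_basisD:
  assumes "dual_basis K V J e \<epsilon>"
  shows "finite J" "\<And>j. j \<in> J \<Longrightarrow> e j \<in> carrier V" "\<And>j. j \<in> J \<Longrightarrow> \<epsilon> j \<in> carrier (dual_space K V)"
    and "\<And>i j. i \<in> J \<Longrightarrow> j \<in> J \<Longrightarrow> \<epsilon> i (e j) = (if i = j then \<one>\<^bsub>K\<^esub> else \<zero>\<^bsub>K\<^esub>)"
    and "\<And>v. v \<in> carrier V \<Longrightarrow> v = (\<Oplus>\<^bsub>V\<^esub>j\<in>J. \<epsilon> j v \<odot>\<^bsub>V\<^esub> e j)"
  using assms unfolding dual_basis_def by blast+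

lemma finsum_delta:
  assumes "vectorspace K V" "finite J" "i \<in> J" "e \<in> J \<rightarrow> carrier V"
  shows "(\<Oplus>\<^bsub>V\<^esub>j\<in>J. (if j = i then \<one>\<^bsub>K\<^esub> else \<zero>\<^bsub>K\<^esub>) \<odot>\<^bsub>V\<^esub> e j) = e i"
proof -
  interpret V: vectorspace K V by fact
  have "(\<Oplus>\<^bsub>V\<^esub>j\<in>J. (if j = i then \<one>\<^bsub>K\<^esub> else \<zero>\<^bsub>K\<^esub>) \<odot>\<^bsub>V\<^esub> e j)
      = (\<Oplus>\<^bsub>V\<^esub>j\<in>J. if i = j then e j else \<zero>\<^bsub>V\<^esub>)"
    using assms by (intro V.M.finsum_cong') (auto simp: Pi_iff)
  then show ?thesis
    using V.M.finsum_singleton[OF assms(3,2,4)] by simp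
qed

text \<open>Coordinates are linear because they are unique: the sum of the coefficient families of
  two vectors represents the sum of the vectors, hence is its coefficient family.\<close>

lemma basis_coordinates:
  assumes "vectorspace K V" "finite B" "vectorspace.basis K V B"
  shows "\<exists>\<epsilon>. dual_basis K V B (\<lambda>b. b) \<epsilon>"
proof -
  interpret V: vectorspace K V by fact
  have B: "B \<subseteq> carrier V" using assms(3) unfolding V.basis_def by auto
  define c where "c v = (THE a. a \<in> B \<rightarrow>\<^sub>E carrier K \<and> V.lincomb a B = v)" for v
  have ex: "\<exists>!a. a \<in> B \<rightarrow>\<^sub>E carrier K \<and> V.lincomb a B = v" if "v \<in> carrier V" for v
    using V.basis_criterion[OF assms(2) B] assms(3) that by blast
  have c: "c v \<in> B \<rightarrow>\<^sub>E carrier K" "V.lincomb (c v) B = v" if "v \<in> carrier V" for v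
    using theI'[OF ex[OF that]] unfolding c_def by auto
  have cl: "c v b \<in> carrier K" if "v \<in> carrier V" "b \<in> B" for v b
    using c(1)[OF that(1)] that(2) by auto
  have uniq: "c v = (\<lambda>b\<in>B. a b)" if "a \<in> B \<rightarrow> carrier K" "V.lincomb a B = v" for a v
  proof -
    have "V.lincomb (\<lambda>b\<in>B. a b) B = v"
      unfolding that(2)[symmetric] using that(1) B by (intro V.lincomb_cong) auto
    moreover have "v \<in> carrier V" using that B by auto
    moreover have "(\<lambda>b\<in>B. a b) \<in> B \<rightarrow>\<^sub>E carrier K" using that by auto
    ultimately show ?thesis using ex c by blast
  qed
  define \<epsilon> where "\<epsilon> b = (\<lambda>v\<in>carrier V. c v b)" for b
  have "\<epsilon> b \<in> carrier (dual_space K V)" if b: "b \<in> B" for b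
    unfolding \<epsilon>_def
  proof (intro dual_restrict linear_mapI V.vectorspace_axioms vs_scalar[OF assms(1)])
    fix v w assume v: "v \<in> carrier V" "w \<in> carrier V"
    have "V.lincomb (\<lambda>b. c v b \<oplus>\<^bsub>K\<^esub> c w b) B = v \<oplus>\<^bsub>V\<^esub> w"
      using V.lincomb_sum[OF assms(2) B, of "c v" "c w"] c v by (auto simp: PiE_iff Pi_iff)
    from uniq[OF _ this] show "c (v \<oplus>\<^bsub>V\<^esub> w) b = c v b \<oplus>\<^bsub>scalar_space K\<^esub> c w b"
      using b cl v by auto
  next
    fix a v assume v: "a \<in> carrier K" "v \<in> carrier V"
    have "V.lincomb (\<lambda>b. a \<otimes>\<^bsub>K\<^esub> c v b) B = a \<odot>\<^bsub>V\<^esub> v"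
      using V.lincomb_smult[OF B, of "c v" a] c v by (auto simp: PiE_iff Pi_iff)
    from uniq[OF _ this] show "c (a \<odot>\<^bsub>V\<^esub> v) b = a \<odot>\<^bsub>scalar_space K\<^esub> c v b"
      using b cl v by auto
  qed (use cl b in auto)
  moreover have "\<epsilon> i j = (if i = j then \<one>\<^bsub>K\<^esub> else \<zero>\<^bsub>K\<^esub>)" if "i \<in> B" "j \<in> B" for i j
  proof -
    \<comment> \<open>The indicator family of j represents j, so by uniqueness it is the coefficient
      family of j.\<close>
    have "V.lincomb (\<lambda>b. if b = j then \<one>\<^bsub>K\<^esub> else \<zero>\<^bsub>K\<^esub>) B = j"
      unfolding V.lincomb_def using B by (intro finsum_delta assms that) auto
    from uniq[OF _ this] show ?thesis using that B by (auto simp: \<epsilon>_def)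
  qed
  moreover have "v = (\<Oplus>\<^bsub>V\<^esub>b\<in>B. \<epsilon> b v \<odot>\<^bsub>V\<^esub> b)" if "v \<in> carrier V" for v
    using c(2)[OF that] that unfolding V.lincomb_def \<epsilon>_def by simp
  ultimately show ?thesis
    using assms(2) B unfolding dual_basis_def by (intro exI[of _ \<epsilon>]) auto
qed

lemma dual_basis_dim:
  assumes "vectorspace K V" "dual_basis K V J e \<epsilon>"
  shows "vectorspace.fin_dim K V" "vectorspace.dim K V = card J"
proof -
  interpret V: vectorspace K V by fact
  note e = dual_basisD[OF assms(2)]
  \<comment> \<open>If e i = e j with i \<noteq> j, then \<open>\<epsilon> i\<close> would take both
    values 1 and 0 there.\<close>
  have inj: "inj_on e J"
  proof (rule inj_onI)
    fix i j assume "i \<in> J" "j \<in> J" "e i = e j"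
    then show "i = j" using e(4)[of i i] e(4)[of i j] V.zero_not_one by (auto split: if_splits)
  qed
  have sub: "e ` J \<subseteq> carrier V" using e(2) by auto
  have fin: "finite (e ` J)" using e(1) by auto
  have lin: "V.lincomb a (e ` J) = (\<Oplus>\<^bsub>V\<^esub>j\<in>J. a (e j) \<odot>\<^bsub>V\<^esub> e j)" if "a \<in> e ` J \<rightarrow> carrier K" for a
    unfolding V.lincomb_def using inj e(2) that
    by (subst V.M.finsum_reindex) auto
  \<comment> \<open>Applying \<open>\<epsilon> i\<close> to a vanishing combination leaves exactly
    its i-th coefficient.\<close>
  have "V.lin_indpt (e ` J)"
  proof (rule V.finite_lin_indpt2[OF fin sub], rule ballI)
    fix a w assume a: "a \<in> e ` J \<rightarrow> carrier K" "V.lincomb a (e ` J) = \<zero>\<^bsub>V\<^esub>" and "w \<in> e ` J"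
    then obtain i where i: "i \<in> J" "w = e i" by auto
    have L: "linear_map K V (scalar_space K) (\<epsilon> i)" using e(3) i assms(1) dual_linear by blast
    interpret S: vectorspace K "scalar_space K" by (rule vs_scalar[OF assms(1)])
    have ac: "a (e j) \<in> carrier K" if "j \<in> J" for j using a that by auto
    have "\<zero>\<^bsub>K\<^esub> = \<epsilon> i (\<Oplus>\<^bsub>V\<^esub>j\<in>J. a (e j) \<odot>\<^bsub>V\<^esub> e j)"
      using linear_map_zero[OF L] a lin by simp
    also have "\<dots> = (\<Oplus>\<^bsub>scalar_space K\<^esub>j\<in>J. \<epsilon> i (a (e j) \<odot>\<^bsub>V\<^esub> e j))"
      using ac e(2) by (intro linear_map_finsum[OF L]) auto
    also have "\<dots> = (\<Oplus>\<^bsub>scalar_space K\<^esub>j\<in>J. (if j = i then \<one>\<^bsub>K\<^esub> else \<zero>\<^bsub>K\<^esub>) \<odot>\<^bsub>scalar_space K\<^esub> a (e j))"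
      using ac e(2) i by (intro S.M.finsum_cong') (auto simp: linear_map_smult[OF L] e(4))
    also have "\<dots> = a (e i)"
      using ac by (intro finsum_delta[OF vs_scalar[OF assms(1)] e(1) i(1)]) auto
    finally show "a w = \<zero>\<^bsub>K\<^esub>" using i by simp
  qed
  moreover have gen: "V.gen_set (e ` J)"
  proof -
    have "v \<in> V.span (e ` J)" if v: "v \<in> carrier V" for v
    proof -
      \<comment> \<open>\<open>lincomb\<close> takes coefficients indexed by vectors, so the
        coordinates are reindexed through the inverse of \<open>e\<close>.\<close>
      define a where "a w = \<epsilon> (the_inv_into J e w) v" for w
      have a: "a \<in> e ` J \<rightarrow> carrier K"
        using inj dual_closed[OF assms(1) e(3) v] by (auto simp: a_def the_inv_into_f_f)
      have "v = V.lincomb a (e ` J)"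
        unfolding lin[OF a] using inj e(2) dual_closed[OF assms(1) e(3) v] e(5)[OF v]
        by (subst e(5)[OF v], intro V.M.finsum_cong') (auto simp: a_def the_inv_into_f_f)
      then show ?thesis using V.finite_span[OF fin sub] a by auto
    qed
    then show ?thesis using V.span_is_subset2[OF sub] by auto
  qed
  ultimately have "V.basis (e ` J)" using sub unfolding V.basis_def by auto
  then show "V.dim = card J" using V.dim_basis[OF fin] card_image[OF inj] by simp
  show "V.fin_dim" unfolding V.fin_dim_def using fin sub gen by blast
qed

text \<open>For a subspace N the \<open>e j\<close> with j in \<open>A\<close> then form a basis of
  N, and the \<open>\<epsilon> j\<close> with j in \<open>J - A\<close> a basis of its annihilator.
  Dimensions, projections and double annihilators are all read off from this splitting.\<close>

definition adapted_basis where
  "adapted_basis K V N J e \<epsilon> A \<longleftrightarrow> dual_basis K V J e \<epsilon> \<and> A \<subseteq> J \<and> e ` A \<subseteq> N \<and>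
     (\<forall>j\<in>J - A. \<forall>n\<in>N. \<epsilon> j n = \<zero>\<^bsub>K\<^esub>)"

text \<open>The dimension bounds the size of independent sets, so a maximal one exists among those
  between \<open>A\<close> and \<open>N\<close>. A vector of \<open>N\<close> outside its span could
  be added, against maximality. It serves twice: to find a basis of a subspace, and to extend that
  basis to the whole space.\<close>

lemma maximal_lin_indpt:
  assumes "vectorspace K V" "vectorspace.fin_dim K V" "N \<subseteq> carrier V"
    and "A \<subseteq> N" "\<not> module.lin_dep K V A"
  shows "\<exists>B. finite B \<and> A \<subseteq> B \<and> B \<subseteq> N \<and> \<not> module.lin_dep K V B \<and> N \<subseteq> module.span K V B"
proof -
  interpret V: vectorspace K V by fact
  have "\<exists>B. finite B \<and> maximal B (\<lambda>S. A \<subseteq> S \<and> S \<subseteq> N \<and> V.lin_indpt S)"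
  proof (rule maximal_exists)
    fix S assume "A \<subseteq> S \<and> S \<subseteq> N \<and> V.lin_indpt S"
    then show "finite S \<and> card S \<le> V.dim"
      using V.li_le_dim[OF assms(2)] assms(3) by (meson subset_trans)
  qed (use assms(4,5) in auto)
  then obtain B where B: "finite B" "maximal B (\<lambda>S. A \<subseteq> S \<and> S \<subseteq> N \<and> V.lin_indpt S)"
    by blast
  then have li: "A \<subseteq> B" "B \<subseteq> N" "V.lin_indpt B"
    and max: "\<And>S. B \<subseteq> S \<Longrightarrow> S \<subseteq> N \<Longrightarrow> V.lin_indpt S \<Longrightarrow> S = B"
    unfolding maximal_def by blast+
  have "n \<in> V.span B" if "n \<in> N" for n
  proof (rule ccontr)
    assume n: "n \<notin> V.span B"
    then have "n \<notin> B" using V.in_own_span li assms(3) by blast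
    then have "V.lin_indpt (B \<union> {n})"
      using V.lin_dep_iff_in_span[of B n] n li assms(3) that by blast
    then show False using max[of "B \<union> {n}"] li that \<open>n \<notin> B\<close> by blast
  qed
  then show ?thesis using B li by blast
qed

text \<open>A basis of \<open>N\<close> is extended to one of \<open>V\<close>. The basis indexes
  itself, which is why the index type is the type of vectors.\<close>

lemma adapted_basis_exists:
  assumes "vectorspace K V" "vectorspace.fin_dim K V" "VectorSpace.subspace K N V"
  shows "\<exists>(J :: 'v set) e \<epsilon> A. adapted_basis K (V :: ('k, 'v, 'm) module_scheme) N J e \<epsilon> A"
proof -
  interpret V: vectorspace K V by fact
  note N = subspaceD[OF assms(3)]
  have "V.lin_indpt {}" unfolding V.lin_dep_def by auto
  then obtain A where A: "finite A" "A \<subseteq> N" "V.lin_indpt A" "N \<subseteq> V.span A"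
    using maximal_lin_indpt[OF assms(1,2) N(2), of "{}"] by blast
  then obtain B where B: "finite B" "A \<subseteq> B" "B \<subseteq> carrier V" "V.lin_indpt B" "carrier V \<subseteq> V.span B"
    using maximal_lin_indpt[OF assms(1,2), of "carrier V" A] N(2) by blast
  have "V.basis B"
    unfolding V.basis_def using B V.span_is_subset2[OF B(3)] by blast
  then obtain \<epsilon> where \<epsilon>: "dual_basis K V B (\<lambda>b. b) \<epsilon>"
    using basis_coordinates[OF assms(1) B(1)] by blast
  note e = dual_basisD[OF \<epsilon>]
  have "\<epsilon> b n = \<zero>\<^bsub>K\<^esub>" if b: "b \<in> B - A" and n: "n \<in> N" for b n
  proof -
    have L: "linear_map K V (scalar_space K) (\<epsilon> b)" using e(3) b assms(1) dual_linear by blast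
    \<comment> \<open>A coordinate belonging to b outside \<open>A\<close> vanishes on
      \<open>A\<close>; its kernel is a subspace, so it contains the span of \<open>A\<close> and
      thereby \<open>N\<close>.\<close>
    have "submodule K {v \<in> carrier V. \<epsilon> b v = \<zero>\<^bsub>scalar_space K\<^esub>} V"
      using kernel_subspace[OF L] by (simp add: VectorSpace.subspace_def)
    moreover have "A \<subseteq> {v \<in> carrier V. \<epsilon> b v = \<zero>\<^bsub>scalar_space K\<^esub>}"
      using b A(2) B N(2) e(4)[of b] by auto
    ultimately have "V.span A \<subseteq> {v \<in> carrier V. \<epsilon> b v = \<zero>\<^bsub>scalar_space K\<^esub>}"
      by (intro V.span_is_subset)
    then show ?thesis using A(4) n by auto
  qed
  then show ?thesis
    using \<epsilon> A B unfolding adapted_basis_def by blast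
qed

lemma dual_basis_exists:
  assumes "vectorspace K V" "vectorspace.fin_dim K V"
  shows "\<exists>(J :: 'v set) e \<epsilon>. dual_basis K (V :: ('k, 'v, 'm) module_scheme) J e \<epsilon>"
  using adapted_basis_exists[OF assms carrier_subspace[OF assms(1)]] unfolding adapted_basis_def by blast

text \<open>The record with the smaller carrier has its own \<open>finsum\<close>; the two sums
  agree because the inclusion is linear and so commutes with sums.\<close>

lemma finsum_subspace_carrier:
  assumes N: "VectorSpace.subspace K N V" and "g \<in> A \<rightarrow> N"
  shows "(\<Oplus>\<^bsub>V\<lparr>carrier := N\<rparr>\<^esub>a\<in>A. g a) = (\<Oplus>\<^bsub>V\<^esub>a\<in>A. g a)"
proof -
  have "linear_map K (V\<lparr>carrier := N\<rparr>) V (\<lambda>v. v)"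
    by (rule linear_map_restrict[OF linear_map_id[OF subspaceD(1)[OF N]] N])
  from linear_map_finsum[OF this, of g A] assms(2) show ?thesis by simp
qed

lemma adapted_sum:
  assumes V: "vectorspace K V" and ad: "adapted_basis K V N J e \<epsilon> A" and v: "v \<in> carrier V"
    and 0: "\<And>j. j \<in> J - A \<Longrightarrow> \<epsilon> j v = \<zero>\<^bsub>K\<^esub>"
  shows "v = (\<Oplus>\<^bsub>V\<^esub>j\<in>A. \<epsilon> j v \<odot>\<^bsub>V\<^esub> e j)"
proof -
  interpret V: vectorspace K V by fact
  have b: "dual_basis K V J e \<epsilon>" "A \<subseteq> J" using ad by (auto simp: adapted_basis_def)
  note e = dual_basisD[OF b(1)]
  have "(\<Oplus>\<^bsub>V\<^esub>j\<in>A. \<epsilon> j v \<odot>\<^bsub>V\<^esub> e j) = (\<Oplus>\<^bsub>V\<^esub>j\<in>J. \<epsilon> j v \<odot>\<^bsub>V\<^esub> e j)"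
    using e b(2) v 0 dual_closed[OF V e(3) v]
    by (intro V.M.add.finprod_mono_neutral_cong_left) auto
  then show ?thesis using e(5)[OF v] by simp
qed

lemma adapted_basis_restrict:
  assumes V: "vectorspace K V" and N: "VectorSpace.subspace K N V"
    and ad: "adapted_basis K V N J e \<epsilon> A"
  shows "dual_basis K (V\<lparr>carrier := N\<rparr>) A e (\<lambda>j. \<lambda>n\<in>N. \<epsilon> j n)"
proof -
  have b: "dual_basis K V J e \<epsilon>" "A \<subseteq> J" "e ` A \<subseteq> N" "\<And>j n. j \<in> J - A \<Longrightarrow> n \<in> N \<Longrightarrow> \<epsilon> j n = \<zero>\<^bsub>K\<^esub>"
    using ad by (auto simp: adapted_basis_def)
  note e = dual_basisD[OF b(1)] and N' = subspaceD[OF N]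
  interpret Nv: vectorspace K "V\<lparr>carrier := N\<rparr>" by (rule subspace_vs[OF N])
  have "(\<lambda>n\<in>N. \<epsilon> j n) \<in> carrier (dual_space K (V\<lparr>carrier := N\<rparr>))" if "j \<in> A" for j
    using dual_restrict[OF linear_map_restrict[OF dual_linear[OF V e(3)] N]] b(2) that by auto
  moreover have "n = (\<Oplus>\<^bsub>V\<lparr>carrier := N\<rparr>\<^esub>j\<in>A. (\<lambda>n\<in>N. \<epsilon> j n) n \<odot>\<^bsub>V\<lparr>carrier := N\<rparr>\<^esub> e j)"
    if n: "n \<in> N" for n
  proof -
    have nc: "n \<in> carrier V" using n N' by auto
    have "n = (\<Oplus>\<^bsub>V\<^esub>j\<in>A. \<epsilon> j n \<odot>\<^bsub>V\<^esub> e j)"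
      by (rule adapted_sum[OF V ad nc]) (rule b(4)[OF _ n])
    also have "\<dots> = (\<Oplus>\<^bsub>V\<lparr>carrier := N\<rparr>\<^esub>j\<in>A. \<epsilon> j n \<odot>\<^bsub>V\<^esub> e j)"
      using b nc N'(5) dual_closed[OF V e(3) nc]
      by (intro finsum_subspace_carrier[OF N, symmetric]) (auto simp: subset_iff)
    finally show ?thesis using n by simp
  qed
  moreover have "finite A" using b(2) e(1) finite_subset by blast
  ultimately show ?thesis
    using b e N' unfolding dual_basis_def by (auto simp: subset_iff)
qed

lemma subspace_fin_dim:
  fixes V :: "('k, 'v, 'm) module_scheme"
  assumes "vectorspace K V" "vectorspace.fin_dim K V" "VectorSpace.subspace K N V"
  shows "vectorspace.fin_dim K (V\<lparr>carrier := N\<rparr>)"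
proof -
  obtain J :: "'v set" and e \<epsilon> A where "adapted_basis K V N J e \<epsilon> A"
    using adapted_basis_exists[OF assms] by blast
  from dual_basis_dim(1)[OF subspace_vs[OF assms(3)] adapted_basis_restrict[OF assms(1,3) this]]
  show ?thesis .
qed

text \<open>The coordinates of \<phi> with respect to the functionals \<open>\<epsilon> j\<close>
  are its values at the \<open>e j\<close>, as one sees by expanding the argument v in the
  basis.\<close>

lemma dual_basis_dual:
  assumes V: "vectorspace K V" and b: "dual_basis K V J e \<epsilon>"
  shows "dual_basis K (dual_space K V) J \<epsilon> (\<lambda>j. \<lambda>\<phi>\<in>carrier (dual_space K V). \<phi> (e j))"
proof -
  note e = dual_basisD[OF b]
  interpret V: vectorspace K V by fact
  interpret D: vectorspace K "dual_space K V" by (rule dual_space_vs[OF V])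
  interpret S: vectorspace K "scalar_space K" by (rule vs_scalar[OF V])
  note comm = V.comm_K
  have "\<phi> = (\<Oplus>\<^bsub>dual_space K V\<^esub>j\<in>J. \<phi> (e j) \<odot>\<^bsub>dual_space K V\<^esub> \<epsilon> j)"
    if \<phi>: "\<phi> \<in> carrier (dual_space K V)" for \<phi>
  proof (rule dual_eqI[OF V \<phi>])
    have cl: "\<phi> (e j) \<odot>\<^bsub>dual_space K V\<^esub> \<epsilon> j \<in> carrier (dual_space K V)" if "j \<in> J" for j
      using dual_closed[OF V \<phi>] e that by (intro D.smult_closed) auto
    show "(\<Oplus>\<^bsub>dual_space K V\<^esub>j\<in>J. \<phi> (e j) \<odot>\<^bsub>dual_space K V\<^esub> \<epsilon> j) \<in> carrier (dual_space K V)"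
      using cl by (intro D.M.finsum_closed) (auto simp del: dual_space_simps)
    fix v assume v: "v \<in> carrier V"
    have ev: "\<epsilon> j v \<in> carrier K" if "j \<in> J" for j using dual_closed[OF V e(3)] that v by auto
    have "\<phi> v = \<phi> (\<Oplus>\<^bsub>V\<^esub>j\<in>J. \<epsilon> j v \<odot>\<^bsub>V\<^esub> e j)" using e(5)[OF v] by simp
    also have "\<dots> = (\<Oplus>\<^bsub>scalar_space K\<^esub>j\<in>J. \<phi> (\<epsilon> j v \<odot>\<^bsub>V\<^esub> e j))"
      using ev e(2) by (intro linear_map_finsum[OF dual_linear[OF V \<phi>]]) auto
    also have "\<dots> = (\<Oplus>\<^bsub>scalar_space K\<^esub>j\<in>J. (\<phi> (e j) \<odot>\<^bsub>dual_space K V\<^esub> \<epsilon> j) v)"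
      using ev e(2) v dual_closed[OF V \<phi>]
      by (intro S.M.finsum_cong') (auto simp: linear_map_smult[OF dual_linear[OF V \<phi>]] comm)
    also have "\<dots> = (\<Oplus>\<^bsub>dual_space K V\<^esub>j\<in>J. \<phi> (e j) \<odot>\<^bsub>dual_space K V\<^esub> \<epsilon> j) v"
      using cl by (intro dual_finsum[OF V _ v, symmetric]) (auto simp del: dual_space_simps)
    finally show "\<phi> v = (\<Oplus>\<^bsub>dual_space K V\<^esub>j\<in>J. \<phi> (e j) \<odot>\<^bsub>dual_space K V\<^esub> \<epsilon> j) v" .
  qed
  moreover have "(\<lambda>\<phi>\<in>carrier (dual_space K V). \<phi> (e j)) \<in> carrier (dual_space K (dual_space K V))"
    if "j \<in> J" for j
    using dual_restrict[OF eval_linear[OF V e(2)[OF that]]] .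
  ultimately show ?thesis
    using e unfolding dual_basis_def by (auto simp del: dual_space_simps)
qed

lemma dual_fin_dim:
  fixes V :: "('k, 'v, 'm) module_scheme"
  assumes "vectorspace K V" "vectorspace.fin_dim K V"
  shows "vectorspace.fin_dim K (dual_space K V)" "vectorspace.dim K (dual_space K V) = vectorspace.dim K V"
proof -
  obtain J :: "'v set" and e \<epsilon> where b: "dual_basis K V J e \<epsilon>"
    using dual_basis_exists[OF assms] by blast
  note d = dual_basis_dim[OF dual_space_vs[OF assms(1)] dual_basis_dual[OF assms(1) b]]
  show "vectorspace.fin_dim K (dual_space K V)" by (rule d(1))
  show "vectorspace.dim K (dual_space K V) = vectorspace.dim K V"
    using d(2) dual_basis_dim(2)[OF assms(1) b] by simp
qed

text \<open>Surjectivity of V \<rightarrow> DDV, stated without an element of the double dual. It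
  produces vectors out of functionals on DV, for the double annihilator and for the surjectivity of
  the chart map.\<close>

lemma reflexive:
  fixes V :: "('k, 'v, 'm) module_scheme"
  assumes V: "vectorspace K V" "vectorspace.fin_dim K V" and F: "linear_map K (dual_space K V) (scalar_space K) F"
  shows "\<exists>v\<in>carrier V. \<forall>\<phi>\<in>carrier (dual_space K V). F \<phi> = \<phi> v"
proof -
  obtain J :: "'v set" and e \<epsilon> where b: "dual_basis K V J e \<epsilon>"
    using dual_basis_exists[OF V] by blast
  note e = dual_basisD[OF b]
  interpret V: vectorspace K V by fact
  interpret D: vectorspace K "dual_space K V" by (rule dual_space_vs[OF V(1)])
  interpret S: vectorspace K "scalar_space K" by (rule vs_scalar[OF V(1)])
  note comm = V.comm_K
  have Fe: "F (\<epsilon> j) \<in> carrier K" if "j \<in> J" for j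
    using linear_map_closed[OF F e(3)[OF that]] by simp
  show ?thesis
  \<comment> \<open>The vector stays schematic until the final \<open>show\<close>, which makes it
    the sum of the F(\<open>\<epsilon> j\<close>) e j: this is forced, since
    \<open>\<epsilon> j\<close> must take the value F(\<open>\<epsilon> j\<close>) there.\<close>
  proof (intro bexI ballI)
    fix \<phi> assume \<phi>: "\<phi> \<in> carrier (dual_space K V)"
    note L = dual_linear[OF V(1) \<phi>]
    have pe: "\<phi> (e j) \<in> carrier K" if "j \<in> J" for j using dual_closed[OF V(1) \<phi> e(2)[OF that]] .
    have sum: "\<phi> = (\<Oplus>\<^bsub>dual_space K V\<^esub>j\<in>J. \<phi> (e j) \<odot>\<^bsub>dual_space K V\<^esub> \<epsilon> j)"
      using dual_basisD(5)[OF dual_basis_dual[OF V(1) b] \<phi>] \<phi> by simp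
    have "F \<phi> = (\<Oplus>\<^bsub>scalar_space K\<^esub>j\<in>J. F (\<phi> (e j) \<odot>\<^bsub>dual_space K V\<^esub> \<epsilon> j))"
      using pe e(3) by (subst sum, intro linear_map_finsum[OF F]) (auto simp del: dual_space_simps)
    also have "\<dots> = (\<Oplus>\<^bsub>scalar_space K\<^esub>j\<in>J. \<phi> (F (\<epsilon> j) \<odot>\<^bsub>V\<^esub> e j))"
      using pe Fe e(2,3)
      by (intro S.M.finsum_cong') (auto simp: linear_map_smult[OF F] linear_map_smult[OF L] comm simp del: dual_space_simps)
    also have "\<dots> = \<phi> (\<Oplus>\<^bsub>V\<^esub>j\<in>J. F (\<epsilon> j) \<odot>\<^bsub>V\<^esub> e j)"
      using Fe e(2) by (intro linear_map_finsum[OF L, symmetric]) auto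
    finally show "F \<phi> = \<phi> (\<Oplus>\<^bsub>V\<^esub>j\<in>J. F (\<epsilon> j) \<odot>\<^bsub>V\<^esub> e j)" .
  qed (use Fe e(2) in \<open>auto intro!: V.M.finsum_closed\<close>)
qed

section \<open>Annihilators, double annihilators, separation and extension\<close>

definition annihilator where
  "annihilator K V N = {\<phi> \<in> carrier (dual_space K V). \<forall>v\<in>N. \<phi> v = \<zero>\<^bsub>K\<^esub>}"

text \<open>Taking common zeros inside \<open>V\<close>, and not the annihilator in the double dual,
  avoids identifying V with DDV.\<close>

definition preannihilator where
  "preannihilator K V M = {v \<in> carrier V. \<forall>\<phi>\<in>M. \<phi> v = \<zero>\<^bsub>K\<^esub>}"

lemma annihilator_subspace:
  assumes "vectorspace K V" "N \<subseteq> carrier V"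
  shows "VectorSpace.subspace K (annihilator K V N) (dual_space K V)"
proof -
  interpret D: vectorspace K "dual_space K V" by (rule dual_space_vs[OF assms(1)])
  interpret S: vectorspace K "scalar_space K" by (rule vs_scalar[OF assms(1)])
  note cl = D.M.zero_closed D.M.add.m_closed D.smult_closed
  have v: "v \<in> carrier V" if "v \<in> N" for v using assms that by auto
  show ?thesis
    using cl S.M.r_zero[of "\<zero>\<^bsub>K\<^esub>"] S.M.zero_closed S.rmult_0
    by (intro subspaceI D.vectorspace_axioms) (auto simp: annihilator_def v)
qed

lemma preannihilator_subspace:
  assumes "vectorspace K V" "M \<subseteq> carrier (dual_space K V)"
  shows "VectorSpace.subspace K (preannihilator K V M) V"
proof -
  interpret V: vectorspace K V by fact
  interpret S: vectorspace K "scalar_space K" by (rule vs_scalar[OF assms(1)])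
  have L: "linear_map K V (scalar_space K) \<phi>" if "\<phi> \<in> M" for \<phi>
    using dual_linear[OF assms(1)] assms(2) that by auto
  show ?thesis
  proof (rule subspaceI[OF assms(1)])
    fix v w assume "v \<in> preannihilator K V M" "w \<in> preannihilator K V M"
    then have vw: "v \<in> carrier V" "w \<in> carrier V" "\<And>\<phi>. \<phi> \<in> M \<Longrightarrow> \<phi> v = \<zero>\<^bsub>K\<^esub>" "\<And>\<phi>. \<phi> \<in> M \<Longrightarrow> \<phi> w = \<zero>\<^bsub>K\<^esub>"
      by (simp_all add: preannihilator_def)
    moreover have "\<phi> (v \<oplus>\<^bsub>V\<^esub> w) = \<zero>\<^bsub>K\<^esub>" if "\<phi> \<in> M" for \<phi>
      using linear_map_add[OF L[OF that] vw(1,2)] S.M.r_zero[OF S.M.zero_closed] vw(3,4)[OF that] by simp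
    ultimately show "v \<oplus>\<^bsub>V\<^esub> w \<in> preannihilator K V M"
      by (simp add: preannihilator_def)
  next
    fix c v assume "c \<in> carrier K" "v \<in> preannihilator K V M"
    then have v: "c \<in> carrier K" "v \<in> carrier V" "\<And>\<phi>. \<phi> \<in> M \<Longrightarrow> \<phi> v = \<zero>\<^bsub>K\<^esub>"
      by (simp_all add: preannihilator_def)
    moreover have "\<phi> (c \<odot>\<^bsub>V\<^esub> v) = \<zero>\<^bsub>K\<^esub>" if "\<phi> \<in> M" for \<phi>
      using linear_map_smult[OF L[OF that] v(1,2)] S.rmult_0[of c] v(1) v(3)[OF that] by simp
    ultimately show "c \<odot>\<^bsub>V\<^esub> v \<in> preannihilator K V M"
      by (simp add: preannihilator_def)
  qed (auto simp: preannihilator_def linear_map_zero[OF L])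
qed

text \<open>Dualizing exchanges the two parts of the index set: \<open>\<epsilon> j\<close> kills
  \<open>N\<close> when j lies outside \<open>A\<close>, and evaluation at \<open>e j\<close> kills
  the annihilator when j lies in \<open>A\<close>.\<close>

lemma adapted_basis_annihilator:
  assumes V: "vectorspace K V" and N: "N \<subseteq> carrier V" and ad: "adapted_basis K V N J e \<epsilon> A"
  shows "adapted_basis K (dual_space K V) (annihilator K V N) J \<epsilon>
           (\<lambda>j. \<lambda>\<phi>\<in>carrier (dual_space K V). \<phi> (e j)) (J - A)"
  using dual_basis_dual[OF V, of J e \<epsilon>] ad dual_basisD(3)[of K V J e \<epsilon>]
  unfolding adapted_basis_def by (auto simp: annihilator_def)

text \<open>The two dimensions are the sizes of \<open>A\<close> and \<open>J - A\<close> for one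
  adapted basis. The additive form avoids truncated subtraction.\<close>

lemma dim_annihilator:
  fixes V :: "('k, 'v, 'm) module_scheme"
  assumes "vectorspace K V" "vectorspace.fin_dim K V" "VectorSpace.subspace K N V"
  shows "vectorspace.dim K (V\<lparr>carrier := N\<rparr>)
      + vectorspace.dim K ((dual_space K V)\<lparr>carrier := annihilator K V N\<rparr>) = vectorspace.dim K V"
proof -
  obtain J :: "'v set" and e \<epsilon> A where ad: "adapted_basis K V N J e \<epsilon> A"
    using adapted_basis_exists[OF assms] by blast
  then have J: "A \<subseteq> J" "finite J" "dual_basis K V J e \<epsilon>"
    by (auto simp: adapted_basis_def dest: dual_basisD)
  note N = subspaceD(2)[OF assms(3)]
  note ann = annihilator_subspace[OF assms(1) N]
  have "vectorspace.dim K (V\<lparr>carrier := N\<rparr>) = card A"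
    by (rule dual_basis_dim(2)[OF subspace_vs[OF assms(3)] adapted_basis_restrict[OF assms(1,3) ad]])
  moreover have "vectorspace.dim K ((dual_space K V)\<lparr>carrier := annihilator K V N\<rparr>) = card (J - A)"
    by (rule dual_basis_dim(2)[OF subspace_vs[OF ann]
          adapted_basis_restrict[OF dual_space_vs[OF assms(1)] ann adapted_basis_annihilator[OF assms(1) N ad]]])
  moreover have "vectorspace.dim K V = card J"
    by (rule dual_basis_dim(2)[OF assms(1) J(3)])
  ultimately show ?thesis
    using J by (simp add: card_Diff_subset finite_subset card_mono)
qed

lemma adapted_in_subspace:
  assumes V: "vectorspace K V" and N: "VectorSpace.subspace K N V"
    and ad: "adapted_basis K V N J e \<epsilon> A" and v: "v \<in> carrier V"
    and 0: "\<And>j. j \<in> J - A \<Longrightarrow> \<epsilon> j v = \<zero>\<^bsub>K\<^esub>"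
  shows "v \<in> N"
proof -
  have b: "dual_basis K V J e \<epsilon>" "A \<subseteq> J" "e ` A \<subseteq> N" using ad by (auto simp: adapted_basis_def)
  have "(\<Oplus>\<^bsub>V\<^esub>j\<in>A. \<epsilon> j v \<odot>\<^bsub>V\<^esub> e j) \<in> N"
    using b dual_closed[OF V dual_basisD(3)[OF b(1)] v]
    by (intro subspace_finsum[OF N]) (auto intro!: subspaceD(5)[OF N])
  then show ?thesis using adapted_sum[OF V ad v 0] by simp
qed

text \<open>The functionals \<open>\<epsilon> j\<close> with j outside \<open>A\<close> lie in the
  annihilator, so a vector killed by it has all its outer coordinates zero and lies in
  \<open>N\<close>.\<close>

lemma preannihilator_annihilator:
  fixes V :: "('k, 'v, 'm) module_scheme"
  assumes "vectorspace K V" "vectorspace.fin_dim K V" "VectorSpace.subspace K N V"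
  shows "preannihilator K V (annihilator K V N) = N"
proof
  obtain J :: "'v set" and e \<epsilon> A where ad: "adapted_basis K V N J e \<epsilon> A"
    using adapted_basis_exists[OF assms] by blast
  then have "\<epsilon> j \<in> annihilator K V N" if "j \<in> J - A" for j
    using that by (auto simp: adapted_basis_def annihilator_def dest: dual_basisD(3))
  then show "preannihilator K V (annihilator K V N) \<subseteq> N"
    by (auto simp: preannihilator_def intro!: adapted_in_subspace[OF assms(1,3) ad])
  show "N \<subseteq> preannihilator K V (annihilator K V N)"
    using subspaceD(2)[OF assms(3)] by (auto simp: annihilator_def preannihilator_def)
qed

text \<open>Here the adapted basis lives in DV, so the outer coordinates are functionals on DV. By
  reflexivity each is evaluation at a vector, which lies in the preannihilator because the
  coordinate vanishes on \<open>M\<close>.\<close>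

lemma annihilator_preannihilator:
  fixes V :: "('k, 'v, 'm) module_scheme"
  assumes V: "vectorspace K V" "vectorspace.fin_dim K V"
    and M: "VectorSpace.subspace K M (dual_space K V)"
  shows "annihilator K V (preannihilator K V M) = M"
proof
  note D = dual_space_vs[OF V(1)]
  obtain J :: "('v \<Rightarrow> 'k) set" and e \<epsilon> A where ad: "adapted_basis K (dual_space K V) M J e \<epsilon> A"
    using adapted_basis_exists[OF D dual_fin_dim(1)[OF V] M] by blast
  then have b: "dual_basis K (dual_space K V) J e \<epsilon>" "\<And>j m. j \<in> J - A \<Longrightarrow> m \<in> M \<Longrightarrow> \<epsilon> j m = \<zero>\<^bsub>K\<^esub>"
    by (auto simp: adapted_basis_def)
  have "\<epsilon> j \<phi> = \<zero>\<^bsub>K\<^esub>" if j: "j \<in> J - A" and \<phi>: "\<phi> \<in> annihilator K V (preannihilator K V M)" for j \<phi>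
  proof -
    have "linear_map K (dual_space K V) (scalar_space K) (\<epsilon> j)"
      using dual_linear[OF D dual_basisD(3)[OF b(1)]] j by auto
    then obtain v where v: "v \<in> carrier V" "\<And>\<phi>. \<phi> \<in> carrier (dual_space K V) \<Longrightarrow> \<epsilon> j \<phi> = \<phi> v"
      using reflexive[OF V] by blast
    have "\<phi> v = \<zero>\<^bsub>K\<^esub>" if "\<phi> \<in> M" for \<phi>
      using v(2)[of \<phi>] b(2)[OF j that] subspaceD(2)[OF M] that by auto
    then have "v \<in> preannihilator K V M"
      using v(1) by (simp add: preannihilator_def)
    then show ?thesis using \<phi> v by (auto simp: annihilator_def)
  qed
  then show "annihilator K V (preannihilator K V M) \<subseteq> M"
    by (auto simp: annihilator_def intro!: adapted_in_subspace[OF D M ad])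
  show "M \<subseteq> annihilator K V (preannihilator K V M)"
    using subspaceD(2)[OF M] by (auto simp: annihilator_def preannihilator_def)
qed

text \<open>The projection truncates the expansion in an adapted basis to the indices of
  \<open>N\<close>.\<close>

lemma subspace_projection:
  fixes V :: "('k, 'v, 'm) module_scheme"
  assumes V: "vectorspace K V" "vectorspace.fin_dim K V" and N: "VectorSpace.subspace K N V"
  shows "\<exists>p. linear_map K V V p \<and> p ` carrier V \<subseteq> N \<and> (\<forall>n\<in>N. p n = n)"
proof -
  interpret V: vectorspace K V by fact
  obtain J :: "'v set" and e \<epsilon> A where ad: "adapted_basis K V N J e \<epsilon> A"
    using adapted_basis_exists[OF V N] by blast
  then have b: "dual_basis K V J e \<epsilon>" "A \<subseteq> J" "e ` A \<subseteq> N" "\<And>j n. j \<in> J - A \<Longrightarrow> n \<in> N \<Longrightarrow> \<epsilon> j n = \<zero>\<^bsub>K\<^esub>"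
    by (auto simp: adapted_basis_def)
  note e = dual_basisD[OF b(1)]
  let ?p = "\<lambda>v. \<Oplus>\<^bsub>V\<^esub>j\<in>A. \<epsilon> j v \<odot>\<^bsub>V\<^esub> e j"
  have "linear_map K V V (\<lambda>v. \<epsilon> j v \<odot>\<^bsub>V\<^esub> e j)" if "j \<in> A" for j
  proof -
    have j: "j \<in> J" using that b by auto
    note L = dual_linear[OF V(1) e(3)[OF j]]
    show ?thesis
      using linear_map_closed[OF L] e(2)[OF j]
      by (intro linear_mapI V(1))
        (auto simp: linear_map_add[OF L] linear_map_smult[OF L] V.smult_l_distr V.smult_assoc1)
  qed
  then have "linear_map K V V ?p" by (rule linear_map_finsum_map[OF V(1) V(1)])
  moreover have "?p v \<in> N" if "v \<in> carrier V" for v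
    using b dual_closed[OF V(1) e(3) that]
    by (intro subspace_finsum[OF N]) (auto intro!: subspaceD(5)[OF N])
  moreover have "?p n = n" if "n \<in> N" for n
    using adapted_sum[OF V(1) ad _ b(4)[OF _ that]] subspaceD(2)[OF N] that by auto
  ultimately show ?thesis by blast
qed

lemma functional_separates:
  assumes V: "vectorspace K V" "vectorspace.fin_dim K V" and N: "VectorSpace.subspace K N V"
    and v: "v \<in> carrier V" "v \<notin> N"
  shows "\<exists>\<phi>\<in>annihilator K V N. \<phi> v \<noteq> \<zero>\<^bsub>K\<^esub>"
proof (rule ccontr)
  assume "\<not> ?thesis"
  then have "v \<in> preannihilator K V (annihilator K V N)"
    using v by (auto simp: preannihilator_def)
  then show False using preannihilator_annihilator[OF V N] v by simp
qed

lemma zero_subspace: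
  assumes "vectorspace K V"
  shows "VectorSpace.subspace K {\<zero>\<^bsub>V\<^esub>} V"
proof -
  interpret V: vectorspace K V by fact
  show ?thesis by (intro subspaceI assms) auto
qed

lemma functional_nonzero:
  assumes V: "vectorspace K V" "vectorspace.fin_dim K V" and v: "v \<in> carrier V" "v \<noteq> \<zero>\<^bsub>V\<^esub>"
  shows "\<exists>\<phi>\<in>carrier (dual_space K V). \<phi> v \<noteq> \<zero>\<^bsub>K\<^esub>"
  using functional_separates[OF V zero_subspace[OF V(1)] v(1)] v(2) by (auto simp: annihilator_def)

text \<open>Composing with a projection onto \<open>N\<close> extends any linear map on
  \<open>N\<close>, whatever its target.\<close>

lemma functional_extends:
  assumes V: "vectorspace K V" "vectorspace.fin_dim K V" and N: "VectorSpace.subspace K N V"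
    and f: "linear_map K (V\<lparr>carrier := N\<rparr>) Y f"
  shows "\<exists>g. linear_map K V Y g \<and> (\<forall>n\<in>N. g n = f n)"
proof -
  obtain p where p: "linear_map K V V p" "p ` carrier V \<subseteq> N" "\<And>n. n \<in> N \<Longrightarrow> p n = n"
    using subspace_projection[OF V N] by blast
  have "linear_map K V Y (\<lambda>v. f (p v))"
    using p(2) by (intro linear_map_comp[OF _ f] linear_map_into_subspace[OF p(1) N]) auto
  then show ?thesis using p(3) by (intro exI[of _ "\<lambda>v. f (p v)"]) auto
qed

section \<open>Quotients, free spaces and tensor products\<close>

lemma subspace_abelian_subgroup:
  assumes "VectorSpace.subspace K N V"
  shows "abelian_subgroup N V"
proof -
  interpret V: vectorspace K V by (rule subspaceD(1)[OF assms])
  note N = subspaceD[OF assms]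
  have neg: "\<ominus>\<^bsub>V\<^esub> n \<in> N" if "n \<in> N" for n
    using subspace_minus[OF assms N(3) that] N(2) that by (auto simp: a_minus_def subset_iff)
  have "subgroup N (add_monoid V)"
    using N(2-4) neg by (intro V.M.add.subgroupI) (auto simp: a_inv_def)
  then show ?thesis
    by (intro abelian_subgroupI3 additive_subgroup.intro V.M.abelian_group_axioms)
qed

lemma quot_eq_iff:
  assumes "VectorSpace.subspace K N V" "x \<in> carrier V" "y \<in> carrier V"
  shows "N +>\<^bsub>V\<^esub> x = N +>\<^bsub>V\<^esub> y \<longleftrightarrow> x \<ominus>\<^bsub>V\<^esub> y \<in> N"
proof -
  interpret abelian_subgroup N V by (rule subspace_abelian_subgroup[OF assms(1)])
  have "N +>\<^bsub>V\<^esub> x = N +>\<^bsub>V\<^esub> y \<longleftrightarrow> x \<in> N +>\<^bsub>V\<^esub> y"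
    using a_repr_independence'[of x y] a_rcos_self[of x] assms(2,3) by auto
  then show ?thesis using a_rcos_module[OF assms(3,2)] by (simp add: a_minus_def)
qed

lemma carrier_quot_space:
  "carrier (quot_space V N) = (\<lambda>v. N +>\<^bsub>V\<^esub> v) ` carrier V"
  by (auto simp: quot_space_def A_RCOSETS_def')

lemma zero_quot_space [simp]: "\<zero>\<^bsub>quot_space V N\<^esub> = N"
  by (simp add: quot_space_def)

lemma quot_add:
  assumes "VectorSpace.subspace K N V" "x \<in> carrier V" "y \<in> carrier V"
  shows "(N +>\<^bsub>V\<^esub> x) \<oplus>\<^bsub>quot_space V N\<^esub> (N +>\<^bsub>V\<^esub> y) = N +>\<^bsub>V\<^esub> (x \<oplus>\<^bsub>V\<^esub> y)"
  using abelian_subgroup.a_rcos_sum[OF subspace_abelian_subgroup[OF assms(1)] assms(2,3)]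
  by (simp add: quot_space_def)

text \<open>The product is defined as a union over all representatives; two representatives differ
  by an element of \<open>N\<close>, so every set in the union is the same coset.\<close>

lemma quot_smult:
  assumes N: "VectorSpace.subspace K N V" and x: "x \<in> carrier V" and c: "c \<in> carrier K"
  shows "c \<odot>\<^bsub>quot_space V N\<^esub> (N +>\<^bsub>V\<^esub> x) = N +>\<^bsub>V\<^esub> (c \<odot>\<^bsub>V\<^esub> x)"
proof -
  interpret V: vectorspace K V by (rule subspaceD(1)[OF N])
  interpret abelian_subgroup N V by (rule subspace_abelian_subgroup[OF N])
  have "N +>\<^bsub>V\<^esub> (c \<odot>\<^bsub>V\<^esub> y) = N +>\<^bsub>V\<^esub> (c \<odot>\<^bsub>V\<^esub> x)" if y: "y \<in> N +>\<^bsub>V\<^esub> x" for y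
  proof -
    have yc: "y \<in> carrier V" using a_elemrcos_carrier[OF x y] .
    have "y \<ominus>\<^bsub>V\<^esub> x \<in> N" using y a_rcos_module[OF x yc] by (simp add: a_minus_def)
    then have "c \<odot>\<^bsub>V\<^esub> (y \<ominus>\<^bsub>V\<^esub> x) \<in> N" using subspaceD(5)[OF N c] by blast
    moreover have "c \<odot>\<^bsub>V\<^esub> (y \<ominus>\<^bsub>V\<^esub> x) = (c \<odot>\<^bsub>V\<^esub> y) \<ominus>\<^bsub>V\<^esub> (c \<odot>\<^bsub>V\<^esub> x)"
      using c x yc by (simp add: a_minus_def V.smult_r_distr V.smult_r_minus)
    ultimately show ?thesis using quot_eq_iff[OF N] c x yc by simp
  qed
  moreover have "N +>\<^bsub>V\<^esub> x \<noteq> {}" using a_rcos_self[OF x] by blast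
  ultimately have "(\<Union>y\<in>N +>\<^bsub>V\<^esub> x. N +>\<^bsub>V\<^esub> (c \<odot>\<^bsub>V\<^esub> y)) = N +>\<^bsub>V\<^esub> (c \<odot>\<^bsub>V\<^esub> x)"
    by (intro SUP_eq_const)
  then show ?thesis by (simp add: quot_space_def)
qed

lemma quot_proj_zero:
  assumes "VectorSpace.subspace K N V" "x \<in> N"
  shows "N +>\<^bsub>V\<^esub> x = N"
  using abelian_subgroup.a_rcos_const[OF subspace_abelian_subgroup[OF assms(1)] assms(2)] .

lemma quot_space_vs:
  assumes N: "VectorSpace.subspace K N V"
  shows "vectorspace K (quot_space V N)"
proof -
  interpret V: vectorspace K V by (rule subspaceD(1)[OF N])
  note a = quot_add[OF N] and m = quot_smult[OF N] and z = quot_proj_zero[OF N subspaceD(3)[OF N]]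
  have zz: "x \<oplus>\<^bsub>V\<^esub> \<zero>\<^bsub>V\<^esub> = x" if "x \<in> carrier V" for x using that by simp
  show ?thesis
  proof (rule vs_criteria)
    show "field K" by (rule vs_field[OF V.vectorspace_axioms])
    show "\<zero>\<^bsub>quot_space V N\<^esub> \<in> carrier (quot_space V N)"
      using z V.M.zero_closed by (auto simp: carrier_quot_space)
    show "\<forall>v\<in>carrier (quot_space V N). \<exists>w\<in>carrier (quot_space V N).
            v \<oplus>\<^bsub>quot_space V N\<^esub> w = \<zero>\<^bsub>quot_space V N\<^esub>"
    proof
      fix v assume "v \<in> carrier (quot_space V N)"
      then obtain x where x: "x \<in> carrier V" "v = N +>\<^bsub>V\<^esub> x" by (auto simp: carrier_quot_space)
      then show "\<exists>w\<in>carrier (quot_space V N). v \<oplus>\<^bsub>quot_space V N\<^esub> w = \<zero>\<^bsub>quot_space V N\<^esub>"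
        by (intro bexI[of _ "N +>\<^bsub>V\<^esub> (\<ominus>\<^bsub>V\<^esub> x)"]) (auto simp: carrier_quot_space a V.M.r_neg z)
    qed
    show "\<forall>v\<in>carrier (quot_space V N). v \<oplus>\<^bsub>quot_space V N\<^esub> \<zero>\<^bsub>quot_space V N\<^esub> = v"
    proof
      fix v assume "v \<in> carrier (quot_space V N)"
      then obtain x where x: "x \<in> carrier V" "v = N +>\<^bsub>V\<^esub> x" by (auto simp: carrier_quot_space)
      then show "v \<oplus>\<^bsub>quot_space V N\<^esub> \<zero>\<^bsub>quot_space V N\<^esub> = v"
        using a[OF x(1) V.M.zero_closed] z by simp
    qed
  qed (auto simp: carrier_quot_space a m V.M.a_ac V.smult_assoc1 V.smult_l_distr V.smult_r_distr)
qed

lemma quot_proj_linear: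
  assumes N: "VectorSpace.subspace K N V"
  shows "linear_map K V (quot_space V N) (\<lambda>v. N +>\<^bsub>V\<^esub> v)"
  by (rule linear_mapI[OF subspaceD(1)[OF N] quot_space_vs[OF N]])
    (auto simp: carrier_quot_space quot_add[OF N] quot_smult[OF N])

text \<open>This is what gives \<open>the_elem\<close> a meaning in \<open>quot_lift_linear\<close>
  and in \<open>tensor_lift\<close>: a map vanishing on \<open>N\<close> is constant on
  cosets.\<close>

lemma quot_image:
  assumes N: "VectorSpace.subspace K N V" and f: "linear_map K V Y f"
    and 0: "\<And>n. n \<in> N \<Longrightarrow> f n = \<zero>\<^bsub>Y\<^esub>" and x: "x \<in> carrier V"
  shows "f ` (N +>\<^bsub>V\<^esub> x) = {f x}"
proof -
  interpret abelian_subgroup N V by (rule subspace_abelian_subgroup[OF N])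
  interpret Y: vectorspace K Y by (rule linear_map_vs[OF f])
  have "f y = f x" if y: "y \<in> N +>\<^bsub>V\<^esub> x" for y
  proof -
    have yc: "y \<in> carrier V" using a_elemrcos_carrier[OF x y] .
    have "y \<ominus>\<^bsub>V\<^esub> x \<in> N" using y a_rcos_module[OF x yc] by (simp add: a_minus_def)
    then have "f y \<ominus>\<^bsub>Y\<^esub> f x = \<zero>\<^bsub>Y\<^esub>"
      using 0[of "y \<ominus>\<^bsub>V\<^esub> x"] linear_map_minus[OF f yc x] by simp
    then show ?thesis
      using Y.M.minus_other_side[OF linear_map_closed[OF f yc] linear_map_closed[OF f x]] by blast
  qed
  then have "f ` (N +>\<^bsub>V\<^esub> x) \<subseteq> {f x}" by blast
  moreover have "f x \<in> f ` (N +>\<^bsub>V\<^esub> x)" using a_rcos_self[OF x] by blast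
  ultimately show ?thesis by blast
qed

lemma quot_lift_linear:
  assumes N: "VectorSpace.subspace K N V" and f: "linear_map K V Y f"
    and 0: "\<And>n. n \<in> N \<Longrightarrow> f n = \<zero>\<^bsub>Y\<^esub>"
  shows "linear_map K (quot_space V N) Y (\<lambda>C. the_elem (f ` C))"
proof -
  note im = quot_image[OF N f 0]
  interpret V: vectorspace K V by (rule subspaceD(1)[OF N])
  show ?thesis
    by (rule linear_mapI[OF quot_space_vs[OF N] linear_map_vs(2)[OF f]])
      (auto simp: carrier_quot_space quot_add[OF N] quot_smult[OF N] im linear_map_closed[OF f]
        linear_map_add[OF f] linear_map_smult[OF f])
qed

section \<open>Free vector spaces and their universal property\<close>

lemma free_space_simps:
  assumes "field K"
  shows "carrier (free_space K S) = {r \<in> S \<rightarrow>\<^sub>E carrier K. finite {s \<in> S. r s \<noteq> \<zero>\<^bsub>K\<^esub>}}"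
    "\<zero>\<^bsub>free_space K S\<^esub> = (\<lambda>s\<in>S. \<zero>\<^bsub>K\<^esub>)"
    "r \<oplus>\<^bsub>free_space K S\<^esub> r' = (\<lambda>s\<in>S. r s \<oplus>\<^bsub>K\<^esub> r' s)"
    "c \<odot>\<^bsub>free_space K S\<^esub> r = (\<lambda>s\<in>S. c \<otimes>\<^bsub>K\<^esub> r s)"
proof -
  interpret field K by fact
  show "carrier (free_space K S) = {r \<in> S \<rightarrow>\<^sub>E carrier K. finite {s \<in> S. r s \<noteq> \<zero>\<^bsub>K\<^esub>}}"
    "\<zero>\<^bsub>free_space K S\<^esub> = (\<lambda>s\<in>S. \<zero>\<^bsub>K\<^esub>)"
    "r \<oplus>\<^bsub>free_space K S\<^esub> r' = (\<lambda>s\<in>S. r s \<oplus>\<^bsub>K\<^esub> r' s)"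
    "c \<odot>\<^bsub>free_space K S\<^esub> r = (\<lambda>s\<in>S. c \<otimes>\<^bsub>K\<^esub> r s)"
    by (simp_all add: free_space_def func_space_def)
qed

text \<open>Finitely supported functions form a subspace of all functions, since the support of a
  sum lies in the union of the supports.\<close>

lemma free_space_vs:
  assumes "field K"
  shows "vectorspace K (free_space K S)"
proof -
  interpret S: vectorspace K "scalar_space K" by (rule scalar_space_vs[OF assms])
  let ?N = "{r \<in> S \<rightarrow>\<^sub>E carrier K. finite {s \<in> S. r s \<noteq> \<zero>\<^bsub>K\<^esub>}}"
  have "VectorSpace.subspace K ?N (ring.func_space K S)"
  proof (rule subspaceI[OF S.func_space_is_vs])
    show "\<zero>\<^bsub>ring.func_space K S\<^esub> \<in> ?N" by (auto simp: S.func_space_def)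
  next
    fix v w assume vw: "v \<in> ?N" "w \<in> ?N"
    have "finite ({s \<in> S. v s \<noteq> \<zero>\<^bsub>K\<^esub>} \<union> {s \<in> S. w s \<noteq> \<zero>\<^bsub>K\<^esub>})" using vw by auto
    then have "finite {s \<in> S. v s \<oplus>\<^bsub>K\<^esub> w s \<noteq> \<zero>\<^bsub>K\<^esub>}"
      by (rule rev_finite_subset) auto
    then show "v \<oplus>\<^bsub>ring.func_space K S\<^esub> w \<in> ?N"
      using vw by (auto simp: S.func_space_def cong: conj_cong)
  next
    fix c v assume cv: "c \<in> carrier K" "v \<in> ?N"
    then have "finite {s \<in> S. v s \<noteq> \<zero>\<^bsub>K\<^esub>}" by auto
    then have "finite {s \<in> S. c \<otimes>\<^bsub>K\<^esub> v s \<noteq> \<zero>\<^bsub>K\<^esub>}"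
      by (rule rev_finite_subset) (use cv in auto)
    then show "c \<odot>\<^bsub>ring.func_space K S\<^esub> v \<in> ?N"
      using cv by (auto simp: S.func_space_def cong: conj_cong)
  qed (auto simp: S.func_space_def)
  from subspace_vs[OF this] show ?thesis by (simp add: free_space_def)
qed

lemma free_gen_closed:
  assumes "field K" "s \<in> S"
  shows "free_gen K S s \<in> carrier (free_space K S)"
proof -
  interpret field K by fact
  have "finite {t \<in> S. free_gen K S s t \<noteq> \<zero>\<^bsub>K\<^esub>}"
    by (rule finite_subset[of _ "{s}"]) (auto simp: free_gen_def)
  then show ?thesis by (auto simp: free_space_simps[OF assms(1)] free_gen_def)
qed

lemma free_space_eval_linear:
  assumes "field K" "s \<in> S"
  shows "linear_map K (free_space K S) (scalar_space K) (\<lambda>r. r s)"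
  using assms(2)
  by (intro linear_mapI free_space_vs scalar_space_vs assms(1)) (auto simp: free_space_simps[OF assms(1)])

lemma free_space_expansion:
  assumes K: "field K" and r: "r \<in> carrier (free_space K S)"
  shows "r = (\<Oplus>\<^bsub>free_space K S\<^esub>s\<in>{s \<in> S. r s \<noteq> \<zero>\<^bsub>K\<^esub>}. r s \<odot>\<^bsub>free_space K S\<^esub> free_gen K S s)"
    (is "r = ?sum")
proof -
  interpret F: vectorspace K "free_space K S" by (rule free_space_vs[OF K])
  interpret S: vectorspace K "scalar_space K" by (rule scalar_space_vs[OF K])
  let ?T = "{s \<in> S. r s \<noteq> \<zero>\<^bsub>K\<^esub>}"
  have fin: "finite ?T" using r by (auto simp: free_space_simps[OF K])
  have rc: "r s \<in> carrier K" if "s \<in> S" for s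
    using r that by (auto simp: free_space_simps[OF K])
  have tc: "r s \<odot>\<^bsub>free_space K S\<^esub> free_gen K S s \<in> carrier (free_space K S)" if "s \<in> S" for s
    using rc[OF that] free_gen_closed[OF K that] by (rule F.smult_closed)
  have sc: "?sum \<in> carrier (free_space K S)" using tc by (intro F.M.finsum_closed) auto
  have "r t = ?sum t" if t: "t \<in> S" for t
  proof -
    have "?sum t = (\<Oplus>\<^bsub>scalar_space K\<^esub>s\<in>?T. (r s \<odot>\<^bsub>free_space K S\<^esub> free_gen K S s) t)"
      using tc by (intro linear_map_finsum[OF free_space_eval_linear[OF K t]]) auto
    also have "\<dots> = (\<Oplus>\<^bsub>scalar_space K\<^esub>s\<in>?T. if t = s then r s else \<zero>\<^bsub>scalar_space K\<^esub>)"
      using t rc by (intro S.M.finsum_cong') (auto simp: free_space_simps[OF K] free_gen_def)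
    also have "\<dots> = (if t \<in> ?T then r t else \<zero>\<^bsub>K\<^esub>)"
    proof (cases "t \<in> ?T")
      case True
      have "(\<lambda>s. r s) \<in> ?T \<rightarrow> carrier (scalar_space K)" using rc by auto
      from S.M.finsum_singleton[OF True fin this] True show ?thesis by simp
    next
      case False
      then have "(\<Oplus>\<^bsub>scalar_space K\<^esub>s\<in>?T. if t = s then r s else \<zero>\<^bsub>scalar_space K\<^esub>)
          = (\<Oplus>\<^bsub>scalar_space K\<^esub>s\<in>?T. \<zero>\<^bsub>scalar_space K\<^esub>)"
        using rc S.M.zero_closed by (intro S.M.finsum_cong') auto
      with False show ?thesis by (simp add: S.M.finsum_zero)
    qed
    finally show ?thesis using t by auto
  qed
  moreover have "r \<in> extensional S" "?sum \<in> extensional S"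
    using r sc by (auto simp: free_space_simps[OF K] PiE_iff)
  ultimately show ?thesis by (rule extensionalityI[rotated 2]) 
qed

text \<open>With S a product of carriers and g given by a bilinear map, this is the very sum that
  occurs in \<open>tensor_lift\<close>.\<close>

definition free_lift where
  "free_lift K S Y g r = (\<Oplus>\<^bsub>Y\<^esub>s\<in>{s \<in> S. r s \<noteq> \<zero>\<^bsub>K\<^esub>}. r s \<odot>\<^bsub>Y\<^esub> g s)"

text \<open>The support of a sum may be smaller than the union of the supports. Additivity therefore
  needs the sums taken over a common finite index set, where the added terms are zero.\<close>

lemma free_lift_superset:
  assumes Y: "vectorspace K Y" and g: "g \<in> S \<rightarrow> carrier Y" and r: "r \<in> carrier (free_space K S)"
    and T: "finite T" "T \<subseteq> S" "{s \<in> S. r s \<noteq> \<zero>\<^bsub>K\<^esub>} \<subseteq> T"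
  shows "free_lift K S Y g r = (\<Oplus>\<^bsub>Y\<^esub>s\<in>T. r s \<odot>\<^bsub>Y\<^esub> g s)"
proof -
  interpret Y: vectorspace K Y by fact
  have rc: "r s \<in> carrier K" "g s \<in> carrier Y" if "s \<in> S" for s
    using r g that by (auto simp: free_space_simps[OF vs_field[OF Y]])
  show ?thesis
    unfolding free_lift_def using T rc
    by (intro Y.M.add.finprod_mono_neutral_cong_left) (auto simp: subset_iff)
qed

lemma free_lift_linear:
  assumes Y: "vectorspace K Y" and g: "g \<in> S \<rightarrow> carrier Y"
  shows "linear_map K (free_space K S) Y (free_lift K S Y g)"
proof -
  note K = vs_field[OF Y]
  interpret Y: vectorspace K Y by fact
  interpret F: vectorspace K "free_space K S" by (rule free_space_vs[OF K])
  note F = free_space_simps[OF K]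
  have rc: "r s \<in> carrier K" if "s \<in> S" "r \<in> carrier (free_space K S)" for r s
    using that by (auto simp: F)
  have fin: "finite {s \<in> S. r s \<noteq> \<zero>\<^bsub>K\<^esub>}" if "r \<in> carrier (free_space K S)" for r
    using that by (auto simp: F)
  have gc: "g s \<in> carrier Y" if "s \<in> S" for s using g that by auto
  show ?thesis
  proof (rule linear_mapI[OF F.vectorspace_axioms Y])
    fix r assume r: "r \<in> carrier (free_space K S)"
    then show "free_lift K S Y g r \<in> carrier Y"
      unfolding free_lift_def using rc gc by (intro Y.M.finsum_closed) auto
    fix r' assume r': "r' \<in> carrier (free_space K S)"
    let ?T = "{s \<in> S. r s \<noteq> \<zero>\<^bsub>K\<^esub>} \<union> {s \<in> S. r' s \<noteq> \<zero>\<^bsub>K\<^esub>}"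
    have T: "finite ?T" "?T \<subseteq> S" using fin r r' by auto
    have "free_lift K S Y g (r \<oplus>\<^bsub>free_space K S\<^esub> r')
        = (\<Oplus>\<^bsub>Y\<^esub>s\<in>?T. (r \<oplus>\<^bsub>free_space K S\<^esub> r') s \<odot>\<^bsub>Y\<^esub> g s)"
      using F.M.add.m_closed[OF r r'] by (intro free_lift_superset[OF Y g _ T]) (auto simp: F(3))
    also have "\<dots> = (\<Oplus>\<^bsub>Y\<^esub>s\<in>?T. r s \<odot>\<^bsub>Y\<^esub> g s \<oplus>\<^bsub>Y\<^esub> r' s \<odot>\<^bsub>Y\<^esub> g s)"
      using rc[OF _ r] rc[OF _ r'] gc by (intro Y.M.finsum_cong') (auto simp: F(3) Y.smult_l_distr)
    also have "\<dots> = (\<Oplus>\<^bsub>Y\<^esub>s\<in>?T. r s \<odot>\<^bsub>Y\<^esub> g s) \<oplus>\<^bsub>Y\<^esub> (\<Oplus>\<^bsub>Y\<^esub>s\<in>?T. r' s \<odot>\<^bsub>Y\<^esub> g s)"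
      using rc[OF _ r] rc[OF _ r'] gc by (intro Y.M.finsum_addf) auto
    also have "(\<Oplus>\<^bsub>Y\<^esub>s\<in>?T. r s \<odot>\<^bsub>Y\<^esub> g s) = free_lift K S Y g r"
      by (rule free_lift_superset[OF Y g r T, symmetric]) auto
    also have "(\<Oplus>\<^bsub>Y\<^esub>s\<in>?T. r' s \<odot>\<^bsub>Y\<^esub> g s) = free_lift K S Y g r'"
      by (rule free_lift_superset[OF Y g r' T, symmetric]) auto
    finally show "free_lift K S Y g (r \<oplus>\<^bsub>free_space K S\<^esub> r')
        = free_lift K S Y g r \<oplus>\<^bsub>Y\<^esub> free_lift K S Y g r'" .
  next
    fix c r assume c: "c \<in> carrier K" and r: "r \<in> carrier (free_space K S)"
    let ?T = "{s \<in> S. r s \<noteq> \<zero>\<^bsub>K\<^esub>}"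
    have T: "finite ?T" "?T \<subseteq> S" using fin r by auto
    have "free_lift K S Y g (c \<odot>\<^bsub>free_space K S\<^esub> r)
        = (\<Oplus>\<^bsub>Y\<^esub>s\<in>?T. (c \<odot>\<^bsub>free_space K S\<^esub> r) s \<odot>\<^bsub>Y\<^esub> g s)"
      using F.smult_closed[OF c r] c by (intro free_lift_superset[OF Y g _ T]) (auto simp: F(4))
    also have "\<dots> = (\<Oplus>\<^bsub>Y\<^esub>s\<in>?T. c \<odot>\<^bsub>Y\<^esub> (r s \<odot>\<^bsub>Y\<^esub> g s))"
      using rc[OF _ r] gc c by (intro Y.M.finsum_cong') (auto simp: F(4) Y.smult_assoc1)
    also have "\<dots> = c \<odot>\<^bsub>Y\<^esub> free_lift K S Y g r"
      unfolding free_lift_def using rc[OF _ r] gc c by (intro Y.finsum_smult[symmetric]) auto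
    finally show "free_lift K S Y g (c \<odot>\<^bsub>free_space K S\<^esub> r) = c \<odot>\<^bsub>Y\<^esub> free_lift K S Y g r" .
  qed
qed

lemma free_lift_gen:
  assumes Y: "vectorspace K Y" and g: "g \<in> S \<rightarrow> carrier Y" and s: "s \<in> S"
  shows "free_lift K S Y g (free_gen K S s) = g s"
proof -
  interpret Y: vectorspace K Y by fact
  have "g s \<in> carrier Y" using g s by auto
  moreover have "{t \<in> S. free_gen K S s t \<noteq> \<zero>\<^bsub>K\<^esub>} = {s}"
    using s Y.one_not_zero by (auto simp: free_gen_def)
  ultimately show ?thesis using s by (simp add: free_lift_def free_gen_def)
qed

section \<open>Bilinear maps, the tensor product and its universal property\<close>

definition bilinear_map where
  "bilinear_map K V W Y b \<longleftrightarrow>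
     (\<forall>v\<in>carrier V. linear_map K W Y (b v)) \<and> (\<forall>w\<in>carrier W. linear_map K V Y (\<lambda>v. b v w))"

locale two_spaces =
  fixes K :: "('k, 'r) ring_scheme" and V :: "('k, 'v, 'x) module_scheme"
    and W :: "('k, 'w, 'y) module_scheme"
  assumes V: "vectorspace K V" and W: "vectorspace K W"
begin

lemma K: "field K" by (rule vs_field[OF V])

sublocale V: vectorspace K V by (rule V)
sublocale W: vectorspace K W by (rule W)

abbreviation "S \<equiv> carrier V \<times> carrier W"
abbreviation "F \<equiv> free_space K S"
abbreviation "e v w \<equiv> free_gen K S (v, w)"
abbreviation "T \<equiv> tensor K V W"
abbreviation "pure v w \<equiv> pure_tensor K V W v w"

sublocale F: vectorspace K F by (rule free_space_vs[OF K])

lemma gen_closed: "v \<in> carrier V \<Longrightarrow> w \<in> carrier W \<Longrightarrow> e v w \<in> carrier F"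
  by (rule free_gen_closed[OF K]) auto

lemma tensor_relations_closed: "tensor_relations K V W \<subseteq> carrier F"
proof -
  note F.M.minus_closed [intro] F.M.add.m_closed [intro] F.smult_closed [intro] gen_closed [intro]
    V.M.add.m_closed [intro] W.M.add.m_closed [intro] V.smult_closed [intro] W.smult_closed [intro]
  show ?thesis
    unfolding tensor_relations_def Let_def by auto
qed

lemma tensor_null_subspace: "VectorSpace.subspace K (tensor_null K V W) F"
  unfolding tensor_null_def by (rule F.span_is_subspace[OF tensor_relations_closed])

lemma relation_in_null: "x \<in> tensor_relations K V W \<Longrightarrow> x \<in> tensor_null K V W"
  using F.in_own_span[OF tensor_relations_closed] unfolding tensor_null_def by auto

lemma tensor_vs: "vectorspace K T"
  unfolding tensor_def by (rule quot_space_vs[OF tensor_null_subspace])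

sublocale T: vectorspace K T by (rule tensor_vs)

lemma pure_closed: "v \<in> carrier V \<Longrightarrow> w \<in> carrier W \<Longrightarrow> pure v w \<in> carrier T"
  unfolding tensor_def pure_tensor_def carrier_quot_space using gen_closed by blast

lemma pure_add_left:
  assumes "v \<in> carrier V" "v' \<in> carrier V" "w \<in> carrier W"
  shows "pure (v \<oplus>\<^bsub>V\<^esub> v') w = pure v w \<oplus>\<^bsub>T\<^esub> pure v' w"
proof -
  have "e (v \<oplus>\<^bsub>V\<^esub> v') w \<ominus>\<^bsub>F\<^esub> (e v w \<oplus>\<^bsub>F\<^esub> e v' w) \<in> tensor_null K V W"
    using assms by (intro relation_in_null) (unfold tensor_relations_def Let_def, blast)
  then show ?thesis
    unfolding pure_tensor_def tensor_def
    using assms by (simp add: quot_add[OF tensor_null_subspace] gen_closed quot_eq_iff[OF tensor_null_subspace])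
qed

lemma pure_add_right:
  assumes "v \<in> carrier V" "w \<in> carrier W" "w' \<in> carrier W"
  shows "pure v (w \<oplus>\<^bsub>W\<^esub> w') = pure v w \<oplus>\<^bsub>T\<^esub> pure v w'"
proof -
  have "e v (w \<oplus>\<^bsub>W\<^esub> w') \<ominus>\<^bsub>F\<^esub> (e v w \<oplus>\<^bsub>F\<^esub> e v w') \<in> tensor_null K V W"
    using assms by (intro relation_in_null) (unfold tensor_relations_def Let_def, blast)
  then show ?thesis
    unfolding pure_tensor_def tensor_def
    using assms by (simp add: quot_add[OF tensor_null_subspace] gen_closed quot_eq_iff[OF tensor_null_subspace])
qed

lemma pure_smult_left:
  assumes "c \<in> carrier K" "v \<in> carrier V" "w \<in> carrier W"
  shows "pure (c \<odot>\<^bsub>V\<^esub> v) w = c \<odot>\<^bsub>T\<^esub> pure v w"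
proof -
  have "e (c \<odot>\<^bsub>V\<^esub> v) w \<ominus>\<^bsub>F\<^esub> (c \<odot>\<^bsub>F\<^esub> e v w) \<in> tensor_null K V W"
    using assms by (intro relation_in_null) (unfold tensor_relations_def Let_def, blast)
  then show ?thesis
    unfolding pure_tensor_def tensor_def
    using assms by (simp add: quot_smult[OF tensor_null_subspace] gen_closed quot_eq_iff[OF tensor_null_subspace])
qed

lemma pure_smult_right:
  assumes "c \<in> carrier K" "v \<in> carrier V" "w \<in> carrier W"
  shows "pure v (c \<odot>\<^bsub>W\<^esub> w) = c \<odot>\<^bsub>T\<^esub> pure v w"
proof -
  have "e v (c \<odot>\<^bsub>W\<^esub> w) \<ominus>\<^bsub>F\<^esub> (c \<odot>\<^bsub>F\<^esub> e v w) \<in> tensor_null K V W"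
    using assms by (intro relation_in_null) (unfold tensor_relations_def Let_def, blast)
  then show ?thesis
    unfolding pure_tensor_def tensor_def
    using assms by (simp add: quot_smult[OF tensor_null_subspace] gen_closed quot_eq_iff[OF tensor_null_subspace])
qed

lemma pure_bilinear: "bilinear_map K V W T pure"
  unfolding bilinear_map_def
  by (intro conjI ballI linear_mapI V W tensor_vs)
    (simp_all add: pure_closed pure_add_left pure_add_right pure_smult_left pure_smult_right)

text \<open>No scalar case and no zero case: a multiple of a pure tensor is again pure, the scalar
  being absorbed in the first factor, and zero is the pure tensor of two zeros.\<close>

lemma tensor_induct [consumes 1, case_names pure add]:
  assumes x: "x \<in> carrier T" and pure: "\<And>v w. v \<in> carrier V \<Longrightarrow> w \<in> carrier W \<Longrightarrow> P (pure v w)"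
    and add: "\<And>x y. x \<in> carrier T \<Longrightarrow> y \<in> carrier T \<Longrightarrow> P x \<Longrightarrow> P y \<Longrightarrow> P (x \<oplus>\<^bsub>T\<^esub> y)"
  shows "P x"
proof -
  let ?\<pi> = "\<lambda>r. tensor_null K V W +>\<^bsub>F\<^esub> r"
  have \<pi>: "linear_map K F T ?\<pi>"
    unfolding tensor_def by (rule quot_proj_linear[OF tensor_null_subspace])
  obtain r where r: "r \<in> carrier F" "x = ?\<pi> r"
    using x unfolding tensor_def carrier_quot_space by blast
  let ?A = "{s \<in> S. r s \<noteq> \<zero>\<^bsub>K\<^esub>}"
  have fin: "finite ?A" and rc: "\<And>s. s \<in> S \<Longrightarrow> r s \<in> carrier K"
    using r(1) by (auto simp: free_space_simps[OF K])
  have gc: "s \<in> S \<Longrightarrow> r s \<odot>\<^bsub>F\<^esub> free_gen K S s \<in> carrier F" for s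
    using rc free_gen_closed[OF K] by (intro F.smult_closed)
  have summand: "P (?\<pi> (r s \<odot>\<^bsub>F\<^esub> free_gen K S s)) \<and> ?\<pi> (r s \<odot>\<^bsub>F\<^esub> free_gen K S s) \<in> carrier T" if sS: "s \<in> S" for s
  proof -
    obtain v w where s: "s = (v, w)" "v \<in> carrier V" "w \<in> carrier W" using sS by (cases s) auto
    have "?\<pi> (r s \<odot>\<^bsub>F\<^esub> free_gen K S s) = pure (r s \<odot>\<^bsub>V\<^esub> v) w"
      using s rc[OF sS] linear_map_smult[OF \<pi> rc[OF sS] free_gen_closed[OF K that]]
      by (simp add: pure_smult_left) (simp add: pure_tensor_def)
    then show ?thesis using pure[of "r s \<odot>\<^bsub>V\<^esub> v" w] s rc[OF sS] pure_closed by auto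
  qed
  \<comment> \<open>Needed for the empty sum at which the induction over the support starts.\<close>
  have zero: "P \<zero>\<^bsub>T\<^esub>"
    using pure[of "\<zero>\<^bsub>K\<^esub> \<odot>\<^bsub>V\<^esub> \<zero>\<^bsub>V\<^esub>" "\<zero>\<^bsub>W\<^esub>"] pure_smult_left[of "\<zero>\<^bsub>K\<^esub>" "\<zero>\<^bsub>V\<^esub>" "\<zero>\<^bsub>W\<^esub>"]
      pure_closed[of "\<zero>\<^bsub>V\<^esub>" "\<zero>\<^bsub>W\<^esub>"] by simp
  have sum: "P (\<Oplus>\<^bsub>T\<^esub>s\<in>B. ?\<pi> (r s \<odot>\<^bsub>F\<^esub> free_gen K S s))" if "finite B" "B \<subseteq> S" for B
    using that
  proof (induction B rule: finite_induct)
    case (insert s B)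
    have mem: "(\<lambda>s. ?\<pi> (r s \<odot>\<^bsub>F\<^esub> free_gen K S s)) \<in> B \<rightarrow> carrier T"
      using insert.prems summand by blast
    have s: "P (?\<pi> (r s \<odot>\<^bsub>F\<^esub> free_gen K S s))" "?\<pi> (r s \<odot>\<^bsub>F\<^esub> free_gen K S s) \<in> carrier T"
      using insert.prems summand[of s] by blast+
    show ?case
      unfolding T.M.finsum_insert[OF insert.hyps(1,2) mem s(2)]
      using insert s mem by (intro add T.M.finsum_closed) auto
  qed (use zero in simp)
  have "x = ?\<pi> (\<Oplus>\<^bsub>F\<^esub>s\<in>?A. r s \<odot>\<^bsub>F\<^esub> free_gen K S s)"
    using free_space_expansion[OF K r(1)] r(2) by simp
  also have "\<dots> = (\<Oplus>\<^bsub>T\<^esub>s\<in>?A. ?\<pi> (r s \<odot>\<^bsub>F\<^esub> free_gen K S s))"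
    using gc by (intro linear_map_finsum[OF \<pi>]) blast
  finally show ?thesis using sum[OF fin] by auto
qed

lemma tensor_linear_eq:
  assumes "linear_map K T Y f" "linear_map K T Y g"
    and "\<And>v w. v \<in> carrier V \<Longrightarrow> w \<in> carrier W \<Longrightarrow> f (pure v w) = g (pure v w)"
    and "x \<in> carrier T"
  shows "f x = g x"
  using assms(4)
  by (induction rule: tensor_induct)
    (auto simp: assms(3) linear_map_add[OF assms(1)] linear_map_add[OF assms(2)])

context
  fixes Y :: "('k, 'u, 'z) module_scheme" and b :: "'v \<Rightarrow> 'w \<Rightarrow> 'u"
  assumes Y: "vectorspace K Y" and b: "bilinear_map K V W Y b"
begin

lemma bl: "v \<in> carrier V \<Longrightarrow> linear_map K W Y (b v)" and br: "w \<in> carrier W \<Longrightarrow> linear_map K V Y (\<lambda>v. b v w)"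
  using b by (auto simp: bilinear_map_def)

abbreviation (input) "B \<equiv> free_lift K S Y (\<lambda>p. b (fst p) (snd p))"

lemma b_closed: "v \<in> carrier V \<Longrightarrow> w \<in> carrier W \<Longrightarrow> b v w \<in> carrier Y"
  using linear_map_closed[OF bl] .

lemma B_linear: "linear_map K F Y B"
  by (rule free_lift_linear[OF Y]) (auto simp: b_closed)

lemma B_gen: "v \<in> carrier V \<Longrightarrow> w \<in> carrier W \<Longrightarrow> B (e v w) = b v w"
  by (subst free_lift_gen[OF Y]) (auto simp: b_closed)

text \<open>Bilinearity of \<open>b\<close> says precisely that the four kinds of relations lie in
  the kernel of the linear extension; being a subspace, the kernel contains their span.\<close>

lemma B_null:
  assumes "n \<in> tensor_null K V W"
  shows "B n = \<zero>\<^bsub>Y\<^esub>"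
proof -
  interpret Y: vectorspace K Y by (rule Y)
  let ?N = "{r \<in> carrier F. B r = \<zero>\<^bsub>Y\<^esub>}"
  note L = linear_map_minus[OF B_linear] linear_map_add[OF B_linear] linear_map_smult[OF B_linear]
  note cl = F.M.minus_closed F.M.add.m_closed F.smult_closed gen_closed
    V.M.add.m_closed W.M.add.m_closed V.smult_closed W.smult_closed
  have "tensor_relations K V W \<subseteq> ?N"
    unfolding tensor_relations_def Let_def
    by (auto simp: L cl B_gen linear_map_add[OF bl] linear_map_smult[OF bl]
        linear_map_add[OF br] linear_map_smult[OF br] b_closed)
  then have "tensor_null K V W \<subseteq> ?N"
    unfolding tensor_null_def using kernel_subspace[OF B_linear]
    by (intro F.span_is_subset) (auto simp: VectorSpace.subspace_def)
  then show ?thesis using assms by auto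
qed

lemma tensor_lift_eq: "C \<in> carrier T \<Longrightarrow> tensor_lift K V W Y b C = the_elem (B ` C)"
  by (simp add: tensor_lift_def free_lift_def[abs_def])

lemma tensor_lift_linear: "linear_map K T Y (tensor_lift K V W Y b)"
proof (rule linear_map_cong[OF _ tensor_lift_eq])
  show "linear_map K T Y (\<lambda>C. the_elem (B ` C))"
    unfolding tensor_def by (rule quot_lift_linear[OF tensor_null_subspace B_linear B_null])
qed

lemma tensor_lift_pure:
  assumes "v \<in> carrier V" "w \<in> carrier W"
  shows "tensor_lift K V W Y b (pure v w) = b v w"
  using quot_image[OF tensor_null_subspace B_linear B_null gen_closed[OF assms]] B_gen[OF assms]
  by (simp add: tensor_lift_eq pure_closed assms) (simp add: pure_tensor_def)

lemma tensor_lift_extensional: "tensor_lift K V W Y b \<in> extensional (carrier T)"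
  by (simp add: tensor_lift_def)

end

text \<open>Only the second factor is expanded in a basis, scalars being moved to the first. A
  tensor is then described by one vector of \<open>V\<close> for each index, and a tensor of
  functionals can pick these vectors out.\<close>

lemma tensor_normal_form:
  assumes d: "dual_basis K W J f \<eta>" and x: "x \<in> carrier T"
  shows "\<exists>g\<in>J \<rightarrow> carrier V. x = (\<Oplus>\<^bsub>T\<^esub>j\<in>J. pure (g j) (f j))"
  using x
proof (induction rule: tensor_induct)
  note f = dual_basisD[OF d]
  case (pure v w)
  have \<eta>: "\<eta> j w \<in> carrier K" if "j \<in> J" for j
    using dual_closed[OF W f(3)[OF that]] pure by blast
  have "pure v w = pure v (\<Oplus>\<^bsub>W\<^esub>j\<in>J. \<eta> j w \<odot>\<^bsub>W\<^esub> f j)"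
    using f(5)[of w] pure by simp
  also have "\<dots> = (\<Oplus>\<^bsub>T\<^esub>j\<in>J. pure v (\<eta> j w \<odot>\<^bsub>W\<^esub> f j))"
    using pure_bilinear pure \<eta> f(2) by (intro linear_map_finsum) (auto simp: bilinear_map_def)
  also have "\<dots> = (\<Oplus>\<^bsub>T\<^esub>j\<in>J. pure (\<eta> j w \<odot>\<^bsub>V\<^esub> v) (f j))"
    using pure \<eta> f(2) by (intro T.M.finsum_cong') (auto simp: pure_smult_left pure_smult_right pure_closed)
  finally show ?case
    using pure \<eta> by (intro bexI[of _ "\<lambda>j. \<eta> j w \<odot>\<^bsub>V\<^esub> v"]) auto
next
  note f = dual_basisD[OF d]
  case (add x y)
  then obtain g h where g: "g \<in> J \<rightarrow> carrier V" "x = (\<Oplus>\<^bsub>T\<^esub>j\<in>J. pure (g j) (f j))"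
    and h: "h \<in> J \<rightarrow> carrier V" "y = (\<Oplus>\<^bsub>T\<^esub>j\<in>J. pure (h j) (f j))" by blast
  have gh: "g j \<in> carrier V" "h j \<in> carrier V" if "j \<in> J" for j using g h that by auto
  have "(\<Oplus>\<^bsub>T\<^esub>j\<in>J. pure (g j \<oplus>\<^bsub>V\<^esub> h j) (f j)) = (\<Oplus>\<^bsub>T\<^esub>j\<in>J. pure (g j) (f j) \<oplus>\<^bsub>T\<^esub> pure (h j) (f j))"
    using gh f(2) by (intro T.M.finsum_cong') (auto simp: pure_add_left pure_closed)
  also have "\<dots> = x \<oplus>\<^bsub>T\<^esub> y"
    unfolding g h using gh f(2) by (intro T.M.finsum_addf) (auto simp: pure_closed)
  finally show ?case
    using gh by (intro bexI[of _ "\<lambda>j. g j \<oplus>\<^bsub>V\<^esub> h j"]) auto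
qed

end

section \<open>Duality of tensor products\<close>

lemma tensor_map_bilinear:
  assumes "linear_map K V V' f" "linear_map K W W' g"
  shows "bilinear_map K V W (tensor K V' W') (\<lambda>v w. pure_tensor K V' W' (f v) (g w))"
proof -
  interpret two_spaces K V' W' by (rule two_spaces.intro[OF linear_map_vs(2)[OF assms(1)] linear_map_vs(2)[OF assms(2)]])
  show ?thesis
    using pure_bilinear linear_map_closed[OF assms(1)] linear_map_closed[OF assms(2)]
    unfolding bilinear_map_def
    by (auto intro: linear_map_comp[OF assms(1)] linear_map_comp[OF assms(2)])
qed

lemma
  assumes f: "linear_map K V V' f" and g: "linear_map K W W' g"
  shows tensor_map_linear:
      "linear_map K (tensor K V W) (tensor K V' W') (tensor_map K V W V' W' f g)"
    and tensor_map_pure: "\<And>v w. v \<in> carrier V \<Longrightarrow> w \<in> carrier W \<Longrightarrow>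
      tensor_map K V W V' W' f g (pure_tensor K V W v w) = pure_tensor K V' W' (f v) (g w)"
proof -
  interpret two_spaces K V W by (rule two_spaces.intro[OF linear_map_vs(1)[OF f] linear_map_vs(1)[OF g]])
  interpret ts': two_spaces K V' W' by (rule two_spaces.intro[OF linear_map_vs(2)[OF f] linear_map_vs(2)[OF g]])
  note b = ts'.tensor_vs tensor_map_bilinear[OF f g]
  show "linear_map K (tensor K V W) (tensor K V' W') (tensor_map K V W V' W' f g)"
    unfolding tensor_map_def by (rule tensor_lift_linear[OF b])
  show "tensor_map K V W V' W' f g (pure_tensor K V W v w) = pure_tensor K V' W' (f v) (g w)"
    if "v \<in> carrier V" "w \<in> carrier W" for v w
    unfolding tensor_map_def by (rule tensor_lift_pure[OF b that])
qed

text \<open>The inner expression of \<open>dual_tensor\<close>, named so that it can be compared for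
  a space and for its subspaces.\<close>

definition functional_tensor where
  "functional_tensor K V W \<phi> \<psi> = tensor_lift K V W (scalar_space K) (\<lambda>v w. \<phi> v \<otimes>\<^bsub>K\<^esub> \<psi> w)"

context two_spaces begin

lemma functional_bilinear:
  assumes "\<phi> \<in> carrier (dual_space K V)" "\<psi> \<in> carrier (dual_space K W)"
  shows "bilinear_map K V W (scalar_space K) (\<lambda>v w. \<phi> v \<otimes>\<^bsub>K\<^esub> \<psi> w)"
proof -
  note L = dual_linear[OF V assms(1)] dual_linear[OF W assms(2)]
  have c: "\<phi> v \<in> carrier K" "\<psi> w \<in> carrier K" if "v \<in> carrier V" "w \<in> carrier W" for v w
    using dual_closed[OF V assms(1)] dual_closed[OF W assms(2)] that by auto
  have "linear_map K W (scalar_space K) (\<lambda>w. \<phi> v \<otimes>\<^bsub>K\<^esub> \<psi> w)" if v: "v \<in> carrier V" for v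
    using linear_map_scale[OF L(2), of "\<phi> v"] dual_closed[OF V assms(1) v] by simp
  moreover have "linear_map K V (scalar_space K) (\<lambda>v. \<phi> v \<otimes>\<^bsub>K\<^esub> \<psi> w)" if w: "w \<in> carrier W" for w
  proof (rule linear_map_cong)
    show "linear_map K V (scalar_space K) (\<lambda>v. \<psi> w \<otimes>\<^bsub>K\<^esub> \<phi> v)"
      using linear_map_scale[OF L(1), of "\<psi> w"] dual_closed[OF W assms(2) w] by simp
    show "\<phi> v \<otimes>\<^bsub>K\<^esub> \<psi> w = \<psi> w \<otimes>\<^bsub>K\<^esub> \<phi> v" if "v \<in> carrier V" for v
      using V.comm_K c that w by blast
  qed
  ultimately show ?thesis unfolding bilinear_map_def by auto
qed

lemma functional_tensor_dual:
  assumes "\<phi> \<in> carrier (dual_space K V)" "\<psi> \<in> carrier (dual_space K W)"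
  shows "functional_tensor K V W \<phi> \<psi> \<in> carrier (dual_space K T)"
  unfolding functional_tensor_def carrier_dual_space[OF tensor_vs]
  using tensor_lift_linear[OF vs_scalar[OF V] functional_bilinear[OF assms]]
    tensor_lift_extensional[OF vs_scalar[OF V] functional_bilinear[OF assms]] by blast

lemma functional_tensor_pure:
  assumes "\<phi> \<in> carrier (dual_space K V)" "\<psi> \<in> carrier (dual_space K W)" "v \<in> carrier V" "w \<in> carrier W"
  shows "functional_tensor K V W \<phi> \<psi> (pure v w) = \<phi> v \<otimes>\<^bsub>K\<^esub> \<psi> w"
  unfolding functional_tensor_def
  by (rule tensor_lift_pure[OF vs_scalar[OF V] functional_bilinear[OF assms(1,2)] assms(3,4)])

lemma dual_tensor_eqI:
  assumes "h \<in> carrier (dual_space K T)" "h' \<in> carrier (dual_space K T)"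
    and "\<And>v w. v \<in> carrier V \<Longrightarrow> w \<in> carrier W \<Longrightarrow> h (pure v w) = h' (pure v w)"
  shows "h = h'"
  by (rule dual_eqI[OF tensor_vs assms(1,2)])
    (rule tensor_linear_eq[OF dual_linear[OF tensor_vs assms(1)] dual_linear[OF tensor_vs assms(2)] assms(3)])

text \<open>Linearity in y is tested at each element of the tensor product; by
  \<open>tensor_induct\<close> pure tensors are enough, because a sum of linear maps is
  linear.\<close>

lemma linear_map_into_dual_tensor:
  assumes Y: "vectorspace K Y" and h: "\<And>y. y \<in> carrier Y \<Longrightarrow> h y \<in> carrier (dual_space K T)"
    and ev: "\<And>v w. v \<in> carrier V \<Longrightarrow> w \<in> carrier W \<Longrightarrow> linear_map K Y (scalar_space K) (\<lambda>y. h y (pure v w))"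
  shows "linear_map K Y (dual_space K T) h"
proof (rule linear_map_into_dual[OF Y tensor_vs h])
  fix x assume "x \<in> carrier T"
  then show "linear_map K Y (scalar_space K) (\<lambda>y. h y x)"
  proof (induction rule: tensor_induct)
    case (add x x')
    show ?case
      using linear_map_add[OF dual_linear[OF tensor_vs h]] add
      by (intro linear_map_cong[OF linear_map_sum[OF add.IH]]) auto
  qed (rule ev)
qed

lemma functional_tensor_bilinear:
  "bilinear_map K (dual_space K V) (dual_space K W) (dual_space K T) (functional_tensor K V W)"
  unfolding bilinear_map_def
proof (intro conjI ballI)
  fix \<phi> assume \<phi>: "\<phi> \<in> carrier (dual_space K V)"
  show "linear_map K (dual_space K W) (dual_space K T) (functional_tensor K V W \<phi>)"
  proof (rule linear_map_into_dual_tensor[OF dual_space_vs[OF W] functional_tensor_dual[OF \<phi>]])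
    fix v w assume v: "v \<in> carrier V" and w: "w \<in> carrier W"
    have "linear_map K (dual_space K W) (scalar_space K) (\<lambda>\<psi>. \<phi> v \<otimes>\<^bsub>K\<^esub> \<psi> w)"
      using linear_map_scale[OF eval_linear[OF W w] dual_closed[OF V \<phi> v]] by simp
    then show "linear_map K (dual_space K W) (scalar_space K) (\<lambda>\<psi>. functional_tensor K V W \<phi> \<psi> (pure v w))"
      by (rule linear_map_cong) (rule functional_tensor_pure[OF \<phi> _ v w])
  qed
next
  fix \<psi> assume \<psi>: "\<psi> \<in> carrier (dual_space K W)"
  show "linear_map K (dual_space K V) (dual_space K T) (\<lambda>\<phi>. functional_tensor K V W \<phi> \<psi>)"
  proof (rule linear_map_into_dual_tensor[OF dual_space_vs[OF V] functional_tensor_dual[OF _ \<psi>]])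
    fix v w assume v: "v \<in> carrier V" and w: "w \<in> carrier W"
    have "linear_map K (dual_space K V) (scalar_space K) (\<lambda>\<phi>. \<psi> w \<otimes>\<^bsub>K\<^esub> \<phi> v)"
      using linear_map_scale[OF eval_linear[OF V v] dual_closed[OF W \<psi> w]] by simp
    then show "linear_map K (dual_space K V) (scalar_space K) (\<lambda>\<phi>. functional_tensor K V W \<phi> \<psi> (pure v w))"
      by (rule linear_map_cong)
        (simp add: functional_tensor_pure[OF _ \<psi> v w] V.comm_K dual_closed[OF V _ v] dual_closed[OF W \<psi> w])
  qed
qed

lemma functional_tensor_sum:
  assumes \<phi>: "\<phi> \<in> carrier (dual_space K V)" and \<psi>: "\<psi> \<in> carrier (dual_space K W)"
    and g: "g \<in> J \<rightarrow> carrier V" and h: "h \<in> J \<rightarrow> carrier W"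
  shows "functional_tensor K V W \<phi> \<psi> (\<Oplus>\<^bsub>T\<^esub>j\<in>J. pure (g j) (h j))
    = (\<Oplus>\<^bsub>scalar_space K\<^esub>j\<in>J. \<phi> (g j) \<otimes>\<^bsub>K\<^esub> \<psi> (h j))"
proof -
  interpret S: vectorspace K "scalar_space K" by (rule vs_scalar[OF V])
  have gh: "g j \<in> carrier V" "h j \<in> carrier W" if "j \<in> J" for j using g h that by auto
  have "functional_tensor K V W \<phi> \<psi> (\<Oplus>\<^bsub>T\<^esub>j\<in>J. pure (g j) (h j))
    = (\<Oplus>\<^bsub>scalar_space K\<^esub>j\<in>J. functional_tensor K V W \<phi> \<psi> (pure (g j) (h j)))"
    using gh pure_closed
    by (intro linear_map_finsum[OF dual_linear[OF tensor_vs functional_tensor_dual[OF \<phi> \<psi>]]]) auto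
  also have "\<dots> = (\<Oplus>\<^bsub>scalar_space K\<^esub>j\<in>J. \<phi> (g j) \<otimes>\<^bsub>K\<^esub> \<psi> (h j))"
    using gh S.smult_closed[simplified] dual_closed[OF V \<phi>] dual_closed[OF W \<psi>]
    by (intro S.M.finsum_cong') (auto simp: functional_tensor_pure[OF \<phi> \<psi>])
  finally show ?thesis .
qed

text \<open>In the normal form of x some component g k is nonzero. A functional \<phi> nonzero at g
  k, tensored with the k-th coordinate of \<open>W\<close>, takes the value \<phi>(g k) at
  x.\<close>

lemma tensor_functional_nonzero:
  assumes fin: "vectorspace.fin_dim K V" "vectorspace.fin_dim K W" and x: "x \<in> carrier T" "x \<noteq> \<zero>\<^bsub>T\<^esub>"
  shows "\<exists>h\<in>carrier (dual_space K T). h x \<noteq> \<zero>\<^bsub>K\<^esub>"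
proof -
  obtain J :: "'w set" and f \<eta> where d: "dual_basis K W J f \<eta>"
    using dual_basis_exists[OF W fin(2)] by blast
  note f = dual_basisD[OF d]
  obtain g where g: "g \<in> J \<rightarrow> carrier V" "x = (\<Oplus>\<^bsub>T\<^esub>j\<in>J. pure (g j) (f j))"
    using tensor_normal_form[OF d x(1)] by blast
  have gc: "g j \<in> carrier V" if "j \<in> J" for j using g that by auto
  have "\<exists>k\<in>J. g k \<noteq> \<zero>\<^bsub>V\<^esub>"
  proof (rule ccontr)
    assume "\<not> ?thesis"
    then have 0: "g j = \<zero>\<^bsub>V\<^esub>" if "j \<in> J" for j using that by auto
    have "pure \<zero>\<^bsub>V\<^esub> w = \<zero>\<^bsub>T\<^esub>" if "w \<in> carrier W" for w
      using pure_bilinear that linear_map_zero[of K V T "\<lambda>v. pure v w"] by (auto simp: bilinear_map_def)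
    then have "x = (\<Oplus>\<^bsub>T\<^esub>j\<in>J. \<zero>\<^bsub>T\<^esub>)"
      unfolding g(2) using 0 f(2) by (intro T.M.finsum_cong') auto
    then show False using x by (simp add: T.M.finsum_zero)
  qed
  then obtain k where k: "k \<in> J" "g k \<noteq> \<zero>\<^bsub>V\<^esub>" by blast
  then obtain \<phi> where \<phi>: "\<phi> \<in> carrier (dual_space K V)" "\<phi> (g k) \<noteq> \<zero>\<^bsub>K\<^esub>"
    using functional_nonzero[OF V fin(1)] gc by blast
  interpret S: vectorspace K "scalar_space K" by (rule vs_scalar[OF V])
  have pc: "\<phi> (g j) \<in> carrier K" if "j \<in> J" for j using dual_closed[OF V \<phi>(1) gc[OF that]] .
  have "functional_tensor K V W \<phi> (\<eta> k) x = (\<Oplus>\<^bsub>scalar_space K\<^esub>j\<in>J. \<phi> (g j) \<otimes>\<^bsub>K\<^esub> \<eta> k (f j))"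
    unfolding g(2) using f(2) f(3)[OF k(1)] by (intro functional_tensor_sum \<phi> g) auto
  also have "\<dots> = (\<Oplus>\<^bsub>scalar_space K\<^esub>j\<in>J. (if j = k then \<one>\<^bsub>K\<^esub> else \<zero>\<^bsub>K\<^esub>) \<odot>\<^bsub>scalar_space K\<^esub> \<phi> (g j))"
    using f(4)[OF k(1)] pc V.comm_K by (intro S.M.finsum_cong') (auto simp: V.comm_K)
  also have "\<dots> = \<phi> (g k)"
    using pc by (intro finsum_delta[OF vs_scalar[OF V] f(1) k(1)]) auto
  finally show ?thesis using functional_tensor_dual[OF \<phi>(1) f(3)[OF k(1)]] \<phi>(2)
    by (intro bexI[of _ "functional_tensor K V W \<phi> (\<eta> k)"]) simp_all
qed

end

text \<open>The basis of DW dual to that of \<open>W\<close> is carried to a space Q isomorphic to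
  DW, so that tensors with second factor Q have a normal form whose coordinates are evaluations at
  vectors of \<open>W\<close>.\<close>

lemma dual_basis_pullback:
  assumes Q: "vectorspace K Q" and W: "vectorspace K W" and d: "dual_basis K W J f \<eta>"
    and \<gamma>: "linear_map K Q (dual_space K W) \<gamma>" "bij_betw \<gamma> (carrier Q) (carrier (dual_space K W))"
  shows "dual_basis K Q J (\<lambda>j. inv_into (carrier Q) \<gamma> (\<eta> j)) (\<lambda>j. \<lambda>q\<in>carrier Q. \<gamma> q (f j))"
proof -
  note f = dual_basisD[OF d]
  let ?g = "inv_into (carrier Q) \<gamma>"
  have g: "linear_map K (dual_space K W) Q ?g" by (rule linear_map_inv_into[OF \<gamma>])
  have gc: "?g \<psi> \<in> carrier Q" "\<gamma> (?g \<psi>) = \<psi>" if "\<psi> \<in> carrier (dual_space K W)" for \<psi>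
    using \<gamma>(2) that by (auto simp: bij_betw_def f_inv_into_f inv_into_into)
  have gg: "?g (\<gamma> q) = q" if "q \<in> carrier Q" for q
    using \<gamma>(2) that by (auto simp: bij_betw_def)
  have "(\<lambda>q\<in>carrier Q. \<gamma> q (f j)) \<in> carrier (dual_space K Q)" if "j \<in> J" for j
    by (intro dual_restrict linear_map_comp[OF \<gamma>(1)] eval_linear W f(2) that)
  moreover have "q = (\<Oplus>\<^bsub>Q\<^esub>j\<in>J. (\<lambda>q\<in>carrier Q. \<gamma> q (f j)) q \<odot>\<^bsub>Q\<^esub> ?g (\<eta> j))" if q: "q \<in> carrier Q" for q
  proof -
    interpret Q: vectorspace K Q by (rule Q)
    interpret DW: vectorspace K "dual_space K W" by (rule dual_space_vs[OF W])
    have \<gamma>q: "\<gamma> q \<in> carrier (dual_space K W)" by (rule linear_map_closed[OF \<gamma>(1) q])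
    have c: "\<gamma> q (f j) \<in> carrier K" if "j \<in> J" for j using dual_closed[OF W \<gamma>q f(2)[OF that]] .
    have "\<gamma> q = (\<Oplus>\<^bsub>dual_space K W\<^esub>j\<in>J. \<gamma> q (f j) \<odot>\<^bsub>dual_space K W\<^esub> \<eta> j)"
      using dual_basisD(5)[OF dual_basis_dual[OF W d] \<gamma>q] \<gamma>q by simp
    then have "q = ?g (\<Oplus>\<^bsub>dual_space K W\<^esub>j\<in>J. \<gamma> q (f j) \<odot>\<^bsub>dual_space K W\<^esub> \<eta> j)"
      using gg[OF q] by simp
    also have "\<dots> = (\<Oplus>\<^bsub>Q\<^esub>j\<in>J. ?g (\<gamma> q (f j) \<odot>\<^bsub>dual_space K W\<^esub> \<eta> j))"
      using c f(3) by (intro linear_map_finsum[OF g]) (auto simp del: dual_space_simps)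
    also have "\<dots> = (\<Oplus>\<^bsub>Q\<^esub>j\<in>J. (\<lambda>q\<in>carrier Q. \<gamma> q (f j)) q \<odot>\<^bsub>Q\<^esub> ?g (\<eta> j))"
      using c f(3) gc q by (intro Q.M.finsum_cong') (auto simp: linear_map_smult[OF g] simp del: dual_space_simps)
    finally show ?thesis .
  qed
  ultimately show ?thesis
    using f(1,3,4) gc unfolding dual_basis_def by (auto simp del: dual_space_simps)
qed

text \<open>P and Q are only isomorphic to DV and DW, which covers both the duals themselves and the
  quotient of DV by an annihilator. A tensor is written as a sum of g j \<otimes> q j with q j dual
  to a basis f of \<open>W\<close>; its image at v \<otimes> f k is then \<open>\<beta>\<close> (g
  k) v. Reading this off gives injectivity, and prescribing it gives surjectivity.\<close>

lemma pairing_bij: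
  fixes W :: "('k, 'w, 'y) module_scheme"
  assumes P: "vectorspace K P" and Q: "vectorspace K Q" and V: "vectorspace K V"
    and W: "vectorspace K W" "vectorspace.fin_dim K W"
    and \<beta>: "linear_map K P (dual_space K V) \<beta>" "bij_betw \<beta> (carrier P) (carrier (dual_space K V))"
    and \<gamma>: "linear_map K Q (dual_space K W) \<gamma>" "bij_betw \<gamma> (carrier Q) (carrier (dual_space K W))"
  defines "\<Theta> \<equiv> tensor_lift K P Q (dual_space K (tensor K V W)) (\<lambda>p q. functional_tensor K V W (\<beta> p) (\<gamma> q))"
  shows "linear_map K (tensor K P Q) (dual_space K (tensor K V W)) \<Theta>"
    and "\<And>p q. p \<in> carrier P \<Longrightarrow> q \<in> carrier Q \<Longrightarrow>
           \<Theta> (pure_tensor K P Q p q) = functional_tensor K V W (\<beta> p) (\<gamma> q)"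
    and "bij_betw \<Theta> (carrier (tensor K P Q)) (carrier (dual_space K (tensor K V W)))"
proof -
  interpret PQ: two_spaces K P Q by (rule two_spaces.intro[OF P Q])
  interpret VW: two_spaces K V W by (rule two_spaces.intro[OF V W(1)])
  interpret DT: vectorspace K "dual_space K VW.T" by (rule dual_space_vs[OF VW.tensor_vs])
  interpret S: vectorspace K "scalar_space K" by (rule vs_scalar[OF V])
  have bil: "bilinear_map K P Q (dual_space K VW.T) (\<lambda>p q. functional_tensor K V W (\<beta> p) (\<gamma> q))"
    using VW.functional_tensor_bilinear linear_map_closed[OF \<beta>(1)] linear_map_closed[OF \<gamma>(1)]
    unfolding bilinear_map_def
    by (auto intro: linear_map_comp[OF \<beta>(1)] linear_map_comp[OF \<gamma>(1)])
  note lift = DT.vectorspace_axioms bil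
  show lin: "linear_map K (tensor K P Q) (dual_space K (tensor K V W)) \<Theta>"
    unfolding \<Theta>_def by (rule PQ.tensor_lift_linear[OF lift])
  show pure: "\<Theta> (pure_tensor K P Q p q) = functional_tensor K V W (\<beta> p) (\<gamma> q)"
    if "p \<in> carrier P" "q \<in> carrier Q" for p q
    unfolding \<Theta>_def by (rule PQ.tensor_lift_pure[OF lift that])
  obtain J :: "'w set" and f \<eta> where d: "dual_basis K W J f \<eta>"
    using dual_basis_exists[OF W] by blast
  note f = dual_basisD[OF d]
  note dQ = dual_basis_pullback[OF Q W(1) d \<gamma>]
  define q where "q j = inv_into (carrier Q) \<gamma> (\<eta> j)" for j
  have qc: "q j \<in> carrier Q" "\<gamma> (q j) = \<eta> j" if "j \<in> J" for j
    using \<gamma>(2) f(3)[OF that] by (auto simp: q_def bij_betw_def f_inv_into_f inv_into_into)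
  have \<Theta>_sum: "\<Theta> (\<Oplus>\<^bsub>PQ.T\<^esub>j\<in>J. PQ.pure (g j) (q j)) (VW.pure v w)
      = (\<Oplus>\<^bsub>scalar_space K\<^esub>j\<in>J. \<beta> (g j) v \<otimes>\<^bsub>K\<^esub> \<eta> j w)"
    if g: "g \<in> J \<rightarrow> carrier P" and v: "v \<in> carrier V" and w: "w \<in> carrier W" for g v w
  proof -
    have gc: "g j \<in> carrier P" if "j \<in> J" for j using g that by auto
    have bc: "\<beta> (g j) \<in> carrier (dual_space K V)" if "j \<in> J" for j
      using linear_map_closed[OF \<beta>(1) gc[OF that]] .
    have "\<Theta> (\<Oplus>\<^bsub>PQ.T\<^esub>j\<in>J. PQ.pure (g j) (q j)) = (\<Oplus>\<^bsub>dual_space K VW.T\<^esub>j\<in>J. \<Theta> (PQ.pure (g j) (q j)))"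
      using gc qc PQ.pure_closed by (intro linear_map_finsum[OF lin]) auto
    also have "\<dots> = (\<Oplus>\<^bsub>dual_space K VW.T\<^esub>j\<in>J. functional_tensor K V W (\<beta> (g j)) (\<eta> j))"
      using gc qc bc f(3) VW.functional_tensor_dual pure
      by (intro DT.M.finsum_cong') auto
    finally have "\<Theta> (\<Oplus>\<^bsub>PQ.T\<^esub>j\<in>J. PQ.pure (g j) (q j)) (VW.pure v w)
      = (\<Oplus>\<^bsub>scalar_space K\<^esub>j\<in>J. functional_tensor K V W (\<beta> (g j)) (\<eta> j) (VW.pure v w))"
      using dual_finsum[OF VW.tensor_vs _ VW.pure_closed[OF v w], of "\<lambda>j. functional_tensor K V W (\<beta> (g j)) (\<eta> j)" J]
        bc f(3) VW.functional_tensor_dual by auto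
    also have "\<dots> = (\<Oplus>\<^bsub>scalar_space K\<^esub>j\<in>J. \<beta> (g j) v \<otimes>\<^bsub>K\<^esub> \<eta> j w)"
      using bc f(3) v w VW.functional_tensor_pure dual_closed[OF V bc v] dual_closed[OF W(1) f(3) w] S.smult_closed[simplified]
      by (intro S.M.finsum_cong') auto
    finally show ?thesis .
  qed
  have "inj_on \<Theta> (carrier PQ.T)"
  proof (rule linear_map_injI[OF lin])
    fix x assume x: "x \<in> carrier PQ.T" "\<Theta> x = \<zero>\<^bsub>dual_space K VW.T\<^esub>"
    obtain g where g: "g \<in> J \<rightarrow> carrier P" "x = (\<Oplus>\<^bsub>PQ.T\<^esub>j\<in>J. PQ.pure (g j) (q j))"
      using PQ.tensor_normal_form[OF dQ x(1)] unfolding q_def by blast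
    have gc: "g j \<in> carrier P" if "j \<in> J" for j using g that by auto
    have bc: "\<beta> (g j) \<in> carrier (dual_space K V)" if "j \<in> J" for j
      using linear_map_closed[OF \<beta>(1) gc[OF that]] .
    have g0: "g k = \<zero>\<^bsub>P\<^esub>" if k: "k \<in> J" for k
    proof -
      have "\<beta> (g k) v = \<zero>\<^bsub>K\<^esub>" if v: "v \<in> carrier V" for v
      proof -
        \<comment> \<open>At v \<otimes> f k only the k-th term of the sum survives, so a vanishing
          image forces \<open>\<beta>\<close> (g k) to be zero at v.\<close>
        have "\<zero>\<^bsub>K\<^esub> = \<Theta> x (VW.pure v (f k))" using x(2) VW.pure_closed[OF v f(2)[OF k]] by simp
        also have "\<dots> = (\<Oplus>\<^bsub>scalar_space K\<^esub>j\<in>J. \<beta> (g j) v \<otimes>\<^bsub>K\<^esub> \<eta> j (f k))"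
          unfolding g(2) by (rule \<Theta>_sum[OF g(1) v f(2)[OF k]])
        also have "\<dots> = (\<Oplus>\<^bsub>scalar_space K\<^esub>j\<in>J. (if j = k then \<one>\<^bsub>K\<^esub> else \<zero>\<^bsub>K\<^esub>) \<odot>\<^bsub>scalar_space K\<^esub> \<beta> (g j) v)"
          using f(4)[OF _ k] dual_closed[OF V bc v] VW.V.comm_K
          by (intro S.M.finsum_cong') (auto simp: VW.V.comm_K)
        also have "\<dots> = \<beta> (g k) v"
          using dual_closed[OF V bc v] by (intro finsum_delta[OF vs_scalar[OF V] f(1) k]) auto
        finally show ?thesis by simp
      qed
      then have "\<beta> (g k) = \<zero>\<^bsub>dual_space K V\<^esub>"
        using bc[OF k] linear_map_zero[OF \<beta>(1)] linear_map_closed[OF \<beta>(1) PQ.V.M.zero_closed]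
        by (intro dual_eqI[OF V]) auto
      then have "\<beta> (g k) = \<beta> \<zero>\<^bsub>P\<^esub>" using linear_map_zero[OF \<beta>(1)] by simp
      then show ?thesis using \<beta>(2) gc[OF k] by (auto simp: bij_betw_def dest: inj_onD)
    qed
    have "PQ.pure \<zero>\<^bsub>P\<^esub> y = \<zero>\<^bsub>PQ.T\<^esub>" if "y \<in> carrier Q" for y
      using PQ.pure_bilinear that linear_map_zero[of K P PQ.T "\<lambda>v. PQ.pure v y"] by (auto simp: bilinear_map_def)
    then have "x = (\<Oplus>\<^bsub>PQ.T\<^esub>j\<in>J. \<zero>\<^bsub>PQ.T\<^esub>)"
      unfolding g(2) using g0 qc by (intro PQ.T.M.finsum_cong') auto
    then show "x = \<zero>\<^bsub>PQ.T\<^esub>" by (simp add: PQ.T.M.finsum_zero)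
  qed
  moreover have "\<exists>x\<in>carrier PQ.T. \<Theta> x = F" if F: "F \<in> carrier (dual_space K VW.T)" for F
  proof -
    note LF = dual_linear[OF VW.tensor_vs F]
    have pl: "linear_map K V VW.T (\<lambda>v. VW.pure v w)" if "w \<in> carrier W" for w
      using VW.pure_bilinear that by (auto simp: bilinear_map_def)
    have pr: "linear_map K W VW.T (VW.pure v)" if "v \<in> carrier V" for v
      using VW.pure_bilinear that by (auto simp: bilinear_map_def)
    \<comment> \<open>The slices of \<open>F\<close> along the basis of \<open>W\<close>: expanding
      w in the f j recovers \<open>F\<close> from them, so the sum of the tensors of
      \<open>\<phi> j\<close> with \<open>\<eta> j\<close> corresponds to \<open>F\<close>.\<close>
    define \<phi> where "\<phi> j = (\<lambda>v\<in>carrier V. F (VW.pure v (f j)))" for j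
    have \<phi>: "\<phi> j \<in> carrier (dual_space K V)" if "j \<in> J" for j
      unfolding \<phi>_def by (intro dual_restrict linear_map_comp[OF pl LF] f(2) that)
    define g where "g j = inv_into (carrier P) \<beta> (\<phi> j)" for j
    have g: "g j \<in> carrier P" "\<beta> (g j) = \<phi> j" if "j \<in> J" for j
      using \<beta>(2) \<phi>[OF that] by (auto simp: g_def bij_betw_def f_inv_into_f inv_into_into)
    let ?x = "\<Oplus>\<^bsub>PQ.T\<^esub>j\<in>J. PQ.pure (g j) (q j)"
    have x: "?x \<in> carrier PQ.T" using g qc PQ.pure_closed by (intro PQ.T.M.finsum_closed) auto
    have "\<Theta> ?x = F"
    proof (rule VW.dual_tensor_eqI[OF linear_map_closed[OF lin x] F])
      fix v w assume v: "v \<in> carrier V" and w: "w \<in> carrier W"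
      have \<eta>c: "\<eta> j w \<in> carrier K" if "j \<in> J" for j using dual_closed[OF W(1) f(3)[OF that] w] .
      have Fc: "F (VW.pure v (f j)) \<in> carrier K" if "j \<in> J" for j
        using dual_closed[OF VW.tensor_vs F VW.pure_closed[OF v f(2)[OF that]]] .
      have "\<Theta> ?x (VW.pure v w) = (\<Oplus>\<^bsub>scalar_space K\<^esub>j\<in>J. \<beta> (g j) v \<otimes>\<^bsub>K\<^esub> \<eta> j w)"
        using g by (intro \<Theta>_sum v w) auto
      also have "\<dots> = (\<Oplus>\<^bsub>scalar_space K\<^esub>j\<in>J. F (VW.pure v (\<eta> j w \<odot>\<^bsub>W\<^esub> f j)))"
        using g(2) v \<eta>c Fc f(2) VW.V.comm_K VW.pure_closed S.smult_closed[simplified]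
        by (intro S.M.finsum_cong') (auto simp: \<phi>_def linear_map_smult[OF pr[OF v]] linear_map_smult[OF LF])
      also have "\<dots> = F (VW.pure v (\<Oplus>\<^bsub>W\<^esub>j\<in>J. \<eta> j w \<odot>\<^bsub>W\<^esub> f j))"
        using \<eta>c f(2)
        by (intro linear_map_finsum[OF linear_map_comp[OF pr[OF v] LF], symmetric]) auto
      also have "\<dots> = F (VW.pure v w)" using f(5)[OF w] by simp
      finally show "\<Theta> ?x (VW.pure v w) = F (VW.pure v w)" .
    qed
    then show ?thesis using x by blast
  qed
  ultimately show "bij_betw \<Theta> (carrier (tensor K P Q)) (carrier (dual_space K (tensor K V W)))"
    using linear_map_closed[OF lin] unfolding bij_betw_def by blast
qed

text \<open>The instance of \<open>pairing_bij\<close> in which both isomorphisms are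
  identities.\<close>

lemma dual_tensor_facts:
  assumes V: "vectorspace K V" and W: "vectorspace K W" "vectorspace.fin_dim K W"
  shows "linear_map K (tensor K (dual_space K V) (dual_space K W)) (dual_space K (tensor K V W)) (dual_tensor K V W)"
    and "\<And>\<phi> \<psi>. \<phi> \<in> carrier (dual_space K V) \<Longrightarrow> \<psi> \<in> carrier (dual_space K W) \<Longrightarrow>
           dual_tensor K V W (pure_tensor K (dual_space K V) (dual_space K W) \<phi> \<psi>) = functional_tensor K V W \<phi> \<psi>"
    and "bij_betw (dual_tensor K V W) (carrier (tensor K (dual_space K V) (dual_space K W)))
           (carrier (dual_space K (tensor K V W)))"
proof -
  note D = dual_space_vs[OF V] dual_space_vs[OF W(1)]
  have eq: "dual_tensor K V W = tensor_lift K (dual_space K V) (dual_space K W) (dual_space K (tensor K V W))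
      (\<lambda>p q. functional_tensor K V W p q)"
    unfolding dual_tensor_def functional_tensor_def ..
  note * = pairing_bij[OF D V W linear_map_id[OF D(1)] _ linear_map_id[OF D(2)], folded eq]
  show "linear_map K (tensor K (dual_space K V) (dual_space K W)) (dual_space K (tensor K V W)) (dual_tensor K V W)"
    by (rule *(1)) (auto simp: bij_betw_def)
  show "dual_tensor K V W (pure_tensor K (dual_space K V) (dual_space K W) \<phi> \<psi>) = functional_tensor K V W \<phi> \<psi>"
    if "\<phi> \<in> carrier (dual_space K V)" "\<psi> \<in> carrier (dual_space K W)" for \<phi> \<psi>
    by (rule *(2)[OF _ _ that]) (auto simp: bij_betw_def)
  show "bij_betw (dual_tensor K V W) (carrier (tensor K (dual_space K V) (dual_space K W)))
           (carrier (dual_space K (tensor K V W)))"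
    by (rule *(3)) (auto simp: bij_betw_def)
qed

section \<open>Direct sums and transposes\<close>

lemma dsum_proj_linear:
  assumes "field K" "\<And>i. i \<in> I \<Longrightarrow> vectorspace K (M i)" "j \<in> I"
  shows "linear_map K (dsum I M) (M j) (\<lambda>x. x j)"
  using assms(3) by (intro linear_mapI dsum_vs assms) auto

lemma dsum_inj_linear:
  assumes "field K" "\<And>i. i \<in> I \<Longrightarrow> vectorspace K (M i)" "j \<in> I"
  shows "linear_map K (M j) (dsum I M) (dsum_inj I M j)"
proof (rule linear_mapI[OF assms(2)[OF assms(3)] dsum_vs[OF assms(1,2)]])
  have z: "\<zero>\<^bsub>M i\<^esub> \<in> carrier (M i)" "\<zero>\<^bsub>M i\<^esub> \<oplus>\<^bsub>M i\<^esub> \<zero>\<^bsub>M i\<^esub> = \<zero>\<^bsub>M i\<^esub>"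
    "c \<in> carrier K \<Longrightarrow> c \<odot>\<^bsub>M i\<^esub> \<zero>\<^bsub>M i\<^esub> = \<zero>\<^bsub>M i\<^esub>" if "i \<in> I" for i c
  proof -
    interpret M: vectorspace K "M i" by (rule assms(2)[OF that])
    show "\<zero>\<^bsub>M i\<^esub> \<in> carrier (M i)" "\<zero>\<^bsub>M i\<^esub> \<oplus>\<^bsub>M i\<^esub> \<zero>\<^bsub>M i\<^esub> = \<zero>\<^bsub>M i\<^esub>"
      "c \<in> carrier K \<Longrightarrow> c \<odot>\<^bsub>M i\<^esub> \<zero>\<^bsub>M i\<^esub> = \<zero>\<^bsub>M i\<^esub>" by simp_all
  qed
  show "dsum_inj I M j x \<in> carrier (dsum I M)" if "x \<in> carrier (M j)" for x
    using that z(1) by (auto simp: dsum_inj_def)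
  show "dsum_inj I M j (x \<oplus>\<^bsub>M j\<^esub> y) = dsum_inj I M j x \<oplus>\<^bsub>dsum I M\<^esub> dsum_inj I M j y" for x y
    using z(2) by (auto simp: dsum_inj_def intro!: restrict_ext)
  show "dsum_inj I M j (c \<odot>\<^bsub>M j\<^esub> x) = c \<odot>\<^bsub>dsum I M\<^esub> dsum_inj I M j x" if "c \<in> carrier K" for c x
    using z(3)[OF _ that] by (auto simp: dsum_inj_def intro!: restrict_ext)
qed

lemma dsum_map_linear:
  assumes "field K" "\<And>i. i \<in> I \<Longrightarrow> linear_map K (M i) (Y i) (f i)"
  shows "linear_map K (dsum I M) (dsum I Y) (dsum_map I f)"
proof (rule linear_mapI)
  show "vectorspace K (dsum I M)" "vectorspace K (dsum I Y)"
    using assms(2) by (auto intro!: dsum_vs[OF assms(1)] dest: linear_map_vs)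
qed (use linear_map_closed[OF assms(2)] linear_map_add[OF assms(2)] linear_map_smult[OF assms(2)] in
  \<open>auto simp: dsum_map_def PiE_iff intro!: restrict_ext\<close>)

lemma dsum_expand:
  assumes K: "field K" and M: "\<And>i. i \<in> I \<Longrightarrow> vectorspace K (M i)" and fin: "finite I"
    and x: "x \<in> carrier (dsum I M)"
  shows "x = (\<Oplus>\<^bsub>dsum I M\<^esub>i\<in>I. dsum_inj I M i (x i))"
proof -
  interpret D: vectorspace K "dsum I M" by (rule dsum_vs[where M=M and I=I, OF K M])
  have c: "dsum_inj I M i (x i) \<in> carrier (dsum I M)" if "i \<in> I" for i
    using linear_map_closed[OF dsum_inj_linear[where M=M and I=I, OF K M that]] x that by auto
  have sc: "(\<Oplus>\<^bsub>dsum I M\<^esub>i\<in>I. dsum_inj I M i (x i)) \<in> carrier (dsum I M)"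
    using c by (intro D.M.finsum_closed) auto
  have "x j = (\<Oplus>\<^bsub>dsum I M\<^esub>i\<in>I. dsum_inj I M i (x i)) j" if j: "j \<in> I" for j
  proof -
    interpret M: vectorspace K "M j" by (rule M[OF j])
    have xj: "x i \<in> carrier (M i)" if "i \<in> I" for i using x that by auto
    have "(\<Oplus>\<^bsub>dsum I M\<^esub>i\<in>I. dsum_inj I M i (x i)) j = (\<Oplus>\<^bsub>M j\<^esub>i\<in>I. dsum_inj I M i (x i) j)"
      using c by (intro linear_map_finsum[OF dsum_proj_linear[where M=M and I=I, OF K M j]]) auto
    also have "\<dots> = (\<Oplus>\<^bsub>M j\<^esub>i\<in>I. if j = i then x j else \<zero>\<^bsub>M j\<^esub>)"
      using j xj by (intro M.M.finsum_cong') (auto simp: dsum_inj_def)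
    also have "\<dots> = x j"
      using M.M.finsum_singleton[OF j fin, of "\<lambda>i. x j"] xj[OF j] by simp
    finally show ?thesis by simp
  qed
  moreover have "x \<in> extensional I" "(\<Oplus>\<^bsub>dsum I M\<^esub>i\<in>I. dsum_inj I M i (x i)) \<in> extensional I"
    using x sc by (auto simp: PiE_iff)
  ultimately show ?thesis by (rule extensionalityI[rotated 2])
qed

lemma dsum_linear_expand:
  assumes K: "field K" and M: "\<And>i. i \<in> I \<Longrightarrow> vectorspace K (M i)" and fin: "finite I"
    and f: "linear_map K (dsum I M) Y f" and x: "x \<in> carrier (dsum I M)"
  shows "f x = (\<Oplus>\<^bsub>Y\<^esub>i\<in>I. f (dsum_inj I M i (x i)))"
proof -
  have "f x = f (\<Oplus>\<^bsub>dsum I M\<^esub>i\<in>I. dsum_inj I M i (x i))"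
    using dsum_expand[where M=M and I=I, OF K M fin x] by simp
  also have "\<dots> = (\<Oplus>\<^bsub>Y\<^esub>i\<in>I. f (dsum_inj I M i (x i)))"
    using linear_map_closed[OF dsum_inj_linear[where M=M and I=I, OF K M]] x
    by (intro linear_map_finsum[OF f]) auto
  finally show ?thesis .
qed

text \<open>For identities \<open>\<Theta> i\<close> on the duals of the \<open>M i\<close> this is
  the natural map from the sum of the duals to the dual of the sum. The \<open>\<Theta> i\<close>
  are built in because the summands met later are only identified with such duals.\<close>

definition dual_sum_map where
  "dual_sum_map K I M \<Theta> z =
     (\<lambda>x\<in>carrier (dsum I M). \<Oplus>\<^bsub>scalar_space K\<^esub>i\<in>I. \<Theta> i (z i) (x i))"

text \<open>On a vector concentrated in the summand j the functional reduces to
  \<open>\<Theta> j (z j)\<close>, so the components can be recovered. The conclusion is a bijection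
  of sets, the form in which maximal ranks are compared.\<close>

lemma dual_sum_map_bij:
  assumes K: "field K" and M: "\<And>i. i \<in> I \<Longrightarrow> vectorspace K (M i)" and fin: "finite I"
    and \<Theta>: "\<And>i. i \<in> I \<Longrightarrow> bij_betw (\<Theta> i) (carrier (Z i)) (carrier (dual_space K (M i)))"
  shows "bij_betw (dual_sum_map K I M \<Theta>) (carrier (dsum I Z)) (carrier (dual_space K (dsum I M)))"
proof -
  interpret S: vectorspace K "scalar_space K" by (rule scalar_space_vs[OF K])
  note DX = dsum_vs[where M=M and I=I, OF K M]
  have \<Theta>c: "\<Theta> i z \<in> carrier (dual_space K (M i))" if "i \<in> I" "z \<in> carrier (Z i)" for i z
    using \<Theta>[OF that(1)] that(2) by (auto simp: bij_betw_def)
  have closed: "dual_sum_map K I M \<Theta> z \<in> carrier (dual_space K (dsum I M))" if "z \<in> carrier (dsum I Z)" for z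
    unfolding dual_sum_map_def
  proof (intro dual_restrict linear_map_finsum_map[OF DX S.vectorspace_axioms])
    fix i assume i: "i \<in> I"
    then have "z i \<in> carrier (Z i)" using that by auto
    then show "linear_map K (dsum I M) (scalar_space K) (\<lambda>v. \<Theta> i (z i) (v i))"
      by (intro linear_map_comp[OF dsum_proj_linear[where M=M and I=I, OF K M i]] dual_linear M \<Theta>c i)
  qed
  have on_inj: "dual_sum_map K I M \<Theta> z (dsum_inj I M j x) = \<Theta> j (z j) x"
    if z: "z \<in> carrier (dsum I Z)" and j: "j \<in> I" and x: "x \<in> carrier (M j)" for z j x
  proof -
    have zc: "\<Theta> i (z i) \<in> carrier (dual_space K (M i))" if "i \<in> I" for i
      using \<Theta>c z that by auto
    have "dsum_inj I M j x \<in> carrier (dsum I M)"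
      by (rule linear_map_closed[OF dsum_inj_linear[where M=M and I=I, OF K M j] x])
    then have "dual_sum_map K I M \<Theta> z (dsum_inj I M j x)
        = (\<Oplus>\<^bsub>scalar_space K\<^esub>i\<in>I. \<Theta> i (z i) (dsum_inj I M j x i))"
      by (simp add: dual_sum_map_def)
    also have "\<dots> = (\<Oplus>\<^bsub>scalar_space K\<^esub>i\<in>I. if j = i then \<Theta> j (z j) x else \<zero>\<^bsub>scalar_space K\<^esub>)"
      using dual_closed[OF M[OF j] zc[OF j] x] linear_map_zero[OF dual_linear[OF M zc]] S.M.zero_closed
      by (intro S.M.finsum_cong') (auto simp: dsum_inj_def)
    also have "\<dots> = \<Theta> j (z j) x"
      using S.M.finsum_singleton[OF j fin, of "\<lambda>i. \<Theta> j (z j) x"] dual_closed[OF M[OF j] zc[OF j] x] by simp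
    finally show ?thesis .
  qed
  have "inj_on (dual_sum_map K I M \<Theta>) (carrier (dsum I Z))"
  proof (rule inj_onI)
    fix z z' assume z: "z \<in> carrier (dsum I Z)" and z': "z' \<in> carrier (dsum I Z)"
      and eq: "dual_sum_map K I M \<Theta> z = dual_sum_map K I M \<Theta> z'"
    have "z j = z' j" if j: "j \<in> I" for j
    proof -
      have zj: "z j \<in> carrier (Z j)" "z' j \<in> carrier (Z j)" using z z' j by auto
      have "\<Theta> j (z j) = \<Theta> j (z' j)"
        using on_inj[OF z j] on_inj[OF z' j] eq
        by (intro dual_eqI[OF M[OF j] \<Theta>c[OF j zj(1)] \<Theta>c[OF j zj(2)]]) simp
      then show ?thesis using \<Theta>[OF j] zj by (auto simp: bij_betw_def dest: inj_onD)
    qed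
    then show "z = z'" using z z' by (auto simp: PiE_iff intro: extensionalityI)
  qed
  moreover have "\<exists>z\<in>carrier (dsum I Z). dual_sum_map K I M \<Theta> z = h"
    if h: "h \<in> carrier (dual_space K (dsum I M))" for h
  proof -
    \<comment> \<open>The components of the preimage come from restricting h to the
      summands.\<close>
    define h' where "h' i = transpose_map (M i) (dsum_inj I M i) h" for i
    have h': "h' i \<in> carrier (dual_space K (M i))" if "i \<in> I" for i
      unfolding h'_def by (rule transpose_closed[OF dsum_inj_linear[where M=M and I=I, OF K M that] h])
    define z where "z = (\<lambda>i\<in>I. inv_into (carrier (Z i)) (\<Theta> i) (h' i))"
    have zi: "z i \<in> carrier (Z i)" "\<Theta> i (z i) = h' i" if "i \<in> I" for i
      using \<Theta>[OF that] h'[OF that] that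
      by (auto simp: z_def bij_betw_def f_inv_into_f inv_into_into)
    have z: "z \<in> carrier (dsum I Z)" using zi by (auto simp: z_def)
    have "dual_sum_map K I M \<Theta> z = h"
    proof (rule dual_eqI[OF DX closed[OF z] h])
      fix x assume x: "x \<in> carrier (dsum I M)"
      have "dual_sum_map K I M \<Theta> z x = (\<Oplus>\<^bsub>scalar_space K\<^esub>i\<in>I. \<Theta> i (z i) (x i))"
        using x by (simp add: dual_sum_map_def)
      also have "\<dots> = (\<Oplus>\<^bsub>scalar_space K\<^esub>i\<in>I. h (dsum_inj I M i (x i)))"
        using x zi dual_closed[OF DX h linear_map_closed[OF dsum_inj_linear[where M=M and I=I, OF K M]]]
        by (intro S.M.finsum_cong') (auto simp: h'_def transpose_map_def PiE_iff)
      also have "\<dots> = h x"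
        using dsum_linear_expand[where M=M and I=I, OF K M fin dual_linear[OF DX h] x] by simp
      finally show "dual_sum_map K I M \<Theta> z x = h x" .
    qed
    then show ?thesis using z by blast
  qed
  ultimately show ?thesis using closed unfolding bij_betw_def by blast
qed

text \<open>S is the transpose of R seen through an identification \<open>\<Theta>\<close> of
  \<open>Z\<close> with the dual of \<open>M\<close>. Transposing exchanges injectivity and
  surjectivity, and maximal rank is symmetric in the two. On the side of \<open>M\<close>,
  separation of nonzero vectors by functionals takes the place of a dimension argument.\<close>

lemma maximal_rank_transpose:
  assumes R: "linear_map K M U R" and U: "vectorspace.fin_dim K U"
    and sep: "\<And>x. x \<in> carrier M \<Longrightarrow> x \<noteq> \<zero>\<^bsub>M\<^esub> \<Longrightarrow> \<exists>h\<in>carrier (dual_space K M). h x \<noteq> \<zero>\<^bsub>K\<^esub>"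
    and \<Theta>: "bij_betw \<Theta> (carrier Z) (carrier (dual_space K M))"
    and S: "\<And>\<phi>. \<phi> \<in> carrier (dual_space K U) \<Longrightarrow> S \<phi> \<in> carrier Z \<and> \<Theta> (S \<phi>) = transpose_map M R \<phi>"
  shows "maximal_rank M U R \<longleftrightarrow> maximal_rank (dual_space K U) Z S"
proof -
  note M = linear_map_vs(1)[OF R] and Uv = linear_map_vs(2)[OF R]
  interpret M: vectorspace K M by (rule M)
  interpret U: vectorspace K U by (rule Uv)
  interpret DU: vectorspace K "dual_space K U" by (rule dual_space_vs[OF Uv])
  have im: "VectorSpace.subspace K (R ` carrier M) U"
    by (rule image_subspace[OF R carrier_subspace[OF M]])
  have \<Theta>_inj: "z = z'" if "z \<in> carrier Z" "z' \<in> carrier Z" "\<Theta> z = \<Theta> z'" for z z'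
    using \<Theta> that by (auto simp: bij_betw_def dest: inj_onD)
  \<comment> \<open>Through the inverse of R the functional \<open>\<Theta> z\<close> becomes one on
    the image of R; any extension of it to \<open>U\<close> is mapped to z.\<close>
  have "S ` carrier (dual_space K U) = carrier Z" if inj: "inj_on R (carrier M)"
  proof -
    have "z \<in> S ` carrier (dual_space K U)" if z: "z \<in> carrier Z" for z
    proof -
      have \<xi>: "\<Theta> z \<in> carrier (dual_space K M)" using \<Theta> z by (auto simp: bij_betw_def)
      have bij: "bij_betw R (carrier M) (carrier (U\<lparr>carrier := R ` carrier M\<rparr>))"
        using inj by (simp add: bij_betw_def)
      have "linear_map K M (U\<lparr>carrier := R ` carrier M\<rparr>) R"
        by (rule linear_map_into_subspace[OF R im]) auto
      from linear_map_comp[OF linear_map_inv_into[OF this bij] dual_linear[OF M \<xi>]]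
      obtain g where g: "linear_map K U (scalar_space K) g"
        "\<And>u. u \<in> R ` carrier M \<Longrightarrow> g u = \<Theta> z (inv_into (carrier M) R u)"
        using functional_extends[OF Uv U im] by blast
      let ?\<phi> = "\<lambda>u\<in>carrier U. g u"
      have \<phi>: "?\<phi> \<in> carrier (dual_space K U)" by (rule dual_restrict[OF g(1)])
      have "transpose_map M R ?\<phi> = \<Theta> z"
        using inj linear_map_closed[OF R]
        by (intro dual_eqI[OF M transpose_closed[OF R \<phi>] \<xi>]) (auto simp: transpose_map_def g(2))
      then show ?thesis using S[OF \<phi>] \<Theta>_inj[OF _ z, of "S ?\<phi>"] \<phi> by (metis imageI)
    qed
    then show ?thesis using S by blast
  qed
  \<comment> \<open>A functional on \<open>M\<close> nonzero at a kernel vector x would have the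
    form \<phi> composed with R, which vanishes at x.\<close>
  moreover have "inj_on R (carrier M)" if surj: "S ` carrier (dual_space K U) = carrier Z"
  proof (rule linear_map_injI[OF R], rule ccontr)
    fix x assume x: "x \<in> carrier M" "R x = \<zero>\<^bsub>U\<^esub>" "x \<noteq> \<zero>\<^bsub>M\<^esub>"
    then obtain h where h: "h \<in> carrier (dual_space K M)" "h x \<noteq> \<zero>\<^bsub>K\<^esub>" using sep by blast
    from h(1) have "h \<in> \<Theta> ` carrier Z" using \<Theta> by (simp add: bij_betw_def)
    then obtain z where z: "z \<in> carrier Z" "\<Theta> z = h" by blast
    then obtain \<phi> where \<phi>: "\<phi> \<in> carrier (dual_space K U)" "z = S \<phi>" using surj by blast
    have "h = transpose_map M R \<phi>" using S[OF \<phi>(1)] z \<phi>(2) by simp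
    then have "h x = \<phi> (R x)" using x(1) by (simp add: transpose_map_def)
    then show False using h(2) x(2) linear_map_zero[OF dual_linear[OF Uv \<phi>(1)]] by simp
  qed
  moreover have "inj_on S (carrier (dual_space K U))" if surj: "R ` carrier M = carrier U"
  proof (rule inj_onI)
    fix \<phi> \<psi> assume \<phi>: "\<phi> \<in> carrier (dual_space K U)" and \<psi>: "\<psi> \<in> carrier (dual_space K U)" and eq: "S \<phi> = S \<psi>"
    have tr: "transpose_map M R \<phi> = transpose_map M R \<psi>" using S[OF \<phi>] S[OF \<psi>] eq by simp
    show "\<phi> = \<psi>"
    proof (rule dual_eqI[OF Uv \<phi> \<psi>])
      fix u assume "u \<in> carrier U"
      then obtain x where x: "x \<in> carrier M" "u = R x" using surj by blast
      then show "\<phi> u = \<psi> u" using fun_cong[OF tr, of x] by (simp add: transpose_map_def)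
    qed
  qed
  \<comment> \<open>If R is not onto, some nonzero functional kills its image and has the same
    transpose as the zero functional.\<close>
  moreover have "R ` carrier M = carrier U" if inj: "inj_on S (carrier (dual_space K U))"
  proof (rule ccontr)
    assume "R ` carrier M \<noteq> carrier U"
    then obtain u where u: "u \<in> carrier U" "u \<notin> R ` carrier M"
      using subspaceD(2)[OF im] by blast
    then obtain \<phi> where \<phi>: "\<phi> \<in> annihilator K U (R ` carrier M)" "\<phi> u \<noteq> \<zero>\<^bsub>K\<^esub>"
      using functional_separates[OF Uv U im] by blast
    let ?z = "\<zero>\<^bsub>dual_space K U\<^esub>"
    have \<phi>c: "\<phi> \<in> carrier (dual_space K U)" using \<phi>(1) by (simp add: annihilator_def)
    have "transpose_map M R \<phi> = transpose_map M R ?z"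
      using \<phi>(1) linear_map_closed[OF R] by (auto simp: transpose_map_def annihilator_def intro!: restrict_ext)
    then have "S \<phi> = S ?z"
      using S[OF \<phi>c] S[OF DU.M.zero_closed] \<Theta>_inj by metis
    then have "\<phi> = ?z" using inj \<phi>c DU.M.zero_closed by (meson inj_onD)
    then show False using \<phi>(2) u(1) by simp
  qed
  ultimately show ?thesis unfolding maximal_rank_def by blast
qed

text \<open>Restriction of functionals to N has the annihilator as its kernel and is onto because
  functionals extend; the quotient of DV by the annihilator is thus the dual of N.\<close>

lemma annihilator_quotient_bij:
  assumes V: "vectorspace K V" "vectorspace.fin_dim K V" and N: "VectorSpace.subspace K N V"
  defines "\<beta> \<equiv> \<lambda>C. the_elem ((\<lambda>\<phi>. \<lambda>n\<in>N. \<phi> n) ` C)"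
  shows "linear_map K (quot_space (dual_space K V) (annihilator K V N)) (dual_space K (V\<lparr>carrier := N\<rparr>)) \<beta>"
    and "\<And>\<phi>. \<phi> \<in> carrier (dual_space K V) \<Longrightarrow>
           \<beta> (annihilator K V N +>\<^bsub>dual_space K V\<^esub> \<phi>) = (\<lambda>n\<in>N. \<phi> n)"
    and "bij_betw \<beta> (carrier (quot_space (dual_space K V) (annihilator K V N)))
           (carrier (dual_space K (V\<lparr>carrier := N\<rparr>)))"
proof -
  let ?A = "annihilator K V N" and ?N = "V\<lparr>carrier := N\<rparr>"
  note Ns = subspaceD(2)[OF N]
  note A = annihilator_subspace[OF V(1) Ns]
  have incl: "linear_map K ?N V (\<lambda>v. v)"
    by (rule linear_map_restrict[OF linear_map_id[OF V(1)] N])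
  have res: "transpose_map ?N (\<lambda>v. v) = (\<lambda>\<phi>. \<lambda>n\<in>N. \<phi> n)" by (simp add: transpose_map_def fun_eq_iff)
  have r: "linear_map K (dual_space K V) (dual_space K ?N) (\<lambda>\<phi>. \<lambda>n\<in>N. \<phi> n)"
    using transpose_linear[OF incl] unfolding res .
  have r0: "(\<lambda>n\<in>N. \<phi> n) = \<zero>\<^bsub>dual_space K ?N\<^esub>" if "\<phi> \<in> ?A" for \<phi>
    using that by (auto simp: annihilator_def intro!: restrict_ext)
  show lin: "linear_map K (quot_space (dual_space K V) ?A) (dual_space K ?N) \<beta>"
    unfolding \<beta>_def by (rule quot_lift_linear[OF A r r0])
  show val: "\<beta> (?A +>\<^bsub>dual_space K V\<^esub> \<phi>) = (\<lambda>n\<in>N. \<phi> n)" if "\<phi> \<in> carrier (dual_space K V)" for \<phi>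
    unfolding \<beta>_def using quot_image[OF A r r0 that] by simp
  have "inj_on \<beta> (carrier (quot_space (dual_space K V) ?A))"
  proof (rule linear_map_injI[OF lin])
    fix C assume C: "C \<in> carrier (quot_space (dual_space K V) ?A)" "\<beta> C = \<zero>\<^bsub>dual_space K ?N\<^esub>"
    then obtain \<phi> where \<phi>: "\<phi> \<in> carrier (dual_space K V)" "C = ?A +>\<^bsub>dual_space K V\<^esub> \<phi>"
      by (auto simp: carrier_quot_space)
    then have "(\<lambda>n\<in>N. \<phi> n) = (\<lambda>n\<in>N. \<zero>\<^bsub>K\<^esub>)" using C(2) val by simp
    then have "\<phi> n = \<zero>\<^bsub>K\<^esub>" if "n \<in> N" for n using that by (metis restrict_apply')
    then have "\<phi> \<in> ?A" using \<phi>(1) by (simp add: annihilator_def)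
    then show "C = \<zero>\<^bsub>quot_space (dual_space K V) ?A\<^esub>"
      unfolding \<phi>(2) by (simp add: quot_proj_zero[OF A])
  qed
  moreover have "\<exists>C\<in>carrier (quot_space (dual_space K V) ?A). \<beta> C = \<xi>" if \<xi>: "\<xi> \<in> carrier (dual_space K ?N)" for \<xi>
  proof -
    obtain g where g: "linear_map K V (scalar_space K) g" "\<And>n. n \<in> N \<Longrightarrow> g n = \<xi> n"
      using functional_extends[OF V N dual_linear[OF subspace_vs[OF N] \<xi>]] by blast
    let ?\<phi> = "\<lambda>v\<in>carrier V. g v"
    have \<phi>: "?\<phi> \<in> carrier (dual_space K V)" by (rule dual_restrict[OF g(1)])
    have "(\<lambda>n\<in>N. ?\<phi> n) = \<xi>"
      using g(2) Ns \<xi> by (auto simp: carrier_dual_space[OF subspace_vs[OF N]] intro!: extensionalityI[of _ N])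
    then show ?thesis using val[OF \<phi>] \<phi> by (auto simp: carrier_quot_space)
  qed
  ultimately show "bij_betw \<beta> (carrier (quot_space (dual_space K V) ?A)) (carrier (dual_space K ?N))"
    using linear_map_closed[OF lin] unfolding bij_betw_def by blast
qed

text \<open>A commuting square: projecting modulo the annihilator on the side of DV \<otimes> DW
  corresponds to restricting functionals from V \<otimes> W to N \<otimes> W. On a pure tensor of
  \<phi> and \<psi> both ways give the tensor of the restriction of \<phi> with \<psi>, and pure
  tensors decide.\<close>

lemma tensor_annihilator_pairing:
  fixes V :: "('k, 'v, 'x) module_scheme" and W :: "('k, 'w, 'y) module_scheme"
  assumes V: "vectorspace K V" "vectorspace.fin_dim K V" and W: "vectorspace K W" "vectorspace.fin_dim K W"
    and N: "VectorSpace.subspace K N V"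
  defines "A \<equiv> annihilator K V N"
  shows "\<exists>\<Theta>. bij_betw \<Theta> (carrier (tensor K (quot_space (dual_space K V) A) (dual_space K W)))
                (carrier (dual_space K (tensor K (V\<lparr>carrier := N\<rparr>) W))) \<and>
         (\<forall>t\<in>carrier (tensor K (dual_space K V) (dual_space K W)).
            \<forall>x\<in>carrier (tensor K (V\<lparr>carrier := N\<rparr>) W).
              \<Theta> (tensor_map K (dual_space K V) (dual_space K W) (quot_space (dual_space K V) A) (dual_space K W)
                   (\<lambda>a. A +>\<^bsub>dual_space K V\<^esub> a) (\<lambda>c. c) t) x
              = dual_tensor K V W t (tensor_map K (V\<lparr>carrier := N\<rparr>) W V W (\<lambda>v. v) (\<lambda>w. w) x))"
proof -
  let ?N = "V\<lparr>carrier := N\<rparr>" and ?DV = "dual_space K V" and ?DW = "dual_space K W"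
  let ?Q = "quot_space ?DV A"
  note Ns = subspaceD(2)[OF N] and Nv = subspace_vs[OF N]
  note DV = dual_space_vs[OF V(1)] and DW = dual_space_vs[OF W(1)]
  have A: "VectorSpace.subspace K A ?DV" unfolding A_def by (rule annihilator_subspace[OF V(1) Ns])
  define \<beta> where "\<beta> C = the_elem ((\<lambda>\<phi>. \<lambda>n\<in>N. \<phi> n) ` C)" for C :: "('v \<Rightarrow> 'k) set"
  note \<beta> = annihilator_quotient_bij[OF V N, folded A_def \<beta>_def]
  define \<Theta> where "\<Theta> = tensor_lift K ?Q ?DW (dual_space K (tensor K ?N W)) (\<lambda>p q. functional_tensor K ?N W (\<beta> p) q)"
  have idb: "bij_betw (\<lambda>v. v) (carrier ?DW) (carrier ?DW)" by (auto simp: bij_betw_def)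
  note \<Theta> = pairing_bij[OF quot_space_vs[OF A] DW Nv W \<beta>(1,3) linear_map_id[OF DW] idb, folded \<Theta>_def]
  note dt = dual_tensor_facts[OF V(1) W]
  interpret DD: two_spaces K ?DV ?DW by (rule two_spaces.intro[OF DV DW])
  interpret NW: two_spaces K ?N W by (rule two_spaces.intro[OF Nv W(1)])
  interpret VW: two_spaces K V W by (rule two_spaces.intro[OF V(1) W(1)])
  let ?\<pi> = "tensor_map K ?DV ?DW ?Q ?DW (\<lambda>a. A +>\<^bsub>?DV\<^esub> a) (\<lambda>c. c)"
  let ?\<iota> = "tensor_map K ?N W V W (\<lambda>v. v) (\<lambda>w. w)"
  note q = quot_proj_linear[OF A]
  note \<pi> = tensor_map_linear[OF q linear_map_id[OF DW]] tensor_map_pure[OF q linear_map_id[OF DW]]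
  have incl: "linear_map K ?N V (\<lambda>v. v)" by (rule linear_map_restrict[OF linear_map_id[OF V(1)] N])
  note \<iota> = tensor_map_linear[OF incl linear_map_id[OF W(1)]] tensor_map_pure[OF incl linear_map_id[OF W(1)]]
  have "\<Theta> (?\<pi> t) = transpose_map NW.T ?\<iota> (dual_tensor K V W t)" if t: "t \<in> carrier DD.T" for t
  proof (rule DD.tensor_linear_eq[OF linear_map_comp[OF \<pi>(1) \<Theta>(1)] linear_map_comp[OF dt(1) transpose_linear[OF \<iota>(1)]] _ t])
    fix \<phi> \<psi> assume \<phi>: "\<phi> \<in> carrier ?DV" and \<psi>: "\<psi> \<in> carrier ?DW"
    have r: "(\<lambda>n\<in>N. \<phi> n) \<in> carrier (dual_space K ?N)"
      using dual_restrict[OF linear_map_restrict[OF dual_linear[OF V(1) \<phi>] N]] by simp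
    have "\<Theta> (?\<pi> (DD.pure \<phi> \<psi>)) = functional_tensor K ?N W (\<lambda>n\<in>N. \<phi> n) \<psi>"
      using \<phi> \<psi> linear_map_closed[OF q \<phi>] by (simp add: \<pi>(2) \<Theta>(2) \<beta>(2))
    also have "\<dots> = transpose_map NW.T ?\<iota> (functional_tensor K V W \<phi> \<psi>)"
    proof (rule NW.dual_tensor_eqI[OF NW.functional_tensor_dual[OF r \<psi>] transpose_closed[OF \<iota>(1) VW.functional_tensor_dual[OF \<phi> \<psi>]]])
      fix v w assume v: "v \<in> carrier ?N" and w: "w \<in> carrier W"
      then have "v \<in> carrier V" using Ns by auto
      then show "functional_tensor K ?N W (\<lambda>n\<in>N. \<phi> n) \<psi> (NW.pure v w)
          = transpose_map NW.T ?\<iota> (functional_tensor K V W \<phi> \<psi>) (NW.pure v w)"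
        using v w NW.pure_closed[OF v w]
        by (simp add: transpose_map_def \<iota>(2) NW.functional_tensor_pure[OF r \<psi>] VW.functional_tensor_pure[OF \<phi> \<psi>])
    qed
    also have "\<dots> = transpose_map NW.T ?\<iota> (dual_tensor K V W (DD.pure \<phi> \<psi>))"
      using dt(2)[OF \<phi> \<psi>] by simp
    finally show "\<Theta> (?\<pi> (DD.pure \<phi> \<psi>)) = transpose_map NW.T ?\<iota> (dual_tensor K V W (DD.pure \<phi> \<psi>))" .
  qed
  then show ?thesis
    using \<Theta>(3) by (intro exI[of _ \<Theta>]) (auto simp: transpose_map_def)
qed

text \<open>Summing the squares of \<open>tensor_annihilator_pairing\<close> over \<open>I\<close>
  shows that the projected dual map is the transpose of the restricted one. The families N and A are
  tied together on \<open>I\<close> only, since their values elsewhere carry no meaning.\<close>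

lemma restriction_iff_projection_maximal_rank:
  fixes V :: "'i \<Rightarrow> ('k, 'v, 'x) module_scheme" and W :: "'i \<Rightarrow> ('k, 'w, 'y) module_scheme"
  assumes K: "field K" and I: "finite I"
    and V: "\<And>i. i \<in> I \<Longrightarrow> vectorspace K (V i)" "\<And>i. i \<in> I \<Longrightarrow> vectorspace.fin_dim K (V i)"
    and W: "\<And>i. i \<in> I \<Longrightarrow> vectorspace K (W i)" "\<And>i. i \<in> I \<Longrightarrow> vectorspace.fin_dim K (W i)"
    and U: "vectorspace.fin_dim K U" and T: "linear_map K (tensor_sum K I V W) U T"
    and N: "\<And>i. i \<in> I \<Longrightarrow> VectorSpace.subspace K (N i) (V i)"
    and A: "\<And>i. i \<in> I \<Longrightarrow> A i = annihilator K (V i) (N i)"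
  shows "restriction_maximal_rank K I V W U T N \<longleftrightarrow>
    projection_maximal_rank K I (dual_space K U) (\<lambda>i. dual_space K (V i)) (\<lambda>i. dual_space K (W i))
      (dual_transformation K I V W T) A"
proof -
  let ?N = "\<lambda>i. (V i)\<lparr>carrier := N i\<rparr>" and ?DV = "\<lambda>i. dual_space K (V i)" and ?DW = "\<lambda>i. dual_space K (W i)"
  let ?Q = "\<lambda>i. quot_space (?DV i) (A i)"
  let ?M = "\<lambda>i. tensor K (?N i) (W i)" and ?Z = "\<lambda>i. tensor K (?Q i) (?DW i)"
  let ?Y = "\<lambda>i. tensor K (V i) (W i)" and ?DD = "\<lambda>i. tensor K (?DV i) (?DW i)"
  define \<iota> where "\<iota> i = tensor_map K (?N i) (W i) (V i) (W i) (\<lambda>v. v) (\<lambda>w. w)" for i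
  define \<pi> where "\<pi> i = tensor_map K (?DV i) (?DW i) (?Q i) (?DW i) (\<lambda>a. A i +>\<^bsub>?DV i\<^esub> a) (\<lambda>c. c)" for i
  have Nv: "vectorspace K (?N i)" and Nf: "vectorspace.fin_dim K (?N i)" if "i \<in> I" for i
    using subspace_vs[OF N] subspace_fin_dim[OF V N] that by auto
  have M: "vectorspace K (?M i)" and Y: "vectorspace K (?Y i)" if "i \<in> I" for i
    using two_spaces.tensor_vs[OF two_spaces.intro] V W Nv that by blast+
  have \<iota>: "linear_map K (?M i) (?Y i) (\<iota> i)" if "i \<in> I" for i
    unfolding \<iota>_def using that
    by (intro tensor_map_linear linear_map_restrict linear_map_id N V W)
  have AA: "VectorSpace.subspace K (A i) (?DV i)" if "i \<in> I" for i
    unfolding A[OF that] by (rule annihilator_subspace[OF V(1) subspaceD(2)[OF N]]) (use that in auto)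
  have \<pi>: "linear_map K (?DD i) (?Z i) (\<pi> i)" if "i \<in> I" for i
    unfolding \<pi>_def using that
    by (intro tensor_map_linear quot_proj_linear AA linear_map_id dual_space_vs W)
  have "\<exists>\<Theta>. bij_betw \<Theta> (carrier (?Z i)) (carrier (dual_space K (?M i))) \<and>
      (\<forall>t\<in>carrier (?DD i). \<forall>x\<in>carrier (?M i). \<Theta> (\<pi> i t) x = dual_tensor K (V i) (W i) t (\<iota> i x))" if "i \<in> I" for i
    unfolding \<pi>_def \<iota>_def A[OF that] by (rule tensor_annihilator_pairing[OF V W N]) (use that in auto)
  then obtain \<Theta> where \<Theta>: "\<And>i. i \<in> I \<Longrightarrow> bij_betw (\<Theta> i) (carrier (?Z i)) (carrier (dual_space K (?M i)))"
    and \<Theta>\<pi>: "\<And>i t x. i \<in> I \<Longrightarrow> t \<in> carrier (?DD i) \<Longrightarrow> x \<in> carrier (?M i) \<Longrightarrow>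
        \<Theta> i (\<pi> i t) x = dual_tensor K (V i) (W i) t (\<iota> i x)"
    by metis
  define R where "R = T \<circ> dsum_map I \<iota>"
  define S where "S = dsum_map I \<pi> \<circ> dual_transformation K I V W T"
  have T': "linear_map K (dsum I ?Y) U T" using T by (simp add: tensor_sum_def)
  have \<iota>sum: "linear_map K (dsum I ?M) (dsum I ?Y) (dsum_map I \<iota>)" by (rule dsum_map_linear[OF K \<iota>])
  have R: "linear_map K (dsum I ?M) U R"
    unfolding R_def comp_def by (rule linear_map_comp[OF \<iota>sum T'])
  \<comment> \<open>A nonzero element of the direct sum has a nonzero component, and a functional on
    that summand is composed with the projection to it.\<close>
  have sep: "\<exists>h\<in>carrier (dual_space K (dsum I ?M)). h x \<noteq> \<zero>\<^bsub>K\<^esub>"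
    if x: "x \<in> carrier (dsum I ?M)" "x \<noteq> \<zero>\<^bsub>dsum I ?M\<^esub>" for x
  proof -
    have "\<exists>i\<in>I. x i \<noteq> \<zero>\<^bsub>?M i\<^esub>"
    proof (rule ccontr)
      assume "\<not> ?thesis"
      then have "x = \<zero>\<^bsub>dsum I ?M\<^esub>" using x(1) by (auto simp: PiE_iff intro!: extensionalityI[of _ I])
      then show False using x(2) by blast
    qed
    then obtain i where i: "i \<in> I" "x i \<noteq> \<zero>\<^bsub>?M i\<^esub>" by blast
    have xi: "x i \<in> carrier (?M i)" using x(1) i(1) by auto
    obtain h where h: "h \<in> carrier (dual_space K (?M i))" "h (x i) \<noteq> \<zero>\<^bsub>K\<^esub>"
      using two_spaces.tensor_functional_nonzero[OF two_spaces.intro[OF Nv W(1)] Nf W(2) xi i(2)] i(1) by blast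
    have "(\<lambda>x\<in>carrier (dsum I ?M). h (x i)) \<in> carrier (dual_space K (dsum I ?M))"
      by (intro dual_restrict linear_map_comp[OF dsum_proj_linear[where M="?M" and I=I, OF K M i(1)] dual_linear[OF M h(1)]] i(1))
    then show ?thesis using h(2) x(1) by (intro bexI[of _ "\<lambda>x\<in>carrier (dsum I ?M). h (x i)"]) auto
  qed
  have "S \<phi> \<in> carrier (dsum I ?Z) \<and> dual_sum_map K I ?M \<Theta> (S \<phi>) = transpose_map (dsum I ?M) R \<phi>"
    if \<phi>: "\<phi> \<in> carrier (dual_space K U)" for \<phi>
  proof -
    define \<tau> where "\<tau> = dual_transformation K I V W T \<phi>"
    \<comment> \<open>Here the \<open>inv_into\<close> in the definition of the dual map disappears:
      only membership and the value under \<open>dual_tensor\<close> are used from now on.\<close>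
    have \<tau>: "\<tau> i \<in> carrier (?DD i)"
      "y \<in> carrier (?Y i) \<Longrightarrow> dual_tensor K (V i) (W i) (\<tau> i) y = \<phi> (T (dsum_inj I ?Y i y))" if i: "i \<in> I" for i y
    proof -
      note inj = dsum_inj_linear[where M="?Y" and I=I, OF K Y i]
      define h where "h = transpose_map (?Y i) (dsum_inj I ?Y i) (transpose_map (tensor_sum K I V W) T \<phi>)"
      have h: "h \<in> carrier (dual_space K (?Y i))"
        unfolding h_def tensor_sum_def by (intro transpose_closed[OF inj] transpose_closed[OF T'] \<phi>)
      have eq: "\<tau> i = inv_into (carrier (?DD i)) (dual_tensor K (V i) (W i)) h"
        using i by (simp add: \<tau>_def dual_transformation_def h_def)
      note bij = dual_tensor_facts(3)[OF V(1)[OF i] W(1)[OF i] W(2)[OF i]]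
      show "\<tau> i \<in> carrier (?DD i)"
        unfolding eq using bij h by (auto simp: bij_betw_def inv_into_into)
      have "dual_tensor K (V i) (W i) (\<tau> i) = h"
        unfolding eq using bij h by (auto simp: bij_betw_def f_inv_into_f)
      then show "dual_tensor K (V i) (W i) (\<tau> i) y = \<phi> (T (dsum_inj I ?Y i y))" if "y \<in> carrier (?Y i)"
        using that linear_map_closed[OF inj that] by (simp add: h_def transpose_map_def tensor_sum_def)
    qed
    have S\<phi>: "S \<phi> = (\<lambda>i\<in>I. \<pi> i (\<tau> i))" by (simp add: S_def \<tau>_def dsum_map_def)
    have "S \<phi> \<in> carrier (dsum I ?Z)"
      unfolding S\<phi> using linear_map_closed[OF \<pi> \<tau>(1)] by auto
    moreover have "dual_sum_map K I ?M \<Theta> (S \<phi>) = transpose_map (dsum I ?M) R \<phi>"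
      unfolding dual_sum_map_def transpose_map_def
    proof (rule restrict_ext)
      fix x assume x: "x \<in> carrier (dsum I ?M)"
      interpret Sc: vectorspace K "scalar_space K" by (rule scalar_space_vs[OF K])
      have xi: "x i \<in> carrier (?M i)" if "i \<in> I" for i using x that by auto
      note L = linear_map_comp[OF T' dual_linear[OF linear_map_vs(2)[OF T'] \<phi>]]
      have \<iota>x: "dsum_map I \<iota> x \<in> carrier (dsum I ?Y)" by (rule linear_map_closed[OF \<iota>sum x])
      have cl: "\<phi> (T (dsum_inj I ?Y i (\<iota> i (x i)))) \<in> carrier K" if "i \<in> I" for i
        using linear_map_closed[OF L linear_map_closed[OF dsum_inj_linear[where M="?Y" and I=I, OF K Y that] linear_map_closed[OF \<iota>[OF that] xi[OF that]]]]
        by simp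
      have "(\<Oplus>\<^bsub>scalar_space K\<^esub>i\<in>I. \<Theta> i (S \<phi> i) (x i))
          = (\<Oplus>\<^bsub>scalar_space K\<^esub>i\<in>I. \<phi> (T (dsum_inj I ?Y i (\<iota> i (x i)))))"
        using cl xi linear_map_closed[OF \<iota> xi]
        by (intro Sc.M.finsum_cong') (auto simp: S\<phi> \<Theta>\<pi> \<tau>)
      also have "\<dots> = (\<Oplus>\<^bsub>scalar_space K\<^esub>i\<in>I. \<phi> (T (dsum_inj I ?Y i (dsum_map I \<iota> x i))))"
        using cl by (intro Sc.M.finsum_cong') (auto simp: dsum_map_def)
      also have "\<dots> = \<phi> (R x)"
        using dsum_linear_expand[where M="?Y" and I=I, OF K Y I L \<iota>x] by (simp add: R_def)
      finally show "(\<Oplus>\<^bsub>scalar_space K\<^esub>i\<in>I. \<Theta> i (S \<phi> i) (x i)) = \<phi> (R x)" .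
    qed
    ultimately show ?thesis ..
  qed
  from maximal_rank_transpose[OF R U sep dual_sum_map_bij[where M="?M" and Z="?Z" and \<Theta>=\<Theta> and I=I, OF K M I \<Theta>] this]
  show ?thesis
    unfolding restriction_maximal_rank_def projection_maximal_rank_def R_def S_def tensor_sum_def
      \<iota>_def[abs_def] \<pi>_def[abs_def] by blast
qed

section \<open>Charts and annihilators\<close>

lemma complementaryD:
  assumes "complementary K V A B"
  shows "VectorSpace.subspace K A V" "VectorSpace.subspace K B V" "vectorspace K V"
    and "\<And>v. v \<in> A \<Longrightarrow> v \<in> B \<Longrightarrow> v = \<zero>\<^bsub>V\<^esub>"
    and "\<And>v. v \<in> carrier V \<Longrightarrow> \<exists>a\<in>A. \<exists>b\<in>B. v = a \<oplus>\<^bsub>V\<^esub> b"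
proof -
  have "(\<Union>a\<in>A. \<Union>b\<in>B. {a \<oplus>\<^bsub>V\<^esub> b}) = carrier V"
    using assms by (simp add: complementary_def set_add_def')
  then show "\<exists>a\<in>A. \<exists>b\<in>B. v = a \<oplus>\<^bsub>V\<^esub> b" if "v \<in> carrier V" for v using that by blast
qed (use assms subspaceD(1)[of K A V] in \<open>auto simp: complementary_def\<close>)

lemma complementaryI:
  assumes "VectorSpace.subspace K A V" "VectorSpace.subspace K B V"
    and "\<And>v. v \<in> A \<Longrightarrow> v \<in> B \<Longrightarrow> v = \<zero>\<^bsub>V\<^esub>"
    and "\<And>v. v \<in> carrier V \<Longrightarrow> \<exists>a\<in>A. \<exists>b\<in>B. v = a \<oplus>\<^bsub>V\<^esub> b"
  shows "complementary K V A B"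
proof -
  interpret V: vectorspace K V by (rule subspaceD(1)[OF assms(1)])
  note A = subspaceD[OF assms(1)] and B = subspaceD[OF assms(2)]
  have "a \<oplus>\<^bsub>V\<^esub> b \<in> carrier V" if "a \<in> A" "b \<in> B" for a b
    using A(2) B(2) that by (intro V.M.add.m_closed) auto
  moreover have "A \<inter> B = {\<zero>\<^bsub>V\<^esub>}" using assms(3) A(3) B(3) by blast
  moreover have "(\<Union>a\<in>A. \<Union>b\<in>B. {a \<oplus>\<^bsub>V\<^esub> b}) = carrier V"
    using calculation(1) assms(4) by (intro equalityI subsetI) blast+
  ultimately show ?thesis
    using assms(1,2) by (simp add: complementary_def set_add_def')
qed

text \<open>The projection onto \<open>A\<close> along \<open>B\<close>. Its value at v is
  characterised as the only a in \<open>A\<close> with v - a in \<open>B\<close>, so each algebraic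
  law follows by exhibiting a suitable candidate.\<close>

lemma complementary_projection:
  assumes c: "complementary K V A B"
  shows "\<exists>p. linear_map K V V p \<and> (\<forall>v\<in>carrier V. p v \<in> A \<and> v \<ominus>\<^bsub>V\<^esub> p v \<in> B) \<and>
           (\<forall>a\<in>A. p a = a) \<and> (\<forall>b\<in>B. p b = \<zero>\<^bsub>V\<^esub>)"
proof -
  note cD = complementaryD[OF c]
  interpret V: vectorspace K V by (rule cD(3))
  note A = subspaceD[OF cD(1)] and B = subspaceD[OF cD(2)]
  have Ac: "a \<in> carrier V" if "a \<in> A" for a using A(2) that by auto
  have Bc: "b \<in> carrier V" if "b \<in> B" for b using B(2) that by auto
  have ab: "(a \<oplus>\<^bsub>V\<^esub> b) \<ominus>\<^bsub>V\<^esub> a = b" if "a \<in> carrier V" "b \<in> carrier V" for a b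
    using that V.M.add.m_comm[of a b] V.M.add.m_assoc[of b a "\<ominus>\<^bsub>V\<^esub> a"] by (simp add: a_minus_def V.M.r_neg)
  define p where "p v = (THE a. a \<in> A \<and> v \<ominus>\<^bsub>V\<^esub> a \<in> B)" for v
  have p_eq: "p v = a" if v: "v \<in> carrier V" and a: "a \<in> A" "v \<ominus>\<^bsub>V\<^esub> a \<in> B" for v a
    unfolding p_def
  proof (rule the_equality)
    fix a' assume a': "a' \<in> A \<and> v \<ominus>\<^bsub>V\<^esub> a' \<in> B"
    \<comment> \<open>This identity places the difference of two candidates in \<open>B\<close>; it
      also lies in \<open>A\<close>, hence is zero.\<close>
    have "v \<ominus>\<^bsub>V\<^esub> a = (v \<ominus>\<^bsub>V\<^esub> a') \<oplus>\<^bsub>V\<^esub> (a' \<ominus>\<^bsub>V\<^esub> a)"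
      using v Ac[OF a(1)] Ac[of a'] a'
      by (simp add: a_minus_def V.M.add.m_assoc V.M.r_neg1)
    then have "a' \<ominus>\<^bsub>V\<^esub> a = (v \<ominus>\<^bsub>V\<^esub> a) \<ominus>\<^bsub>V\<^esub> (v \<ominus>\<^bsub>V\<^esub> a')"
      using ab[of "v \<ominus>\<^bsub>V\<^esub> a'" "a' \<ominus>\<^bsub>V\<^esub> a"] v Ac[OF a(1)] Ac[of a'] a' by simp
    then have "a' \<ominus>\<^bsub>V\<^esub> a \<in> B" using subspace_minus[OF cD(2) a(2)] a' by metis
    moreover have "a' \<ominus>\<^bsub>V\<^esub> a \<in> A" using subspace_minus[OF cD(1)] a a' by blast
    ultimately have "a' \<ominus>\<^bsub>V\<^esub> a = \<zero>\<^bsub>V\<^esub>" using cD(4) by blast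
    then show "a' = a" using Ac a(1) a' by simp
  qed (use a in auto)
  have p: "p v \<in> A" "v \<ominus>\<^bsub>V\<^esub> p v \<in> B" if v: "v \<in> carrier V" for v
  proof -
    obtain a b where "a \<in> A" "b \<in> B" "v = a \<oplus>\<^bsub>V\<^esub> b" using cD(5)[OF v] by blast
    then have *: "a \<in> A" "v \<ominus>\<^bsub>V\<^esub> a \<in> B" using ab Ac Bc by auto
    show "p v \<in> A" "v \<ominus>\<^bsub>V\<^esub> p v \<in> B" using p_eq[OF v *] * by auto
  qed
  have "linear_map K V V p"
  proof (rule linear_mapI[OF cD(3) cD(3)])
    fix v w assume v: "v \<in> carrier V" and w: "w \<in> carrier V"
    have "(v \<oplus>\<^bsub>V\<^esub> w) \<ominus>\<^bsub>V\<^esub> (p v \<oplus>\<^bsub>V\<^esub> p w) = (v \<ominus>\<^bsub>V\<^esub> p v) \<oplus>\<^bsub>V\<^esub> (w \<ominus>\<^bsub>V\<^esub> p w)"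
      using v w Ac[OF p(1)] by (simp add: a_minus_def V.M.minus_add V.M.a_ac)
    then show "p (v \<oplus>\<^bsub>V\<^esub> w) = p v \<oplus>\<^bsub>V\<^esub> p w"
      using p[OF v] p[OF w] v w A(4) B(4) by (intro p_eq) auto
  next
    fix k v assume k: "k \<in> carrier K" and v: "v \<in> carrier V"
    have "(k \<odot>\<^bsub>V\<^esub> v) \<ominus>\<^bsub>V\<^esub> (k \<odot>\<^bsub>V\<^esub> p v) = k \<odot>\<^bsub>V\<^esub> (v \<ominus>\<^bsub>V\<^esub> p v)"
      using k v Ac[OF p(1)] by (simp add: a_minus_def V.smult_r_distr V.smult_r_minus)
    then show "p (k \<odot>\<^bsub>V\<^esub> v) = k \<odot>\<^bsub>V\<^esub> p v"
      using p[OF v] v k A(5) B(5) by (intro p_eq) auto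
  qed (use p Ac in auto)
  moreover have "p a = a" if "a \<in> A" for a
    using that Ac[OF that] B(3) by (intro p_eq) (auto simp: a_minus_def V.M.r_neg)
  moreover have "p b = \<zero>\<^bsub>V\<^esub>" if "b \<in> B" for b
    using subspace_minus[OF cD(2) that B(3)] Bc[OF that] A(3) by (intro p_eq)
  ultimately show ?thesis using p by blast
qed

lemma annihilatorD:
  "\<phi> \<in> annihilator K V N \<Longrightarrow> \<phi> \<in> carrier (dual_space K V)"
  "\<phi> \<in> annihilator K V N \<Longrightarrow> v \<in> N \<Longrightarrow> \<phi> v = \<zero>\<^bsub>K\<^esub>"
  by (auto simp: annihilator_def)

text \<open>With p the projection onto \<open>A\<close> along \<open>B\<close>, a functional splits
  as \<phi> \<circ> (1 - p), which kills \<open>A\<close>, plus \<phi> \<circ> p, which kills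
  \<open>B\<close>.\<close>

lemma complementary_annihilator:
  assumes c: "complementary K V A B"
  shows "complementary K (dual_space K V) (annihilator K V A) (annihilator K V B)"
proof -
  note cD = complementaryD[OF c]
  interpret K: field K by (rule vs_field[OF cD(3)])
  interpret V: vectorspace K V by (rule cD(3))
  note A = subspaceD[OF cD(1)] and B = subspaceD[OF cD(2)]
  have Ac: "a \<in> carrier V" if "a \<in> A" for a using A(2) that by auto
  have Bc: "b \<in> carrier V" if "b \<in> B" for b using B(2) that by auto
  obtain p where p: "linear_map K V V p" "\<And>v. v \<in> carrier V \<Longrightarrow> p v \<in> A"
    "\<And>v. v \<in> carrier V \<Longrightarrow> v \<ominus>\<^bsub>V\<^esub> p v \<in> B" "\<And>a. a \<in> A \<Longrightarrow> p a = a" "\<And>b. b \<in> B \<Longrightarrow> p b = \<zero>\<^bsub>V\<^esub>"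
    using complementary_projection[OF c] by blast
  show ?thesis
  proof (rule complementaryI)
    show "VectorSpace.subspace K (annihilator K V A) (dual_space K V)"
      "VectorSpace.subspace K (annihilator K V B) (dual_space K V)"
      using annihilator_subspace[OF cD(3)] A(2) B(2) by auto
  next
    fix \<phi> assume \<phi>: "\<phi> \<in> annihilator K V A" "\<phi> \<in> annihilator K V B"
    note L = dual_linear[OF cD(3) annihilatorD(1)[OF \<phi>(1)]]
    show "\<phi> = \<zero>\<^bsub>dual_space K V\<^esub>"
    proof (rule dual_eqI[OF cD(3) annihilatorD(1)[OF \<phi>(1)]])
      show "\<zero>\<^bsub>dual_space K V\<^esub> \<in> carrier (dual_space K V)"
        using subspaceD(2,3)[OF annihilator_subspace[OF cD(3) A(2)]] by blast
      fix v assume v: "v \<in> carrier V"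
      then obtain a b where ab: "a \<in> A" "b \<in> B" "v = a \<oplus>\<^bsub>V\<^esub> b" using cD(5) by blast
      then have "\<phi> v = \<phi> a \<oplus>\<^bsub>K\<^esub> \<phi> b" using linear_map_add[OF L, of a b] Ac Bc by simp
      then show "\<phi> v = \<zero>\<^bsub>dual_space K V\<^esub> v"
        using annihilatorD(2)[OF \<phi>(1) ab(1)] annihilatorD(2)[OF \<phi>(2) ab(2)] v by simp
    qed
  next
    fix \<phi> assume \<phi>: "\<phi> \<in> carrier (dual_space K V)"
    note L = dual_linear[OF cD(3) \<phi>]
    have cl: "\<phi> v \<in> carrier K" if "v \<in> carrier V" for v using dual_closed[OF cD(3) \<phi> that] .
    have Lp: "linear_map K V (scalar_space K) (\<lambda>v. \<phi> (p v))" by (rule linear_map_comp[OF p(1) L])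
    have Lq: "linear_map K V (scalar_space K) (\<lambda>v. \<phi> (v \<ominus>\<^bsub>V\<^esub> p v))"
      by (rule linear_map_comp[OF linear_map_diff[OF linear_map_id[OF cD(3)] p(1)] L])
    let ?\<alpha> = "\<lambda>v\<in>carrier V. \<phi> (v \<ominus>\<^bsub>V\<^esub> p v)" and ?\<beta> = "\<lambda>v\<in>carrier V. \<phi> (p v)"
    have \<alpha>: "?\<alpha> \<in> annihilator K V A"
      using dual_restrict[OF Lq] p(4) Ac linear_map_zero[OF L]
      by (auto simp: annihilator_def a_minus_def V.M.r_neg)
    have \<beta>: "?\<beta> \<in> annihilator K V B"
      using dual_restrict[OF Lp] p(5) Bc linear_map_zero[OF L] by (auto simp: annihilator_def)
    have "\<phi> = ?\<alpha> \<oplus>\<^bsub>dual_space K V\<^esub> ?\<beta>"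
    proof -
      have "\<phi> v = (?\<alpha> \<oplus>\<^bsub>dual_space K V\<^esub> ?\<beta>) v" if v: "v \<in> carrier V" for v
      proof -
        have "v \<ominus>\<^bsub>V\<^esub> p v \<oplus>\<^bsub>V\<^esub> p v = v"
          using v Ac[OF p(2)[OF v]] by (simp add: a_minus_def V.M.add.m_assoc V.M.l_neg)
        then show ?thesis
          using linear_map_add[OF L, of "v \<ominus>\<^bsub>V\<^esub> p v" "p v"] v Ac[OF p(2)[OF v]] by simp
      qed
      moreover have "\<phi> \<in> extensional (carrier V)" using \<phi> by (simp add: carrier_dual_space[OF cD(3)])
      ultimately show ?thesis by (intro extensionalityI[of _ "carrier V"]) auto
    qed
    then show "\<exists>a\<in>annihilator K V A. \<exists>b\<in>annihilator K V B. \<phi> = a \<oplus>\<^bsub>dual_space K V\<^esub> b"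
      using \<alpha> \<beta> by blast
  qed
qed

text \<open>Every functional is a sum of one killing \<open>A\<close> and one killing
  \<open>B\<close>, so all functionals vanish on the intersection, which is zero. A functional
  killing the sum of \<open>A\<close> and \<open>B\<close> lies in both annihilators and is zero, so
  the sum is everything.\<close>

lemma complementary_of_annihilators:
  assumes V: "vectorspace K V" "vectorspace.fin_dim K V"
    and A: "VectorSpace.subspace K A V" and B: "VectorSpace.subspace K B V"
    and c: "complementary K (dual_space K V) (annihilator K V A) (annihilator K V B)"
  shows "complementary K V A B"
proof (rule complementaryI[OF A B])
  note cD = complementaryD[OF c]
  interpret K: field K by (rule vs_field[OF V(1)])
  interpret V: vectorspace K V by (rule V(1))
  note As = subspaceD[OF A] and Bs = subspaceD[OF B]
  fix v assume v: "v \<in> A" "v \<in> B"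
  show "v = \<zero>\<^bsub>V\<^esub>"
  proof (rule ccontr)
    assume "v \<noteq> \<zero>\<^bsub>V\<^esub>"
    moreover have vc: "v \<in> carrier V" using v As(2) by auto
    ultimately obtain \<phi> where \<phi>: "\<phi> \<in> carrier (dual_space K V)" "\<phi> v \<noteq> \<zero>\<^bsub>K\<^esub>"
      using functional_nonzero[OF V] by blast
    obtain a b where ab: "a \<in> annihilator K V A" "b \<in> annihilator K V B" "\<phi> = a \<oplus>\<^bsub>dual_space K V\<^esub> b"
      using cD(5)[OF \<phi>(1)] by blast
    then show False
      using \<phi>(2) vc annihilatorD(2)[OF ab(1) v(1)] annihilatorD(2)[OF ab(2) v(2)] by simp
  qed
next
  note cD = complementaryD[OF c]
  interpret V: vectorspace K V by (rule V(1))
  note As = subspaceD[OF A] and Bs = subspaceD[OF B]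
  let ?N = "{a \<oplus>\<^bsub>V\<^esub> b | a b. a \<in> A \<and> b \<in> B}"
  have N: "?N = V.subspace_sum A B" unfolding V.submodule_sum_def by auto
  have sub: "VectorSpace.subspace K ?N V" unfolding N by (rule V.sum_is_subspace[OF A B])
  have incl: "A \<subseteq> ?N" "B \<subseteq> ?N"
    unfolding N using V.in_sum_vs[OF A B] V.in_sum_vs[OF B A] V.vsum_comm[OF A B] by auto
  fix v assume v: "v \<in> carrier V"
  have "v \<in> ?N"
  proof (rule ccontr)
    assume "v \<notin> ?N"
    then obtain \<phi> where \<phi>: "\<phi> \<in> annihilator K V ?N" "\<phi> v \<noteq> \<zero>\<^bsub>K\<^esub>"
      using functional_separates[OF V sub v] by blast
    then have "\<phi> \<in> annihilator K V A" "\<phi> \<in> annihilator K V B"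
      using incl unfolding annihilator_def by blast+
    then have "\<phi> = \<zero>\<^bsub>dual_space K V\<^esub>" by (rule cD(4))
    then show False using \<phi>(2) v by simp
  qed
  then show "\<exists>a\<in>A. \<exists>b\<in>B. v = a \<oplus>\<^bsub>V\<^esub> b" by blast
qed

text \<open>In the charts given by \<open>V = A \<oplus> B\<close> and by the annihilators of \<open>A\<close> and \<open>B\<close>, passing to the
  annihilator is a linear isomorphism of the parameter spaces.\<close>

lemma dual_chart_exists:
  fixes V :: "('k, 'v, 'm) module_scheme"
  assumes V: "vectorspace K V" "vectorspace.fin_dim K V" and c: "complementary K V A B"
  defines "H \<equiv> hom_space K (V\<lparr>carrier := A\<rparr>) (V\<lparr>carrier := B\<rparr>)"
    and "H' \<equiv> hom_space K ((dual_space K V)\<lparr>carrier := annihilator K V A\<rparr>)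
               ((dual_space K V)\<lparr>carrier := annihilator K V B\<rparr>)"
  shows "\<exists>L. linear_map K H H' L \<and> bij_betw L (carrier H) (carrier H') \<and>
    (\<forall>f\<in>carrier H. (\<lambda>\<alpha>. \<alpha> \<oplus>\<^bsub>dual_space K V\<^esub> L f \<alpha>) ` annihilator K V A =
       annihilator K V ((\<lambda>a. a \<oplus>\<^bsub>V\<^esub> f a) ` A))"
proof -
  let ?D = "dual_space K V" and ?A = "annihilator K V A" and ?B = "annihilator K V B"
  note cD = complementaryD[OF c]
  interpret K: field K by (rule vs_field[OF V(1)])
  interpret V: vectorspace K V by (rule V(1))
  interpret D: vectorspace K ?D by (rule dual_space_vs[OF V(1)])
  note A = subspaceD[OF cD(1)] and B = subspaceD[OF cD(2)]
  have Ac: "a \<in> carrier V" if "a \<in> A" for a using A(2) that by auto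
  have Bc: "b \<in> carrier V" if "b \<in> B" for b using B(2) that by auto
  have sA: "VectorSpace.subspace K ?A ?D" and sB: "VectorSpace.subspace K ?B ?D"
    using annihilator_subspace[OF V(1)] A(2) B(2) by auto
  note vs = subspace_vs[OF cD(1)] subspace_vs[OF cD(2)] subspace_vs[OF sA] subspace_vs[OF sB]
  note H = carrier_hom_space[OF vs(1,2), folded H_def]
  note H' = carrier_hom_space[OF vs(3,4), folded H'_def]
  interpret H: vectorspace K H unfolding H_def by (rule hom_space_vs[OF vs(1,2)])
  interpret H': vectorspace K H' unfolding H'_def by (rule hom_space_vs[OF vs(3,4)])
  obtain p where p: "linear_map K V V p" "\<And>v. v \<in> carrier V \<Longrightarrow> p v \<in> A"
    "\<And>v. v \<in> carrier V \<Longrightarrow> v \<ominus>\<^bsub>V\<^esub> p v \<in> B" "\<And>a. a \<in> A \<Longrightarrow> p a = a" "\<And>b. b \<in> B \<Longrightarrow> p b = \<zero>\<^bsub>V\<^esub>"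
    using complementary_projection[OF c] by blast
  have pc: "p v \<in> carrier V" if "v \<in> carrier V" for v using Ac[OF p(2)[OF that]] .
  have split: "(v \<ominus>\<^bsub>V\<^esub> p v) \<oplus>\<^bsub>V\<^esub> p v = v" if "v \<in> carrier V" for v
    using that pc[OF that] by (simp add: a_minus_def V.M.add.m_assoc V.M.l_neg)
  have fB: "f a \<in> B" if "f \<in> carrier H" "a \<in> A" for f a
    using linear_map_closed[of K "V\<lparr>carrier := A\<rparr>" "V\<lparr>carrier := B\<rparr>" f a] that by (simp add: H)
  have fc: "f a \<in> carrier V" if "f \<in> carrier H" "a \<in> A" for f a using Bc[OF fB[OF that]] .
  have ac: "\<alpha> v \<in> carrier K" if "\<alpha> \<in> carrier ?D" "v \<in> carrier V" for \<alpha> v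
    using dual_closed[OF V(1) that] .
  note aD = annihilatorD(1)
  \<comment> \<open>Composing with p turns f, which is linear only on \<open>A\<close>, into a
    linear map on all of \<open>V\<close>, so that functionals on \<open>V\<close> can be formed
    from it.\<close>
  have fp: "linear_map K V V (\<lambda>v. f (p v))" if "f \<in> carrier H" for f
  proof -
    have "linear_map K (V\<lparr>carrier := A\<rparr>) V f"
      by (rule linear_map_from_subspace[OF _ cD(2)]) (use that in \<open>simp add: H\<close>)
    from linear_map_comp[OF linear_map_into_subspace[OF p(1) cD(1) p(2)] this] show ?thesis .
  qed
  \<comment> \<open>A functional \<open>\<alpha> + \<beta>\<close> with \<open>\<alpha>\<close> vanishing on \<open>A\<close> and \<open>\<beta>\<close> on \<open>B\<close> kills the graph of \<open>f\<close> iff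
    \<open>\<beta>(a) = - \<alpha>(f a)\<close> for all \<open>a \<in> A\<close>.\<close>
  define L where "L f = (\<lambda>\<alpha>\<in>?A. \<lambda>v\<in>carrier V. \<ominus>\<^bsub>K\<^esub> \<alpha> (f (p v)))" for f :: "'v \<Rightarrow> 'v"
  have Lv: "L f \<alpha> v = \<ominus>\<^bsub>K\<^esub> \<alpha> (f (p v))" if "\<alpha> \<in> ?A" "v \<in> carrier V" for f \<alpha> v
    using that by (simp add: L_def)
  have LB: "L f \<alpha> \<in> ?B" if f: "f \<in> carrier H" and \<alpha>: "\<alpha> \<in> ?A" for f \<alpha>
  proof -
    note la = dual_linear[OF V(1) aD[OF \<alpha>]]
    have "linear_map K V (scalar_space K) (\<lambda>v. \<ominus>\<^bsub>K\<^esub> \<alpha> (f (p v)))"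
      using linear_map_neg[OF linear_map_comp[OF fp[OF f] la]]
      by (rule linear_map_cong)
        (use scalar_space_uminus[OF vs_field[OF V(1)] ac[OF aD[OF \<alpha>] fc[OF f p(2)]]] in simp)
    then have "L f \<alpha> \<in> carrier ?D" using dual_restrict \<alpha> by (simp add: L_def)
    moreover have "L f \<alpha> b = \<zero>\<^bsub>K\<^esub>" if "b \<in> B" for b
      using linear_map_zero[OF linear_map_comp[OF fp[OF f] la]] Bc[OF that] p(5)[OF that]
        p(5)[OF B(3)] by (simp add: Lv[OF \<alpha>])
    ultimately show ?thesis by (simp add: annihilator_def)
  qed
  have LD: "L f \<alpha> \<in> carrier ?D" if "f \<in> carrier H" "\<alpha> \<in> ?A" for f \<alpha>
    using aD[OF LB[OF that]] .
  have LH: "L f \<in> carrier H'" if f: "f \<in> carrier H" for f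
  proof -
    have "linear_map K (?D\<lparr>carrier := ?A\<rparr>) (scalar_space K) (\<lambda>\<alpha>. L f \<alpha> v)" if v: "v \<in> carrier V" for v
    proof -
      note x = fc[OF f p(2)[OF v]]
      show ?thesis
        using scalar_space_uminus[OF vs_field[OF V(1)] ac[OF aD x]] v
        by (intro linear_map_cong[OF linear_map_neg[OF linear_map_restrict[OF eval_linear[OF V(1) x] sA]]])
          (simp add: Lv)
    qed
    then have "linear_map K (?D\<lparr>carrier := ?A\<rparr>) ?D (L f)"
      using LD[OF f] by (intro linear_map_into_dual vs V(1)) simp
    then have "linear_map K (?D\<lparr>carrier := ?A\<rparr>) (?D\<lparr>carrier := ?B\<rparr>) (L f)"
      using LB[OF f] by (intro linear_map_into_subspace sB) simp_all
    then show ?thesis by (simp add: H') (simp add: L_def)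
  qed
  have H'_eqI: "g = g'" if "g \<in> carrier H'" "g' \<in> carrier H'"
    "\<And>\<alpha> v. \<alpha> \<in> ?A \<Longrightarrow> v \<in> carrier V \<Longrightarrow> g \<alpha> v = g' \<alpha> v" for g g'
  proof -
    have cl: "g \<alpha> \<in> carrier ?D" "g' \<alpha> \<in> carrier ?D" if "\<alpha> \<in> ?A" for \<alpha>
      using linear_map_closed[of K "?D\<lparr>carrier := ?A\<rparr>" "?D\<lparr>carrier := ?B\<rparr>"] \<open>g \<in> carrier H'\<close> \<open>g' \<in> carrier H'\<close> that aD
      by (fastforce simp: H')+
    show ?thesis
      using that dual_eqI[OF V(1) cl] by (intro extensionalityI[of _ ?A]) (auto simp: H')
  qed
  have lin: "linear_map K H H' L"
    unfolding H'_def
  proof (rule linear_map_into_hom[OF H.vectorspace_axioms vs(3,4)])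
    show "L f \<in> carrier (hom_space K (?D\<lparr>carrier := ?A\<rparr>) (?D\<lparr>carrier := ?B\<rparr>))" if "f \<in> carrier H" for f
      using LH[OF that] unfolding H'_def .
    fix \<alpha> assume "\<alpha> \<in> carrier (?D\<lparr>carrier := ?A\<rparr>)"
    then have a: "\<alpha> \<in> ?A" by simp
    have "linear_map K H (scalar_space K) (\<lambda>f. L f \<alpha> v)" if v: "v \<in> carrier V" for v
    proof -
      have "linear_map K H (V\<lparr>carrier := B\<rparr>) (\<lambda>f. f (p v))"
        unfolding H_def by (rule hom_eval_linear[OF vs(1,2)]) (simp add: p(2)[OF v])
      from linear_map_neg[OF linear_map_comp[OF linear_map_from_subspace[OF this cD(2)] dual_linear[OF V(1) aD[OF a]]]]
      show ?thesis
        by (rule linear_map_cong)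
          (use scalar_space_uminus[OF vs_field[OF V(1)] ac[OF aD[OF a] fc[OF _ p(2)[OF v]]]] Lv[OF a v] in simp)
    qed
    then have "linear_map K H ?D (\<lambda>f. L f \<alpha>)"
      using LD[OF _ a] by (intro linear_map_into_dual H.vectorspace_axioms V(1))
    then show "linear_map K H (?D\<lparr>carrier := ?B\<rparr>) (\<lambda>f. L f \<alpha>)"
      using LB[OF _ a] by (rule linear_map_into_subspace[OF _ sB])
  qed
  \<comment> \<open>Vectors of \<open>B\<close> are separated by functionals killing
    \<open>A\<close>: if all of these vanish at the difference, it lies in the double annihilator
    \<open>A\<close>, and in \<open>B\<close> as well.\<close>
  have sep: "x = y" if x: "x \<in> B" "y \<in> B" and eq: "\<And>\<alpha>. \<alpha> \<in> ?A \<Longrightarrow> \<alpha> x = \<alpha> y" for x y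
  proof -
    have d: "x \<ominus>\<^bsub>V\<^esub> y \<in> B" by (rule subspace_minus[OF cD(2) x])
    have "\<alpha> (x \<ominus>\<^bsub>V\<^esub> y) = \<zero>\<^bsub>K\<^esub>" if a: "\<alpha> \<in> ?A" for \<alpha>
      using linear_map_minus[OF dual_linear[OF V(1) aD[OF a]] Bc[OF x(1)] Bc[OF x(2)]] eq[OF a]
        ac[OF aD[OF a] Bc[OF x(1)]] ac[OF aD[OF a] Bc[OF x(2)]] K.field_axioms by (simp add: a_minus_def K.r_neg)
    then have "x \<ominus>\<^bsub>V\<^esub> y \<in> preannihilator K V ?A" using Bc[OF d] by (simp add: preannihilator_def)
    then have "x \<ominus>\<^bsub>V\<^esub> y \<in> A" using preannihilator_annihilator[OF V cD(1)] by simp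
    then have "x \<ominus>\<^bsub>V\<^esub> y = \<zero>\<^bsub>V\<^esub>" using cD(4) d by blast
    then show ?thesis using Bc x by simp
  qed
  have inj: "inj_on L (carrier H)"
  proof (rule inj_onI)
    fix f g assume f: "f \<in> carrier H" and g: "g \<in> carrier H" and eq: "L f = L g"
    have "f a = g a" if a: "a \<in> A" for a
    proof (rule sep[OF fB[OF f a] fB[OF g a]])
      fix \<alpha> assume \<alpha>: "\<alpha> \<in> ?A"
      have "\<ominus>\<^bsub>K\<^esub> \<alpha> (f a) = \<ominus>\<^bsub>K\<^esub> \<alpha> (g a)"
        using Lv[OF \<alpha> Ac[OF a], of f] Lv[OF \<alpha> Ac[OF a], of g] eq p(4)[OF a] by simp
      then show "\<alpha> (f a) = \<alpha> (g a)"
        using ac[OF aD[OF \<alpha>] fc[OF f a]] ac[OF aD[OF \<alpha>] fc[OF g a]] by (metis K.minus_minus)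
    qed
    then show "f = g" using f g by (intro extensionalityI[of _ A]) (auto simp: H)
  qed
  have surj: "\<exists>f\<in>carrier H. L f = g" if g: "g \<in> carrier H'" for g
  proof -
    have gl: "linear_map K (?D\<lparr>carrier := ?A\<rparr>) (?D\<lparr>carrier := ?B\<rparr>) g" using g by (simp add: H')
    have gB: "g \<alpha> \<in> ?B" if "\<alpha> \<in> ?A" for \<alpha> using linear_map_closed[OF gl] that by simp
    \<comment> \<open>The projection of DV onto the annihilator of \<open>A\<close> along that of
      \<open>B\<close>. It extends g from the annihilator to all of DV, where reflexivity
      applies.\<close>
    define q where "q \<phi> = (\<lambda>v\<in>carrier V. \<phi> (v \<ominus>\<^bsub>V\<^esub> p v))" for \<phi> :: "'v \<Rightarrow> 'k"
    have lq: "linear_map K V V (\<lambda>v. v \<ominus>\<^bsub>V\<^esub> p v)"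
      by (rule linear_map_diff[OF linear_map_id[OF V(1)] p(1)])
    have "linear_map K ?D ?D q"
      using transpose_linear[OF lq] by (simp add: q_def[abs_def] transpose_map_def[abs_def])
    moreover have "q \<phi> \<in> ?A" if "\<phi> \<in> carrier ?D" for \<phi>
      using linear_map_closed[OF \<open>linear_map K ?D ?D q\<close> that] Ac p(4) linear_map_zero[OF dual_linear[OF V(1) that]]
      by (auto simp: annihilator_def q_def a_minus_def V.M.r_neg)
    ultimately have q: "linear_map K ?D (?D\<lparr>carrier := ?A\<rparr>) q" by (rule linear_map_into_subspace[OF _ sA])
    have q_id: "q \<alpha> = \<alpha>" if a: "\<alpha> \<in> ?A" for \<alpha>
    proof (rule dual_eqI[OF V(1) _ aD[OF a]])
      show "q \<alpha> \<in> carrier ?D" using linear_map_closed[OF q aD[OF a]] aD by simp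
      fix v assume v: "v \<in> carrier V"
      have la: "linear_map K V (scalar_space K) \<alpha>" by (rule dual_linear[OF V(1) aD[OF a]])
      have "\<alpha> v = \<alpha> (v \<ominus>\<^bsub>V\<^esub> p v) \<oplus>\<^bsub>K\<^esub> \<alpha> (p v)"
        using linear_map_add[OF la, of "v \<ominus>\<^bsub>V\<^esub> p v" "p v"] v pc[OF v] split[OF v] by simp
      then show "q \<alpha> v = \<alpha> v"
        using v annihilatorD(2)[OF a p(2)[OF v]] ac[OF aD[OF a]] pc[OF v] by (simp add: q_def)
    qed
    \<comment> \<open>By reflexivity the functional \<open>\<alpha> \<mapsto> - g(\<alpha>)(a)\<close> is the evaluation at a vector.\<close>
    have "\<exists>x\<in>B. \<forall>\<alpha>\<in>?A. \<alpha> x = \<ominus>\<^bsub>K\<^esub> g \<alpha> a" if a: "a \<in> A" for a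
    proof -
      have ev: "linear_map K ?D (scalar_space K) (\<lambda>\<phi>. g (q \<phi>) a)"
        using linear_map_comp[OF linear_map_from_subspace[OF linear_map_comp[OF q gl] sB] eval_linear[OF V(1) Ac[OF a]]] .
      obtain x where x: "x \<in> carrier V" "\<And>\<phi>. \<phi> \<in> carrier ?D \<Longrightarrow> \<ominus>\<^bsub>scalar_space K\<^esub> g (q \<phi>) a = \<phi> x"
        using reflexive[OF V linear_map_neg[OF ev]] by blast
      \<comment> \<open>The vector x given by reflexivity need not lie in \<open>B\<close>. Its
        component in \<open>B\<close> will do, because functionals killing \<open>A\<close> do not
        see the other one.\<close>
      have "\<alpha> (x \<ominus>\<^bsub>V\<^esub> p x) = \<ominus>\<^bsub>K\<^esub> g \<alpha> a" if \<alpha>: "\<alpha> \<in> ?A" for \<alpha>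
      proof -
        have "\<alpha> (x \<ominus>\<^bsub>V\<^esub> p x) = \<alpha> x" using fun_cong[OF q_id[OF \<alpha>], of x] x(1) by (simp add: q_def)
        also have "\<dots> = \<ominus>\<^bsub>scalar_space K\<^esub> g \<alpha> a" using x(2)[OF aD[OF \<alpha>]] q_id[OF \<alpha>] by simp
        finally show ?thesis
          using ac[OF aD[OF gB[OF \<alpha>]] Ac[OF a]] scalar_space_uminus[OF vs_field[OF V(1)]] by simp
      qed
      then show ?thesis using p(3)[OF x(1)] by blast
    qed
    then obtain w where w: "\<And>a. a \<in> A \<Longrightarrow> w a \<in> B" "\<And>a \<alpha>. a \<in> A \<Longrightarrow> \<alpha> \<in> ?A \<Longrightarrow> \<alpha> (w a) = \<ominus>\<^bsub>K\<^esub> g \<alpha> a"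
      by metis
    \<comment> \<open>The values w a were chosen one at a time; linearity follows because a vector
      of \<open>B\<close> is determined by its values under the annihilator of
      \<open>A\<close>.\<close>
    have "linear_map K (V\<lparr>carrier := A\<rparr>) (V\<lparr>carrier := B\<rparr>) w"
    proof (rule linear_mapI[OF vs(1,2)])
      fix a b assume "a \<in> carrier (V\<lparr>carrier := A\<rparr>)" "b \<in> carrier (V\<lparr>carrier := A\<rparr>)"
      then have ab: "a \<in> A" "b \<in> A" "a \<oplus>\<^bsub>V\<^esub> b \<in> A" using A(4) by auto
      have "w (a \<oplus>\<^bsub>V\<^esub> b) = w a \<oplus>\<^bsub>V\<^esub> w b"
      proof (rule sep[OF w(1)[OF ab(3)] B(4)[OF w(1)[OF ab(1)] w(1)[OF ab(2)]]])
        fix \<alpha> assume \<alpha>: "\<alpha> \<in> ?A"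
        note G = dual_linear[OF V(1) aD[OF gB[OF \<alpha>]]]
        show "\<alpha> (w (a \<oplus>\<^bsub>V\<^esub> b)) = \<alpha> (w a \<oplus>\<^bsub>V\<^esub> w b)"
          using linear_map_add[OF dual_linear[OF V(1) aD[OF \<alpha>]] Bc[OF w(1)[OF ab(1)]] Bc[OF w(1)[OF ab(2)]]]
            w(2)[OF _ \<alpha>] ab linear_map_add[OF G Ac[OF ab(1)] Ac[OF ab(2)]]
            ac[OF aD[OF gB[OF \<alpha>]] Ac[OF ab(1)]] ac[OF aD[OF gB[OF \<alpha>]] Ac[OF ab(2)]] by (simp add: K.minus_add)
      qed
      then show "w (a \<oplus>\<^bsub>V\<lparr>carrier := A\<rparr>\<^esub> b) = w a \<oplus>\<^bsub>V\<lparr>carrier := B\<rparr>\<^esub> w b" by simp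
    next
      fix k a assume k: "k \<in> carrier K" and "a \<in> carrier (V\<lparr>carrier := A\<rparr>)"
      then have a: "a \<in> A" "k \<odot>\<^bsub>V\<^esub> a \<in> A" using A(5)[OF k] by auto
      have "w (k \<odot>\<^bsub>V\<^esub> a) = k \<odot>\<^bsub>V\<^esub> w a"
      proof (rule sep[OF w(1)[OF a(2)] B(5)[OF k w(1)[OF a(1)]]])
        fix \<alpha> assume \<alpha>: "\<alpha> \<in> ?A"
        note G = dual_linear[OF V(1) aD[OF gB[OF \<alpha>]]]
        show "\<alpha> (w (k \<odot>\<^bsub>V\<^esub> a)) = \<alpha> (k \<odot>\<^bsub>V\<^esub> w a)"
          using linear_map_smult[OF dual_linear[OF V(1) aD[OF \<alpha>]] k Bc[OF w(1)[OF a(1)]]]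
            w(2)[OF _ \<alpha>] a linear_map_smult[OF G k Ac[OF a(1)]] ac[OF aD[OF gB[OF \<alpha>]] Ac[OF a(1)]] k
          by (simp add: K.r_minus)
      qed
      then show "w (k \<odot>\<^bsub>V\<lparr>carrier := A\<rparr>\<^esub> a) = k \<odot>\<^bsub>V\<lparr>carrier := B\<rparr>\<^esub> w a" by simp
    qed (use w in simp)
    then have "linear_map K (V\<lparr>carrier := A\<rparr>) (V\<lparr>carrier := B\<rparr>) (\<lambda>a\<in>A. w a)"
      by (rule linear_map_cong) simp
    then have f: "(\<lambda>a\<in>A. w a) \<in> carrier H" by (simp add: H)
    have "L (\<lambda>a\<in>A. w a) = g"
    proof (rule H'_eqI[OF LH[OF f] g])
      fix \<alpha> v assume \<alpha>: "\<alpha> \<in> ?A" and v: "v \<in> carrier V"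
      note G = dual_linear[OF V(1) aD[OF gB[OF \<alpha>]]]
      have gc: "g \<alpha> x \<in> carrier K" if "x \<in> carrier V" for x using ac[OF aD[OF gB[OF \<alpha>]] that] .
      have "g \<alpha> v = g \<alpha> (v \<ominus>\<^bsub>V\<^esub> p v) \<oplus>\<^bsub>K\<^esub> g \<alpha> (p v)"
        using linear_map_add[OF G, of "v \<ominus>\<^bsub>V\<^esub> p v" "p v"] v pc[OF v] split[OF v] by simp
      also have "\<dots> = g \<alpha> (p v)"
        using annihilatorD(2)[OF gB[OF \<alpha>] p(3)[OF v]] gc[OF pc[OF v]] by simp
      finally show "L (\<lambda>a\<in>A. w a) \<alpha> v = g \<alpha> v"
        using Lv[OF \<alpha> v] w(2)[OF p(2)[OF v] \<alpha>] p(2)[OF v] gc[OF pc[OF v]] by simp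
    qed
    then show ?thesis using f by blast
  qed
  have graph: "(\<lambda>\<alpha>. \<alpha> \<oplus>\<^bsub>?D\<^esub> L f \<alpha>) ` ?A = annihilator K V ((\<lambda>a. a \<oplus>\<^bsub>V\<^esub> f a) ` A)" if f: "f \<in> carrier H" for f
  proof
    show "(\<lambda>\<alpha>. \<alpha> \<oplus>\<^bsub>?D\<^esub> L f \<alpha>) ` ?A \<subseteq> annihilator K V ((\<lambda>a. a \<oplus>\<^bsub>V\<^esub> f a) ` A)"
    proof
      fix \<phi> assume "\<phi> \<in> (\<lambda>\<alpha>. \<alpha> \<oplus>\<^bsub>?D\<^esub> L f \<alpha>) ` ?A"
      then obtain \<alpha> where \<alpha>: "\<alpha> \<in> ?A" "\<phi> = \<alpha> \<oplus>\<^bsub>?D\<^esub> L f \<alpha>" by blast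
      have \<phi>: "\<phi> \<in> carrier ?D" unfolding \<alpha>(2) by (rule D.M.add.m_closed[OF aD[OF \<alpha>(1)] LD[OF f \<alpha>(1)]])
      have "\<phi> (a \<oplus>\<^bsub>V\<^esub> f a) = \<zero>\<^bsub>K\<^esub>" if a: "a \<in> A" for a
      proof -
        have 1: "\<alpha> (a \<oplus>\<^bsub>V\<^esub> f a) = \<alpha> (f a)"
          using linear_map_add[OF dual_linear[OF V(1) aD[OF \<alpha>(1)]] Ac[OF a] fc[OF f a]]
            annihilatorD(2)[OF \<alpha>(1) a] ac[OF aD[OF \<alpha>(1)] fc[OF f a]] by simp
        have 2: "L f \<alpha> (a \<oplus>\<^bsub>V\<^esub> f a) = \<ominus>\<^bsub>K\<^esub> \<alpha> (f a)"
          using linear_map_add[OF dual_linear[OF V(1) LD[OF f \<alpha>(1)]] Ac[OF a] fc[OF f a]]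
            annihilatorD(2)[OF LB[OF f \<alpha>(1)] fB[OF f a]] Lv[OF \<alpha>(1) Ac[OF a], of f] p(4)[OF a]
            ac[OF aD[OF \<alpha>(1)] fc[OF f a]] by simp
        show ?thesis
          unfolding \<alpha>(2) using 1 2 Ac[OF a] fc[OF f a] ac[OF aD[OF \<alpha>(1)] fc[OF f a]] by (simp add: K.r_neg)
      qed
      then show "\<phi> \<in> annihilator K V ((\<lambda>a. a \<oplus>\<^bsub>V\<^esub> f a) ` A)" using \<phi> by (auto simp: annihilator_def)
    qed
  next
    show "annihilator K V ((\<lambda>a. a \<oplus>\<^bsub>V\<^esub> f a) ` A) \<subseteq> (\<lambda>\<alpha>. \<alpha> \<oplus>\<^bsub>?D\<^esub> L f \<alpha>) ` ?A"
    proof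
      fix \<phi> assume \<phi>: "\<phi> \<in> annihilator K V ((\<lambda>a. a \<oplus>\<^bsub>V\<^esub> f a) ` A)"
      note \<phi>D = aD[OF \<phi>] and l\<phi> = dual_linear[OF V(1) aD[OF \<phi>]]
      have \<phi>c: "\<phi> v \<in> carrier K" if "v \<in> carrier V" for v using ac[OF \<phi>D that] .
      let ?\<alpha> = "\<lambda>v\<in>carrier V. \<phi> (v \<ominus>\<^bsub>V\<^esub> p v)"
      have "?\<alpha> \<in> carrier ?D"
        by (intro dual_restrict linear_map_comp[OF linear_map_diff[OF linear_map_id[OF V(1)] p(1)] l\<phi>])
      then have \<alpha>: "?\<alpha> \<in> ?A"
        using Ac p(4) linear_map_zero[OF l\<phi>] by (auto simp: annihilator_def a_minus_def V.M.r_neg)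
      \<comment> \<open>The complementary part of \<phi> is \<phi> \<circ> p, and it equals L f of
        the first part: \<phi> vanishes at the point p v + f (p v) of the graph, so \<phi>(p v) = -
        \<phi>(f (p v)).\<close>
      have "\<phi> = ?\<alpha> \<oplus>\<^bsub>?D\<^esub> L f ?\<alpha>"
      proof (rule dual_eqI[OF V(1) \<phi>D D.M.add.m_closed[OF aD[OF \<alpha>] LD[OF f \<alpha>]]])
        fix v assume v: "v \<in> carrier V"
        let ?b = "f (p v)"
        have b: "?b \<in> B" "?b \<in> carrier V" using fB[OF f p(2)[OF v]] fc[OF f p(2)[OF v]] by auto
        have "L f ?\<alpha> v = \<ominus>\<^bsub>K\<^esub> \<phi> ?b"
          using Lv[OF \<alpha> v, of f] b p(5)[OF b(1)] split[OF b(2)] by simp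
        moreover have "\<phi> (p v) \<oplus>\<^bsub>K\<^esub> \<phi> ?b = \<zero>\<^bsub>K\<^esub>"
          using annihilatorD(2)[OF \<phi>, of "p v \<oplus>\<^bsub>V\<^esub> ?b"] p(2)[OF v] linear_map_add[OF l\<phi> pc[OF v] b(2)] by auto
        then have "\<ominus>\<^bsub>K\<^esub> \<phi> ?b = \<phi> (p v)"
          using \<phi>c[OF pc[OF v]] \<phi>c[OF b(2)] by (intro K.minus_equality)
        moreover have "\<phi> v = \<phi> (v \<ominus>\<^bsub>V\<^esub> p v) \<oplus>\<^bsub>K\<^esub> \<phi> (p v)"
          using linear_map_add[OF l\<phi>, of "v \<ominus>\<^bsub>V\<^esub> p v" "p v"] v pc[OF v] split[OF v] by simp
        ultimately show "\<phi> v = (?\<alpha> \<oplus>\<^bsub>?D\<^esub> L f ?\<alpha>) v" using v by simp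
      qed
      then show "\<phi> \<in> (\<lambda>\<alpha>. \<alpha> \<oplus>\<^bsub>?D\<^esub> L f \<alpha>) ` ?A" using \<alpha> by blast
    qed
  qed
  have "bij_betw L (carrier H) (carrier H')"
    using inj LH surj unfolding bij_betw_def by blast
  then show ?thesis using lin graph by blast
qed

section \<open>Annihilators as homeomorphisms of products of Grassmannians\<close>

text \<open>Generators pull back to generators, a functional pulling back to its transpose; hence
  linear maps are continuous for the Zariski topologies.\<close>

lemma poly_functions_pullback:
  assumes L: "linear_map K V W L" and q: "q \<in> poly_functions K W"
  shows "(\<lambda>v\<in>carrier V. q (L v)) \<in> poly_functions K V"
  using q
proof induction
  case (const c)
  have "(\<lambda>v\<in>carrier V. (\<lambda>w\<in>carrier W. c) (L v)) = (\<lambda>v\<in>carrier V. c)"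
    using linear_map_closed[OF L] by (auto intro!: restrict_ext)
  then show ?case using poly_functions.const[OF const, of V] by (simp only:)
next
  case (functional \<phi>)
  then show ?case
    using poly_functions.functional[OF transpose_closed[OF L functional]] by (simp only: transpose_map_def)
next
  case (add p q)
  have "(\<lambda>v\<in>carrier V. (\<lambda>w\<in>carrier W. p w \<oplus>\<^bsub>K\<^esub> q w) (L v))
      = (\<lambda>v\<in>carrier V. (\<lambda>v\<in>carrier V. p (L v)) v \<oplus>\<^bsub>K\<^esub> (\<lambda>v\<in>carrier V. q (L v)) v)"
    using linear_map_closed[OF L] by (auto intro!: restrict_ext)
  then show ?case using poly_functions.add[OF add.IH] by (simp only:)
next
  case (mult p q)
  have "(\<lambda>v\<in>carrier V. (\<lambda>w\<in>carrier W. p w \<otimes>\<^bsub>K\<^esub> q w) (L v))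
      = (\<lambda>v\<in>carrier V. (\<lambda>v\<in>carrier V. p (L v)) v \<otimes>\<^bsub>K\<^esub> (\<lambda>v\<in>carrier V. q (L v)) v)"
    using linear_map_closed[OF L] by (auto intro!: restrict_ext)
  then show ?case using poly_functions.mult[OF mult.IH] by (simp only:)
qed

lemma zariski_base_Union:
  assumes "field K"
  shows "\<Union>{{v \<in> carrier V. p v \<noteq> \<zero>\<^bsub>K\<^esub>} | p. p \<in> poly_functions K V} = carrier V"
proof -
  interpret K: field K by fact
  have "(\<lambda>v\<in>carrier V. \<one>\<^bsub>K\<^esub>) \<in> poly_functions K V" by (rule poly_functions.const) simp
  moreover have "{v \<in> carrier V. (\<lambda>v\<in>carrier V. \<one>\<^bsub>K\<^esub>) v \<noteq> \<zero>\<^bsub>K\<^esub>} = carrier V" by auto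
  ultimately have "carrier V \<in> {{v \<in> carrier V. p v \<noteq> \<zero>\<^bsub>K\<^esub>} | p. p \<in> poly_functions K V}"
    by (intro CollectI exI[of _ "\<lambda>v\<in>carrier V. \<one>\<^bsub>K\<^esub>"]) simp
  then show ?thesis by blast
qed

lemma topspace_zariski:
  assumes "field K"
  shows "topspace (zariski_topology K V) = carrier V"
  unfolding zariski_topology_def topology_generated_by_topspace by (rule zariski_base_Union[OF assms])

lemma zariski_continuous:
  assumes L: "linear_map K V W L"
  shows "continuous_map (zariski_topology K V) (zariski_topology K W) L"
proof -
  note K = vs_field[OF linear_map_vs(1)[OF L]]
  show ?thesis
    unfolding zariski_topology_def[of K W]
  proof (rule continuous_on_generated_topo)
    fix B assume "B \<in> {{w \<in> carrier W. p w \<noteq> \<zero>\<^bsub>K\<^esub>} | p. p \<in> poly_functions K W}"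
    then obtain p where p: "p \<in> poly_functions K W" "B = {w \<in> carrier W. p w \<noteq> \<zero>\<^bsub>K\<^esub>}" by blast
    have "L -` B \<inter> topspace (zariski_topology K V) = {v \<in> carrier V. (\<lambda>v\<in>carrier V. p (L v)) v \<noteq> \<zero>\<^bsub>K\<^esub>}"
      using linear_map_closed[OF L] by (auto simp: p(2) topspace_zariski[OF K])
    moreover have "openin (zariski_topology K V) {v \<in> carrier V. (\<lambda>v\<in>carrier V. p (L v)) v \<noteq> \<zero>\<^bsub>K\<^esub>}"
      unfolding zariski_topology_def[of K V]
      by (rule topology_generated_by_Basis) (use poly_functions_pullback[OF L p(1)] in blast)
    ultimately show "openin (zariski_topology K V) (L -` B \<inter> topspace (zariski_topology K V))"
      by (simp only:)
  qed (use linear_map_closed[OF L] in \<open>auto simp: topspace_zariski[OF K] zariski_base_Union[OF K]\<close>)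
qed

text \<open>Both directions are continuity, of L and of its inverse, which is linear too.\<close>

lemma zariski_open_iff:
  assumes L: "linear_map K V W L" and bij: "bij_betw L (carrier V) (carrier W)" and Z: "Z \<subseteq> carrier W"
  shows "openin (zariski_topology K V) {v \<in> carrier V. L v \<in> Z} \<longleftrightarrow> openin (zariski_topology K W) Z"
proof
  note K = vs_field[OF linear_map_vs(1)[OF L]]
  let ?M = "inv_into (carrier V) L"
  have M: "?M w \<in> carrier V" "L (?M w) = w" if "w \<in> carrier W" for w
    using bij that by (auto simp: bij_betw_def f_inv_into_f inv_into_into)
  show "openin (zariski_topology K V) {v \<in> carrier V. L v \<in> Z}" if "openin (zariski_topology K W) Z"
    using openin_continuous_map_preimage[OF zariski_continuous[OF L] that] by (simp add: topspace_zariski[OF K])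
  assume "openin (zariski_topology K V) {v \<in> carrier V. L v \<in> Z}"
  from openin_continuous_map_preimage[OF zariski_continuous[OF linear_map_inv_into[OF L bij]] this]
  have "openin (zariski_topology K W) {w \<in> carrier W. ?M w \<in> {v \<in> carrier V. L v \<in> Z}}"
    by (simp add: topspace_zariski[OF K])
  also have "{w \<in> carrier W. ?M w \<in> {v \<in> carrier V. L v \<in> Z}} = Z" using M Z by auto
  finally show "openin (zariski_topology K W) Z" .
qed

lemma dsum_map_bij:
  assumes "\<And>i. i \<in> I \<Longrightarrow> bij_betw (f i) (carrier (M i)) (carrier (N i))"
  shows "bij_betw (dsum_map I f) (carrier (dsum I M)) (carrier (dsum I N))"
proof (rule bij_betw_byWitness[where f' = "dsum_map I (\<lambda>i. inv_into (carrier (M i)) (f i))"])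
  have f: "f i x \<in> carrier (N i)" "inv_into (carrier (M i)) (f i) (f i x) = x"
    if "i \<in> I" "x \<in> carrier (M i)" for i x
    using assms[OF that(1)] that(2) by (auto simp: bij_betw_def)
  have g: "inv_into (carrier (M i)) (f i) y \<in> carrier (M i)" "f i (inv_into (carrier (M i)) (f i) y) = y"
    if "i \<in> I" "y \<in> carrier (N i)" for i y
    using assms[OF that(1)] that(2) by (auto simp: bij_betw_def f_inv_into_f inv_into_into)
  show "\<forall>x\<in>carrier (dsum I M). dsum_map I (\<lambda>i. inv_into (carrier (M i)) (f i)) (dsum_map I f x) = x"
    using f by (auto simp: dsum_map_def PiE_iff fun_eq_iff extensional_def)
  show "\<forall>y\<in>carrier (dsum I N). dsum_map I f (dsum_map I (\<lambda>i. inv_into (carrier (M i)) (f i)) y) = y"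
    using g by (auto simp: dsum_map_def PiE_iff fun_eq_iff extensional_def)
  show "dsum_map I f ` carrier (dsum I M) \<subseteq> carrier (dsum I N)"
    using f by (auto simp: dsum_map_def PiE_iff)
  show "dsum_map I (\<lambda>i. inv_into (carrier (M i)) (f i)) ` carrier (dsum I N) \<subseteq> carrier (dsum I M)"
    using g by (auto simp: dsum_map_def PiE_iff)
qed

section \<open>Annihilators of families of subspaces\<close>

locale space_family =
  fixes K :: "('k, 'r) ring_scheme" and I :: "'i set" and V :: "'i \<Rightarrow> ('k, 'v, 'x) module_scheme"
  assumes K: "field K"
    and V: "\<And>i. i \<in> I \<Longrightarrow> vectorspace K (V i)" and fin: "\<And>i. i \<in> I \<Longrightarrow> vectorspace.fin_dim K (V i)"
begin

abbreviation "D i \<equiv> dual_space K (V i)"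

definition annihilators where "annihilators N = (\<lambda>i\<in>I. annihilator K (V i) (N i))"

lemma annihilator_subspace': "i \<in> I \<Longrightarrow> VectorSpace.subspace K N (V i) \<Longrightarrow>
    VectorSpace.subspace K (annihilator K (V i) N) (D i)"
  by (rule annihilator_subspace[OF V subspaceD(2)])

lemma preannihilator_subspace': "i \<in> I \<Longrightarrow> VectorSpace.subspace K N (D i) \<Longrightarrow>
    VectorSpace.subspace K (preannihilator K (V i) N) (V i)"
  by (rule preannihilator_subspace[OF V subspaceD(2)])

lemma annihilators_inj: "inj_on annihilators (\<Pi>\<^sub>E i\<in>I. {N. VectorSpace.subspace K N (V i)})"
proof (rule inj_onI)
  fix N N' assume N: "N \<in> (\<Pi>\<^sub>E i\<in>I. {N. VectorSpace.subspace K N (V i)})"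
    and N': "N' \<in> (\<Pi>\<^sub>E i\<in>I. {N. VectorSpace.subspace K N (V i)})" and eq: "annihilators N = annihilators N'"
  have "N i = N' i" if i: "i \<in> I" for i
  proof -
    have "annihilator K (V i) (N i) = annihilator K (V i) (N' i)"
      using fun_cong[OF eq, of i] i by (simp add: annihilators_def)
    then show ?thesis
      using preannihilator_annihilator[OF V[OF i] fin[OF i], of "N i"]
        preannihilator_annihilator[OF V[OF i] fin[OF i], of "N' i"] N N' i by auto
  qed
  then show "N = N'" using N N' by (auto simp: PiE_iff intro: extensionalityI)
qed

text \<open>Complementary dimensions come from \<open>dim_annihilator\<close>; surjectivity uses the
  family of preannihilators as preimage.\<close>

lemma annihilators_grassmannian:
  assumes d: "\<And>i. i \<in> I \<Longrightarrow> d i + d' i = vectorspace.dim K (V i)"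
  shows "annihilators ` (\<Pi>\<^sub>E i\<in>I. grassmannian K (V i) (d i)) = (\<Pi>\<^sub>E i\<in>I. grassmannian K (D i) (d' i))"
proof
  have "annihilator K (V i) N \<in> grassmannian K (D i) (d' i)" if "i \<in> I" "N \<in> grassmannian K (V i) (d i)" for i N
    using dim_annihilator[OF V fin, of i N] d[of i] annihilator_subspace' that by (auto simp: grassmannian_def)
  then show "annihilators ` (\<Pi>\<^sub>E i\<in>I. grassmannian K (V i) (d i)) \<subseteq> (\<Pi>\<^sub>E i\<in>I. grassmannian K (D i) (d' i))"
    by (auto simp: annihilators_def PiE_iff)
  show "(\<Pi>\<^sub>E i\<in>I. grassmannian K (D i) (d' i)) \<subseteq> annihilators ` (\<Pi>\<^sub>E i\<in>I. grassmannian K (V i) (d i))"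
  proof
    fix A assume A: "A \<in> (\<Pi>\<^sub>E i\<in>I. grassmannian K (D i) (d' i))"
    let ?N = "\<lambda>i\<in>I. preannihilator K (V i) (A i)"
    have Ai: "VectorSpace.subspace K (A i) (D i)" "vectorspace.dim K ((D i)\<lparr>carrier := A i\<rparr>) = d' i" if "i \<in> I" for i
      using A that by (auto simp: grassmannian_def PiE_iff)
    have an: "annihilator K (V i) (preannihilator K (V i) (A i)) = A i" if "i \<in> I" for i
      by (rule annihilator_preannihilator[OF V fin Ai(1)]) (rule that)+
    have "preannihilator K (V i) (A i) \<in> grassmannian K (V i) (d i)" if i: "i \<in> I" for i
      using dim_annihilator[OF V[OF i] fin[OF i] preannihilator_subspace'[OF i Ai(1)[OF i]]]
        d[OF i] Ai(2)[OF i] an[OF i] preannihilator_subspace'[OF i Ai(1)[OF i]] by (simp add: grassmannian_def)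
    then have N: "?N \<in> (\<Pi>\<^sub>E i\<in>I. grassmannian K (V i) (d i))" by auto
    have eq: "A = annihilators ?N"
      using an A by (auto simp: annihilators_def PiE_iff fun_eq_iff extensional_def)
    show "A \<in> annihilators ` (\<Pi>\<^sub>E i\<in>I. grassmannian K (V i) (d i))"
      by (subst eq) (rule imageI[OF N])
  qed
qed

lemma grassmannian_subspaces:
  "(\<Pi>\<^sub>E i\<in>I. grassmannian K (V i) (d i)) \<subseteq> (\<Pi>\<^sub>E i\<in>I. {N. VectorSpace.subspace K N (V i)})"
  by (auto simp: grassmannian_def PiE_iff)

text \<open>The linear isomorphisms of \<open>dual_chart_exists\<close> are assembled into one
  between the chart spaces. It turns the trace of \<open>Z\<close> on one chart into the trace of
  its image on the other, and linear isomorphisms preserve Zariski openness.\<close>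

lemma chart_open_iff:
  assumes c: "\<And>i. i \<in> I \<Longrightarrow> complementary K (V i) (A i) (B i)"
    and A': "\<And>i. i \<in> I \<Longrightarrow> A' i = annihilator K (V i) (A i)"
    and B': "\<And>i. i \<in> I \<Longrightarrow> B' i = annihilator K (V i) (B i)"
    and Z: "Z \<subseteq> (\<Pi>\<^sub>E i\<in>I. {N. VectorSpace.subspace K N (V i)})"
  shows "openin (zariski_topology K (chart_space K I V A B))
           {f \<in> carrier (chart_space K I V A B). graph_chart I V A f \<in> Z} \<longleftrightarrow>
         openin (zariski_topology K (chart_space K I D A' B'))
           {g \<in> carrier (chart_space K I D A' B'). graph_chart I D A' g \<in> annihilators ` Z}"
proof -
  let ?H = "\<lambda>i. hom_space K ((V i)\<lparr>carrier := A i\<rparr>) ((V i)\<lparr>carrier := B i\<rparr>)"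
  let ?H' = "\<lambda>i. hom_space K ((D i)\<lparr>carrier := A' i\<rparr>) ((D i)\<lparr>carrier := B' i\<rparr>)"
  define good where "good i L \<longleftrightarrow> linear_map K (?H i) (?H' i) L \<and> bij_betw L (carrier (?H i)) (carrier (?H' i)) \<and>
    (\<forall>f\<in>carrier (?H i). (\<lambda>\<alpha>. \<alpha> \<oplus>\<^bsub>D i\<^esub> L f \<alpha>) ` A' i = annihilator K (V i) ((\<lambda>a. a \<oplus>\<^bsub>V i\<^esub> f a) ` A i))"
    for i L
  have "\<forall>i\<in>I. \<exists>L. good i L"
  proof
    fix i assume i: "i \<in> I"
    show "\<exists>L. good i L"
      unfolding good_def A'[OF i] B'[OF i] by (rule dual_chart_exists[OF V[OF i] fin[OF i] c[OF i]])
  qed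
  from bchoice[OF this] obtain L where good: "\<forall>i\<in>I. good i (L i)" by blast
  have L: "linear_map K (?H i) (?H' i) (L i)"
    and bij: "bij_betw (L i) (carrier (?H i)) (carrier (?H' i))"
    and graph: "\<And>f. f \<in> carrier (?H i) \<Longrightarrow>
       (\<lambda>\<alpha>. \<alpha> \<oplus>\<^bsub>D i\<^esub> L i f \<alpha>) ` A' i = annihilator K (V i) ((\<lambda>a. a \<oplus>\<^bsub>V i\<^esub> f a) ` A i)"
    if "i \<in> I" for i
    using bspec[OF good that] unfolding good_def by blast+
  let ?C = "chart_space K I V A B" and ?C' = "chart_space K I D A' B'"
  have lin: "linear_map K ?C ?C' (dsum_map I L)"
    unfolding chart_space_def by (rule dsum_map_linear[OF K L])
  have bij': "bij_betw (dsum_map I L) (carrier ?C) (carrier ?C')"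
    unfolding chart_space_def by (rule dsum_map_bij[OF bij])
  \<comment> \<open>Graphs are subspaces: this puts them in the domain on which
    \<open>annihilators\<close> is injective, so that membership in the image of \<open>Z\<close>
    can be pulled back to membership in \<open>Z\<close>.\<close>
  have sub: "graph_chart I V A f \<in> (\<Pi>\<^sub>E i\<in>I. {N. VectorSpace.subspace K N (V i)})" if f: "f \<in> carrier ?C" for f
  proof -
    have "VectorSpace.subspace K ((\<lambda>a. a \<oplus>\<^bsub>V i\<^esub> f i a) ` A i) (V i)" if i: "i \<in> I" for i
    proof -
      note cD = complementaryD[OF c[OF i]]
      note vs = subspace_vs[OF cD(1)] subspace_vs[OF cD(2)]
      have "f i \<in> carrier (?H i)" using f i by (auto simp: chart_space_def)
      then have "linear_map K ((V i)\<lparr>carrier := A i\<rparr>) (V i) (f i)"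
        by (intro linear_map_from_subspace[OF _ cD(2)]) (simp add: carrier_hom_space[OF vs])
      then have "linear_map K ((V i)\<lparr>carrier := A i\<rparr>) (V i) (\<lambda>a. a \<oplus>\<^bsub>V i\<^esub> f i a)"
        by (intro linear_map_sum linear_map_restrict[OF linear_map_id[OF V[OF i]] cD(1)])
      from image_subspace[OF this carrier_subspace[OF vs(1)]] show ?thesis by simp
    qed
    then show ?thesis by (auto simp: graph_chart_def)
  qed
  have gr: "graph_chart I D A' (dsum_map I L f) = annihilators (graph_chart I V A f)" if f: "f \<in> carrier ?C" for f
    unfolding graph_chart_def annihilators_def
  proof (rule restrict_ext)
    fix i assume i: "i \<in> I"
    then have "f i \<in> carrier (?H i)" using f by (auto simp: chart_space_def)
    from graph[OF i this]
    show "(\<lambda>\<alpha>. \<alpha> \<oplus>\<^bsub>D i\<^esub> dsum_map I L f i \<alpha>) ` A' i = annihilator K (V i) ((\<lambda>i\<in>I. (\<lambda>a. a \<oplus>\<^bsub>V i\<^esub> f i a) ` A i) i)"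
      unfolding dsum_map_def restrict_apply'[OF i] .
  qed
  let ?Z' = "{g \<in> carrier ?C'. graph_chart I D A' g \<in> annihilators ` Z}"
  have "{f \<in> carrier ?C. dsum_map I L f \<in> ?Z'} = {f \<in> carrier ?C. graph_chart I V A f \<in> Z}"
  proof -
    have "dsum_map I L f \<in> ?Z' \<longleftrightarrow> graph_chart I V A f \<in> Z" if f: "f \<in> carrier ?C" for f
      using gr[OF f] linear_map_closed[OF lin f] inj_on_image_mem_iff[OF annihilators_inj sub[OF f] Z] by simp
    then show ?thesis by blast
  qed
  then show ?thesis using zariski_open_iff[OF lin bij', of ?Z'] by simp
qed

text \<open>Openness quantifies over all charts, so charts have to be matched in both directions:
  annihilators send complementary pairs to complementary pairs, and every complementary pair in the
  duals arises in this way.\<close>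

lemma grassmannian_open_iff:
  assumes d: "\<And>i. i \<in> I \<Longrightarrow> d i + d' i = vectorspace.dim K (V i)"
    and Z: "Z \<subseteq> (\<Pi>\<^sub>E i\<in>I. grassmannian K (V i) (d i))"
  shows "grassmannian_open K I V d Z \<longleftrightarrow> grassmannian_open K I D d' (annihilators ` Z)"
proof -
  note Zs = subset_trans[OF Z grassmannian_subspaces]
  have ag: "annihilators ` (\<Pi>\<^sub>E i\<in>I. grassmannian K (V i) (d i)) = (\<Pi>\<^sub>E i\<in>I. grassmannian K (D i) (d' i))"
    using d by (rule annihilators_grassmannian)
  have Z': "annihilators ` Z \<subseteq> (\<Pi>\<^sub>E i\<in>I. grassmannian K (D i) (d' i))"
    unfolding ag[symmetric] by (rule image_mono[OF Z])
  have gr: "annihilator K (V i) N \<in> grassmannian K (D i) (d' i) \<longleftrightarrow> N \<in> grassmannian K (V i) (d i)"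
    if "i \<in> I" "VectorSpace.subspace K N (V i)" for i N
    using dim_annihilator[OF V fin, of i N] d[of i] annihilator_subspace' that by (auto simp: grassmannian_def)
  show ?thesis
  proof
    assume open_Z: "grassmannian_open K I V d Z"
    show "grassmannian_open K I D d' (annihilators ` Z)"
      unfolding grassmannian_open_def
    proof (intro conjI allI impI Z')
      fix A' B' assume AB': "\<forall>i\<in>I. A' i \<in> grassmannian K (D i) (d' i) \<and> complementary K (D i) (A' i) (B' i)"
      \<comment> \<open>A given chart on the dual side is recognised as the dual of the chart formed
        by the preannihilators.\<close>
      define A where "A i = preannihilator K (V i) (A' i)" for i
      define B where "B i = preannihilator K (V i) (B' i)" for i
      have s: "VectorSpace.subspace K (A' i) (D i)" "VectorSpace.subspace K (B' i) (D i)" if "i \<in> I" for i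
        using AB' that complementaryD(1,2)[of K "D i" "A' i" "B' i"] by auto
      have A: "VectorSpace.subspace K (A i) (V i)" "A' i = annihilator K (V i) (A i)" if "i \<in> I" for i
        unfolding A_def using preannihilator_subspace'[OF that s(1)] annihilator_preannihilator[OF V fin s(1)] that by auto
      have B: "VectorSpace.subspace K (B i) (V i)" "B' i = annihilator K (V i) (B i)" if "i \<in> I" for i
        unfolding B_def using preannihilator_subspace'[OF that s(2)] annihilator_preannihilator[OF V fin s(2)] that by auto
      have c: "complementary K (V i) (A i) (B i)" if i: "i \<in> I" for i
      proof -
        have "complementary K (D i) (A' i) (B' i)" using AB' i by blast
        then show ?thesis
          unfolding A(2)[OF i] B(2)[OF i]
          by (rule complementary_of_annihilators[OF V[OF i] fin[OF i] A(1)[OF i] B(1)[OF i]])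
      qed
      have "\<forall>i\<in>I. A i \<in> grassmannian K (V i) (d i) \<and> complementary K (V i) (A i) (B i)"
        using c AB' gr A by auto
      then show "openin (zariski_topology K (chart_space K I D A' B'))
          {f \<in> carrier (chart_space K I D A' B'). graph_chart I D A' f \<in> annihilators ` Z}"
        using open_Z chart_open_iff[OF c A(2) B(2) Zs] unfolding grassmannian_open_def by blast
    qed
  next
    assume open_Z': "grassmannian_open K I D d' (annihilators ` Z)"
    show "grassmannian_open K I V d Z"
      unfolding grassmannian_open_def
    proof (intro conjI allI impI Z)
      fix A B assume AB: "\<forall>i\<in>I. A i \<in> grassmannian K (V i) (d i) \<and> complementary K (V i) (A i) (B i)"
      define A' where "A' i = annihilator K (V i) (A i)" for i
      define B' where "B' i = annihilator K (V i) (B i)" for i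
      have "\<forall>i\<in>I. A' i \<in> grassmannian K (D i) (d' i) \<and> complementary K (D i) (A' i) (B' i)"
        unfolding A'_def B'_def using AB gr complementary_annihilator complementaryD(1) by blast
      then show "openin (zariski_topology K (chart_space K I V A B))
          {f \<in> carrier (chart_space K I V A B). graph_chart I V A f \<in> Z}"
        using open_Z' chart_open_iff[of A B A' B', OF _ A'_def B'_def Zs] AB unfolding grassmannian_open_def by blast
    qed
  qed
qed

text \<open>The map and its inverse preserve openness by \<open>grassmannian_open_iff\<close>; it
  remains to match the underlying spaces of the two topologies.\<close>

lemma annihilators_homeomorphism:
  assumes d: "\<And>i. i \<in> I \<Longrightarrow> d i + d' i = vectorspace.dim K (V i)"
  shows "homeomorphic_map (grassmannian_topology K I V d) (grassmannian_topology K I D d') annihilators"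
proof -
  let ?G = "\<Pi>\<^sub>E i\<in>I. grassmannian K (V i) (d i)" and ?G' = "\<Pi>\<^sub>E i\<in>I. grassmannian K (D i) (d' i)"
  let ?T = "grassmannian_topology K I V d" and ?T' = "grassmannian_topology K I D d'"
  have ag: "annihilators ` (\<Pi>\<^sub>E i\<in>I. grassmannian K (V i) (d i)) = (\<Pi>\<^sub>E i\<in>I. grassmannian K (D i) (d' i))"
    using d by (rule annihilators_grassmannian)
  have inj: "inj_on annihilators ?G" by (rule inj_on_subset[OF annihilators_inj grassmannian_subspaces])
  have sub: "S \<subseteq> ?G" if "openin ?T S" for S
    using that by (simp add: openin_grassmannian_topology grassmannian_open_def)
  have sub': "S \<subseteq> ?G'" if "openin ?T' S" for S
    using that by (simp add: openin_grassmannian_topology grassmannian_open_def)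
  have iff: "openin ?T S \<longleftrightarrow> openin ?T' (annihilators ` S)" if "S \<subseteq> ?G" for S
    unfolding openin_grassmannian_topology using d that by (rule grassmannian_open_iff)
  have pre: "openin ?T {N \<in> ?G. annihilators N \<in> S}" "annihilators ` {N \<in> ?G. annihilators N \<in> S} = S"
    if S: "openin ?T' S" for S
  proof -
    show im: "annihilators ` {N \<in> ?G. annihilators N \<in> S} = S"
    proof (intro equalityI subsetI)
      fix A assume A: "A \<in> S"
      then have "A \<in> annihilators ` ?G" unfolding ag using sub'[OF S] by (rule rev_subsetD)
      then obtain N where "N \<in> ?G" "A = annihilators N" by (elim imageE)
      then show "A \<in> annihilators ` {N \<in> ?G. annihilators N \<in> S}"
        using A by (intro image_eqI[of _ _ N]) simp_all
    qed (elim imageE, simp)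
    show "openin ?T {N \<in> ?G. annihilators N \<in> S}" using iff[of "{N \<in> ?G. annihilators N \<in> S}"] im S by auto
  qed
  \<comment> \<open>The underlying space is itself open, hence contained in the product of
    Grassmannians, where \<open>annihilators\<close> is injective.\<close>
  have ts: "topspace ?T \<subseteq> ?G" by (rule sub) simp
  have top: "annihilators ` topspace ?T = topspace ?T'"
  proof
    show "annihilators ` topspace ?T \<subseteq> topspace ?T'"
      by (rule openin_subset) (use iff[OF ts] in simp)
    have "{N \<in> ?G. annihilators N \<in> topspace ?T'} \<subseteq> topspace ?T"
      by (rule openin_subset[OF pre(1)]) simp
    from image_mono[OF this, of annihilators] show "topspace ?T' \<subseteq> annihilators ` topspace ?T"
      unfolding pre(2)[OF openin_topspace] .
  qed
  show ?thesis
  proof (rule bijective_open_imp_homeomorphic_map)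
    show "continuous_map ?T ?T' annihilators"
      unfolding continuous_map_alt
    proof (intro conjI allI impI)
      fix S assume S: "openin ?T' S"
      have "annihilators -` S \<inter> topspace ?T = {N \<in> ?G. annihilators N \<in> S}"
        using openin_subset[OF pre(1)[OF S]] ts by auto
      then show "openin ?T (annihilators -` S \<inter> topspace ?T)" using pre(1)[OF S] by simp
    qed (use top in auto)
    show "open_map ?T ?T' annihilators"
      unfolding open_map_def
    proof (intro allI impI)
      fix S assume S: "openin ?T S"
      then show "openin ?T' (annihilators ` S)" using iff[OF sub[OF S]] by simp
    qed
    show "inj_on annihilators (topspace ?T)" by (rule inj_on_subset[OF inj ts])
  qed (rule top)
qed

lemma grassmannian_dim_le: "N \<in> grassmannian K (V i) n \<Longrightarrow> i \<in> I \<Longrightarrow> n \<le> vectorspace.dim K (V i)"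
  using dim_annihilator[OF V fin, of i N] by (auto simp: grassmannian_def)

text \<open>For one fixed choice of dimensions: a homeomorphism commutes with closures and preserves
  open sets, so a dense open set of good families corresponds to one on the dual side.\<close>

lemma general_dimension_iff:
  assumes d: "\<And>i. i \<in> I \<Longrightarrow> d i + d' i = vectorspace.dim K (V i)"
    and PQ: "\<And>N. N \<in> (\<Pi>\<^sub>E i\<in>I. {N. VectorSpace.subspace K N (V i)}) \<Longrightarrow> P N \<longleftrightarrow> Q (annihilators N)"
  shows "(\<exists>\<Omega>. openin (grassmannian_topology K I V d) \<Omega> \<and>
             Abstract_Topology.closure_of (grassmannian_topology K I V d) \<Omega> = (\<Pi>\<^sub>E i\<in>I. grassmannian K (V i) (d i)) \<and>
             (\<forall>N\<in>\<Omega>. P N)) \<longleftrightarrow>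
         (\<exists>\<Omega>. openin (grassmannian_topology K I D d') \<Omega> \<and>
             Abstract_Topology.closure_of (grassmannian_topology K I D d') \<Omega> = (\<Pi>\<^sub>E i\<in>I. grassmannian K (D i) (d' i)) \<and>
             (\<forall>N\<in>\<Omega>. Q N))"
    (is "(\<exists>\<Omega>. ?L \<Omega>) \<longleftrightarrow> (\<exists>\<Omega>. ?R \<Omega>)")
proof -
  let ?G = "\<Pi>\<^sub>E i\<in>I. grassmannian K (V i) (d i)" and ?G' = "\<Pi>\<^sub>E i\<in>I. grassmannian K (D i) (d' i)"
  let ?T = "grassmannian_topology K I V d" and ?T' = "grassmannian_topology K I D d'"
  have ag: "annihilators ` (\<Pi>\<^sub>E i\<in>I. grassmannian K (V i) (d i)) = (\<Pi>\<^sub>E i\<in>I. grassmannian K (D i) (d' i))"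
    using d by (rule annihilators_grassmannian)
  have hom: "homeomorphic_map (grassmannian_topology K I V d) (grassmannian_topology K I D d') annihilators"
    using d by (rule annihilators_homeomorphism)
  have inj: "inj_on annihilators ?G" by (rule inj_on_subset[OF annihilators_inj grassmannian_subspaces])
  have sub: "S \<subseteq> ?G" if "openin ?T S" for S
    using that by (simp add: openin_grassmannian_topology grassmannian_open_def)
  have key: "?L \<Omega> \<longleftrightarrow> ?R (annihilators ` \<Omega>)" if \<Omega>: "\<Omega> \<subseteq> topspace ?T" for \<Omega>
  proof -
    have ts: "topspace ?T \<subseteq> ?G" by (rule sub) simp
    have "openin ?T \<Omega> \<longleftrightarrow> openin ?T' (annihilators ` \<Omega>)"
      using homeomorphic_map_openness_eq[OF hom, of \<Omega>] \<Omega> by simp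
    moreover have "Abstract_Topology.closure_of ?T' (annihilators ` \<Omega>) = annihilators ` (Abstract_Topology.closure_of ?T \<Omega>)"
      by (rule homeomorphic_map_closure_of[OF hom \<Omega>])
    \<comment> \<open>Injectivity on the product of Grassmannians, which contains the closure,
      allows density to be compared after taking images.\<close>
    moreover have "Abstract_Topology.closure_of ?T \<Omega> = ?G \<longleftrightarrow>
        annihilators ` (Abstract_Topology.closure_of ?T \<Omega>) = annihilators ` ?G"
      using inj_on_image_eq_iff[OF inj subset_trans[OF closure_of_subset_topspace ts] subset_refl, of \<Omega>] by simp
    moreover have "P N \<longleftrightarrow> Q (annihilators N)" if "N \<in> \<Omega>" for N
      by (rule PQ[OF subsetD[OF grassmannian_subspaces subsetD[OF ts subsetD[OF \<Omega> that]]]])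
    then have "(\<forall>N\<in>\<Omega>. P N) \<longleftrightarrow> (\<forall>N\<in>annihilators ` \<Omega>. Q N)" by simp
    ultimately show ?thesis unfolding ag[symmetric] by simp
  qed
  show ?thesis
  proof
    assume "\<exists>\<Omega>. ?L \<Omega>"
    then obtain \<Omega> where L: "?L \<Omega>" by (elim exE)
    from iffD1[OF key[OF openin_subset[OF conjunct1[OF L]]] L] show "\<exists>\<Omega>. ?R \<Omega>" by (rule exI)
  next
    assume "\<exists>\<Omega>. ?R \<Omega>"
    then obtain \<Omega>' where R: "?R \<Omega>'" by (elim exE)
    have "\<Omega>' \<subseteq> annihilators ` topspace ?T"
      using openin_subset[OF conjunct1[OF R]] unfolding homeomorphic_imp_surjective_map[OF hom] .
    then obtain \<Omega> where \<Omega>: "\<Omega> \<subseteq> topspace ?T" "\<Omega>' = annihilators ` \<Omega>" by (elim subset_imageE)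
    from iffD2[OF key[OF \<Omega>(1)] R[unfolded \<Omega>(2)]] show "\<exists>\<Omega>. ?L \<Omega>" by (rule exI)
  qed
qed

text \<open>All dimension vectors are covered by d \<mapsto> dim V - d as long as d does not exceed
  the dimensions. Otherwise the product of Grassmannians is empty, and the empty set is open and
  dense in it.\<close>

lemma general_subspaces_iff:
  assumes PQ: "\<And>N. N \<in> (\<Pi>\<^sub>E i\<in>I. {N. VectorSpace.subspace K N (V i)}) \<Longrightarrow> P N \<longleftrightarrow> Q (annihilators N)"
  shows "general_subspaces K I V P \<longleftrightarrow> general_subspaces K I D Q"
proof
  let ?n = "\<lambda>i. vectorspace.dim K (V i)"
  assume P: "general_subspaces K I V P"
  show "general_subspaces K I D Q"
    unfolding general_subspaces_def
  proof
    fix d' :: "'i \<Rightarrow> nat"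
    show "\<exists>\<Omega>. openin (grassmannian_topology K I D d') \<Omega> \<and>
        Abstract_Topology.closure_of (grassmannian_topology K I D d') \<Omega> = (\<Pi>\<^sub>E i\<in>I. grassmannian K (D i) (d' i)) \<and>
        (\<forall>N\<in>\<Omega>. Q N)"
    proof (cases "\<forall>i\<in>I. d' i \<le> ?n i")
      case True
      then have "\<And>i. i \<in> I \<Longrightarrow> (?n i - d' i) + d' i = ?n i" by simp
      from iffD1[OF general_dimension_iff[where d="\<lambda>i. ?n i - d' i" and d'=d' and P=P and Q=Q, OF this PQ]
          spec[OF P[unfolded general_subspaces_def]]]
      show ?thesis .
    next
      case False
      \<comment> \<open>The dual family satisfies the same assumptions, so the bound on dimensions
        of subspaces applies to it; its dimensions agree with those of \<open>V\<close>.\<close>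
      interpret dual: space_family K I D
        by (rule space_family.intro) (simp_all add: K dual_space_vs V dual_fin_dim(1)[OF V fin])
      from False obtain i where "i \<in> I" "\<not> d' i \<le> vectorspace.dim K (D i)"
        using dual_fin_dim(2)[OF V fin] by auto
      then have "(\<Pi>\<^sub>E i\<in>I. grassmannian K (D i) (d' i)) = {}"
        using dual.grassmannian_dim_le by (auto simp: PiE_eq_empty_iff)
      then show ?thesis by (intro exI[of _ "{}"]) simp
    qed
  qed
next
  let ?n = "\<lambda>i. vectorspace.dim K (V i)"
  assume Q: "general_subspaces K I D Q"
  show "general_subspaces K I V P"
    unfolding general_subspaces_def
  proof
    fix d :: "'i \<Rightarrow> nat"
    show "\<exists>\<Omega>. openin (grassmannian_topology K I V d) \<Omega> \<and>
        Abstract_Topology.closure_of (grassmannian_topology K I V d) \<Omega> = (\<Pi>\<^sub>E i\<in>I. grassmannian K (V i) (d i)) \<and>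
        (\<forall>N\<in>\<Omega>. P N)"
    proof (cases "\<forall>i\<in>I. d i \<le> ?n i")
      case True
      then have "\<And>i. i \<in> I \<Longrightarrow> d i + (?n i - d i) = ?n i" by simp
      from iffD2[OF general_dimension_iff[where d=d and d'="\<lambda>i. ?n i - d i" and P=P and Q=Q, OF this PQ]
          spec[OF Q[unfolded general_subspaces_def]]]
      show ?thesis .
    next
      case False
      then have "(\<Pi>\<^sub>E i\<in>I. grassmannian K (V i) (d i)) = {}"
        using grassmannian_dim_le by (auto simp: PiE_eq_empty_iff)
      then show ?thesis by (intro exI[of _ "{}"]) simp
    qed
  qed
qed

end

theorem proposition2p11:
  fixes K :: "('k, 'r) ring_scheme"
    and l :: nat
    and V :: "nat \<Rightarrow> ('k, 'v) module"
    and W :: "nat \<Rightarrow> ('k, 'w) module"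
    and U :: "('k, 'u) module"
    and T :: "(nat \<Rightarrow> ('v \<times> 'w \<Rightarrow> 'k) set) \<Rightarrow> 'u"
  assumes "algebraically_closed K"
    and "\<And>i. i \<in> {1..l} \<Longrightarrow> vectorspace K (V i) \<and> vectorspace.fin_dim K (V i)"
    and "\<And>i. i \<in> {1..l} \<Longrightarrow> vectorspace K (W i) \<and> vectorspace.fin_dim K (W i)"
    and "vectorspace K U" and "vectorspace.fin_dim K U"
    and "linear_map K (tensor_sum K {1..l} V W) U T"
  shows "(left_omnipresent_from K {1..l} V W U T \<longleftrightarrow>
            left_omnipresent_to K {1..l} (dual_space K U)
              (\<lambda>i. dual_space K (V i)) (\<lambda>i. dual_space K (W i))
              (dual_transformation K {1..l} V W T))
       \<and> (left_general_from K {1..l} V W U T \<longleftrightarrow>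
            left_general_to K {1..l} (dual_space K U)
              (\<lambda>i. dual_space K (V i)) (\<lambda>i. dual_space K (W i))
              (dual_transformation K {1..l} V W T))"
proof -
  let ?I = "{1..l}" and ?DV = "\<lambda>i. dual_space K (V i)"
  let ?P = "restriction_maximal_rank K ?I V W U T"
  let ?Q = "projection_maximal_rank K ?I (dual_space K U) ?DV (\<lambda>i. dual_space K (W i))
    (dual_transformation K ?I V W T)"
  have K: "field K" by (rule vs_field[OF assms(4)])
  interpret space_family K ?I V by (rule space_family.intro) (use K assms(2) in auto)
  \<comment> \<open>The family A is an arbitrary one agreeing with the annihilators on the index
    set: the omnipresent property quantifies over unrestricted families, whereas the general one
    uses the extensional \<open>annihilators N\<close>.\<close>
  have PQ: "?P N \<longleftrightarrow> ?Q A" if "\<And>i. i \<in> ?I \<Longrightarrow> VectorSpace.subspace K (N i) (V i)"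
    "\<And>i. i \<in> ?I \<Longrightarrow> A i = annihilator K (V i) (N i)" for N A
    using assms(2,3,5,6) that by (intro restriction_iff_projection_maximal_rank K) auto
  have "left_omnipresent_from K ?I V W U T \<longleftrightarrow>
      left_omnipresent_to K ?I (dual_space K U) ?DV (\<lambda>i. dual_space K (W i)) (dual_transformation K ?I V W T)"
    unfolding left_omnipresent_from_def left_omnipresent_to_def
  proof (intro iffI allI impI)
    fix A assume P: "\<forall>N. (\<forall>i\<in>?I. VectorSpace.subspace K (N i) (V i)) \<longrightarrow> ?P N"
      and A: "\<forall>i\<in>?I. VectorSpace.subspace K (A i) (?DV i)"
    \<comment> \<open>Every family of subspaces of the duals consists of the annihilators of its
      preannihilators, so the assumption is applied to the latter.\<close>
    let ?N = "\<lambda>i. preannihilator K (V i) (A i)"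
    have N: "VectorSpace.subspace K (?N i) (V i)" if "i \<in> ?I" for i
      by (rule preannihilator_subspace'[OF that bspec[OF A that]])
    have AN: "A i = annihilator K (V i) (?N i)" if "i \<in> ?I" for i
      by (rule annihilator_preannihilator[OF V[OF that] fin[OF that] bspec[OF A that], symmetric])
    have "?P ?N" by (rule mp[OF spec[OF P]]) (rule ballI, rule N)
    moreover have "?P ?N \<longleftrightarrow> ?Q A" using N AN by (rule PQ)
    ultimately show "?Q A" by simp
  next
    fix N assume Q: "\<forall>A. (\<forall>i\<in>?I. VectorSpace.subspace K (A i) (?DV i)) \<longrightarrow> ?Q A"
      and N: "\<forall>i\<in>?I. VectorSpace.subspace K (N i) (V i)"
    have "?Q (\<lambda>i. annihilator K (V i) (N i))"
      by (rule mp[OF spec[OF Q]]) (rule ballI, rule annihilator_subspace'[OF _ bspec[OF N]])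
    moreover have "?P N \<longleftrightarrow> ?Q (\<lambda>i. annihilator K (V i) (N i))" using bspec[OF N] refl by (rule PQ)
    ultimately show "?P N" by simp
  qed
  moreover have "left_general_from K ?I V W U T \<longleftrightarrow>
      left_general_to K ?I (dual_space K U) ?DV (\<lambda>i. dual_space K (W i)) (dual_transformation K ?I V W T)"
    unfolding left_general_from_def left_general_to_def
  proof (rule general_subspaces_iff, rule PQ)
    fix N i assume N: "N \<in> (\<Pi>\<^sub>E i\<in>?I. {N. VectorSpace.subspace K N (V i)})" and i: "i \<in> ?I"
    show "VectorSpace.subspace K (N i) (V i)" using PiE_mem[OF N i] by (rule CollectD)
    show "annihilators N i = annihilator K (V i) (N i)" unfolding annihilators_def by (rule restrict_apply'[OF i])
  qed
  ultimately show ?thesis ..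
qed

end
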